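(* Let $\{R,F\}$ be a compatible pair of strict skew invertible R-matrices and $\mathcal M(R,F)$ the corresponding quantum matrix algebra. The formulas $$M^{\alpha^{(n)}}\star M^{\beta^{(i)}}:=M^{(\alpha^{(n)}\star\beta^{(i)})},\qquad \alpha^{(n)}\star\beta^{(i)}:=\alpha^{(n)}\,\beta^{(i)\uparrow n}\,(\sigma_n\cdots\sigma_2\sigma_1\sigma_2^{-1}\cdots\sigma_n^{-1}),$$ $$(I\,ch(\beta^{(i)}))\star M^{\alpha^{(n)}}:=M^{\alpha^{(n)}}\star(I\,ch(\beta^{(i)})):=M^{\alpha^{(n)}}ch(\beta^{(i)}),$$ $$(I\,ch(\alpha^{(i)}))\star(I\,ch(\beta^{(n)})):=I\,\big(ch(\alpha^{(i)})\,ch(\beta^{(n)})\big),$$ for $\alpha^{(n)}\in\mathbb C\mathcal B_n$, $\beta^{(i)}\in\mathbb C\mathcal B_i$ etc., define an associative multiplication on the space $\mathcal P(R,F)$, which agrees with its right $\mathcal C(R,F)$-module structure; in other words, the map $ch(\alpha^{(n)})\mapsto I\,ch(\alpha^{(n)})$ is an algebra monomorphism $\mathcal C(R,F)\hookrightarrow\mathcal P(R,F)$.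
   Context: Operators. $V$ is a complex vector space of finite dimension $N$ with a fixed basis (operators on $V^{\otimes n}$ are matrices), $I$ the identity, $P$ the flip on $V\otimes V$. For $X\in\mathrm{End}(V^{\otimes 2})$, $X_{mr}$ is $X$ acting in the tensor factors $m,r$ and trivially elsewhere, $X_m:=X_{m\,m+1}$; for an $N\times N$ matrix $Y$, $Y_m$ is $Y$ in factor $m$. $\mathrm{Tr}_{(i)}$ is the trace over the $i$-th factor. $X$ is skew invertible if there is $\Psi_X\in\mathrm{End}(V^{\otimes2})$ with $\mathrm{Tr}_{(2)}X_{12}(\Psi_X)_{23}=\mathrm{Tr}_{(2)}(\Psi_X)_{12}X_{23}=P_{13}$; then $C_X:=\mathrm{Tr}_{(1)}(\Psi_X)_{12}$, $D_X:=\mathrm{Tr}_{(2)}(\Psi_X)_{12}$, and $X$ is strict skew invertible if $C_X$ or $D_X$ is invertible. An R-matrix is an invertible $R\in\mathrm{End}(V^{\otimes 2})$ with $R_1R_2R_1=R_2R_1R_2$; it gives representations $\rho_R$ of the braid groups $\mathcal B_n$ (Artin generators $\sigma_1,\dots,\sigma_{n-1}$, $\mathcal B_1=\{1\}$) and of $\mathbb C\mathcal B_n$ on $V^{\otimes n}$, $\sigma_i\mapsto R_i$. A pair $\{R,F\}$ is compatible if $R_1F_2F_1=F_2F_1R_2$ and $R_2F_1F_2=F_1F_2R_1$. For skew invertible $R$ the R-trace over spaces $i_1,\dots,i_s$ is $\mathrm{Tr}_{R(i_1,\dots,i_s)}X:=\mathrm{Tr}_{(i_1,\dots,i_s)}\big((D_R)_{i_1}\cdots(D_R)_{i_s}X\big)$.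 For an $N\times N$ matrix $M$ put $M_{\overline1}:=M_1$, $M_{\overline i}:=F_{i-1}M_{\overline{i-1}}F_{i-1}^{-1}$. $\mathcal M(R,F)$ is the unital associative $\mathbb C$-algebra generated by the entries $M_a^b$ of $M$ with relations $R_1M_{\overline1}M_{\overline2}=M_{\overline1}M_{\overline2}R_1$. The characteristic subalgebra $\mathcal C(R,F)$ is the linear span of $1$ and all $ch(\alpha):=\mathrm{Tr}_{R(1,\dots,n)}(M_{\overline1}\cdots M_{\overline n}\,\rho_R(\alpha))$, $\alpha\in\mathbb C\mathcal B_n$, $n\ge1$; it is a commutative subalgebra of $\mathcal M(R,F)$. $\mathcal P(R,F)$ is the linear subspace of $\mathrm{Mat}_N(\mathcal M(R,F))$ spanned by $I\,c$, $c\in\mathcal C(R,F)$, and by the matrices $M^1:=M$ ($n=1$) and $(M^{\alpha^{(n)}})_1:=\mathrm{Tr}_{R(2,\dots,n)}(M_{\overline1}\cdots M_{\overline n}\,\rho_R(\alpha^{(n)}))$, $\alpha^{(n)}\in\mathbb C\mathcal B_n$, $n\ge2$. It is a right $\mathcal C(R,F)$-module by entrywise right multiplication; one has $M^{\alpha^{(n)}}ch(\beta^{(i)})=M^{(\alpha^{(n)}\beta^{(i)\uparrow n})}$. For $\beta\in\mathbb C\mathcal B_i$, $\beta^{\uparrow n}\in\mathbb C\mathcal B_{i+n}$ is its image under $\sigma_j\mapsto\sigma_{j+n}$; $\alpha^{(n)}\in\mathbb C\mathcal B_n$ without arrow is regarded as an element of $\mathbb C\mathcal B_{n+i}$ via $\sigma_j\mapsto\sigma_j$.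 For $n=1$ the factor $\sigma_n\cdots\sigma_1\sigma_2^{-1}\cdots\sigma_n^{-1}$ is $\sigma_1$. *)

theory Defs
  imports
    "HOL-Analysis.Analysis"
    "HOL-Library.Poly_Mapping"
    "HOL-Library.FuncSet"
    "HOL-Algebra.Module"
    "HOL-Algebra.QuotRing"
    "HOL-Algebra.Algebraic_Closure_Type"
begin

unbundle no fps_syntax

section \<open>Operators on tensor powers\<close>

text \<open>
  The index type \<open>'v\<close> labels the fixed basis of \<open>V\<close>, so \<open>N = CARD('v) \<ge> 1\<close>.  An element of
  \<open>End(V \<otimes> V)\<close> is a matrix whose rows and columns are labelled by pairs.  For a finite set \<open>A\<close> of
  tensor factors (numbered from 1, as usual), the basis of the tensor product of the copies of
  \<open>V\<close> in \<open>A\<close> is labelled by \<open>idx A\<close>; an operator is a function of a row and a column index,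
  with values in an arbitrary coefficient ring, of which only the values on \<open>idx A\<close> matter.
\<close>

type_synonym 'v mat1 = "complex ^ 'v ^ 'v"
type_synonym 'v mat2 = "complex ^ ('v \<times> 'v) ^ ('v \<times> 'v)"
type_synonym ('v, 'a) tens_op = "(nat \<Rightarrow> 'v) \<Rightarrow> (nat \<Rightarrow> 'v) \<Rightarrow> 'a"

definition idx :: "nat set \<Rightarrow> (nat \<Rightarrow> 'v) set" where
  "idx A = PiE A (\<lambda>_. UNIV)"

definition op_eq :: "nat set \<Rightarrow> ('v, 'a) tens_op \<Rightarrow> ('v, 'a) tens_op \<Rightarrow> bool" where
  "op_eq A T Y \<longleftrightarrow> (\<forall>i\<in>idx A. \<forall>j\<in>idx A. T i j = Y i j)"

definition op_one :: "('v, 'a::zero_neq_one) tens_op" where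
  "op_one i j = (if i = j then 1 else 0)"

definition op_mult ::
  "nat set \<Rightarrow> ('v, 'a::semiring_0) tens_op \<Rightarrow> ('v, 'a) tens_op \<Rightarrow> ('v, 'a) tens_op" where
  "op_mult A T Y i j = (\<Sum>k\<in>idx A. T i k * Y k j)"

definition act1 :: "nat set \<Rightarrow> nat \<Rightarrow> 'a::zero ^ 'v::finite ^ 'v \<Rightarrow> ('v, 'a) tens_op" where
  "act1 A m Y i j = (if \<forall>k\<in>A - {m}. i k = j k then Y $ (i m) $ (j m) else 0)"

definition act2 ::
  "nat set \<Rightarrow> nat \<Rightarrow> nat \<Rightarrow> 'a::zero ^ ('v::finite \<times> 'v) ^ ('v \<times> 'v) \<Rightarrow> ('v, 'a) tens_op" where
  "act2 A m r T i j =
     (if \<forall>k\<in>A - {m, r}. i k = j k then T $ (i m, i r) $ (j m, j r) else 0)"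

text \<open>The trace over the factors in \<open>S\<close> turns an operator on the factors \<open>A\<close> (with \<open>S \<subseteq> A\<close>)
  into one on the factors \<open>A - S\<close>.\<close>

definition ptrace :: "nat set \<Rightarrow> ('v, 'a::comm_monoid_add) tens_op \<Rightarrow> ('v, 'a) tens_op" where
  "ptrace S T i j = (\<Sum>t\<in>idx S. T (override_on i t S) (override_on j t S))"

section \<open>R-matrices, skew invertibility, compatible pairs\<close>

definition flip :: "'v::finite mat2" where
  "flip = (\<chi> p q. if fst p = snd q \<and> snd p = fst q then 1 else 0)"

definition R_matrix :: "'v::finite mat2 \<Rightarrow> bool" where
  "R_matrix R \<longleftrightarrow> invertible R \<and>
     (let A = {1, 2, 3}; R1 = act2 A 1 2 R; R2 = act2 A 2 3 R in
      op_eq A (op_mult A R1 (op_mult A R2 R1)) (op_mult A R2 (op_mult A R1 R2)))"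

definition is_skew_inverse :: "'v::finite mat2 \<Rightarrow> 'v mat2 \<Rightarrow> bool" where
  "is_skew_inverse T \<Psi> \<longleftrightarrow>
     (let A = {1, 2, 3} in
      op_eq {1, 3} (ptrace {2} (op_mult A (act2 A 1 2 T) (act2 A 2 3 \<Psi>))) (act2 {1, 3} 1 3 flip) \<and>
      op_eq {1, 3} (ptrace {2} (op_mult A (act2 A 1 2 \<Psi>) (act2 A 2 3 T))) (act2 {1, 3} 1 3 flip))"

definition skew_invertible :: "'v::finite mat2 \<Rightarrow> bool" where
  "skew_invertible T \<longleftrightarrow> (\<exists>\<Psi>. is_skew_inverse T \<Psi>)"

text \<open>The skew inverse is unique when it exists; the choice is irrelevant.\<close>

definition skew_inv :: "'v::finite mat2 \<Rightarrow> 'v mat2" where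
  "skew_inv T = (SOME \<Psi>. is_skew_inverse T \<Psi>)"

definition C_mat :: "'v::finite mat2 \<Rightarrow> 'v mat1" where
  "C_mat T = (\<chi> a b. \<Sum>c\<in>UNIV. skew_inv T $ (c, a) $ (c, b))"

definition D_mat :: "'v::finite mat2 \<Rightarrow> 'v mat1" where
  "D_mat T = (\<chi> a b. \<Sum>c\<in>UNIV. skew_inv T $ (a, c) $ (b, c))"

definition strict_skew_invertible :: "'v::finite mat2 \<Rightarrow> bool" where
  "strict_skew_invertible T \<longleftrightarrow>
     skew_invertible T \<and> (invertible (C_mat T) \<or> invertible (D_mat T))"

definition compatible_pair :: "'v::finite mat2 \<Rightarrow> 'v mat2 \<Rightarrow> bool" where
  "compatible_pair R F \<longleftrightarrow>
     (let A = {1, 2, 3};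
          R1 = act2 A 1 2 R; R2 = act2 A 2 3 R; F1 = act2 A 1 2 F; F2 = act2 A 2 3 F in
      op_eq A (op_mult A R1 (op_mult A F2 F1)) (op_mult A F2 (op_mult A F1 R2)) \<and>
      op_eq A (op_mult A R2 (op_mult A F1 F2)) (op_mult A F1 (op_mult A F2 R1)))"

section \<open>Braid groups and their group algebras\<close>

text \<open>Words in the Artin generators: \<open>(i, True)\<close> is \<open>\<sigma>\<^sub>i\<close> and \<open>(i, False)\<close> is its inverse.\<close>

type_synonym bword = "(nat \<times> bool) list"

definition bwords :: "nat \<Rightarrow> bword set" where
  "bwords n = lists ({1..<n} \<times> UNIV)"

inductive braid_eq :: "nat \<Rightarrow> bword \<Rightarrow> bword \<Rightarrow> bool" for n where
  refl: "w \<in> bwords n \<Longrightarrow> braid_eq n w w"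
| sym: "braid_eq n u v \<Longrightarrow> braid_eq n v u"
| trans: "braid_eq n u v \<Longrightarrow> braid_eq n v w \<Longrightarrow> braid_eq n u w"
| cong: "braid_eq n u u' \<Longrightarrow> braid_eq n v v' \<Longrightarrow> braid_eq n (u @ v) (u' @ v')"
| cancel: "i \<in> {1..<n} \<Longrightarrow> braid_eq n [(i, e), (i, \<not> e)] []"
| braid: "i \<in> {1..<n} \<Longrightarrow> i + 1 \<in> {1..<n} \<Longrightarrow>
    braid_eq n [(i, True), (i + 1, True), (i, True)] [(i + 1, True), (i, True), (i + 1, True)]"
| far: "i \<in> {1..<n} \<Longrightarrow> j \<in> {1..<n} \<Longrightarrow> i + 2 \<le> j \<Longrightarrow>
    braid_eq n [(i, True), (j, True)] [(j, True), (i, True)]"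

type_synonym braid = "bword set"

definition braid_rel :: "nat \<Rightarrow> (bword \<times> bword) set" where
  "braid_rel n = {(u, v). braid_eq n u v}"

definition braid_class :: "nat \<Rightarrow> bword \<Rightarrow> braid" where
  "braid_class n w = braid_rel n `` {w}"

definition braid_group :: "nat \<Rightarrow> braid monoid" where
  "braid_group n =
     \<lparr>carrier = bwords n // braid_rel n,
      mult = (\<lambda>a b. braid_rel n `` {u @ v | u v. u \<in> a \<and> v \<in> b}),
      one = braid_class n []\<rparr>"

text \<open>\<open>braid_embed k m\<close> is the homomorphism from a braid group to the braid group on \<open>m\<close> strands
  given by \<open>\<sigma>\<^sub>j \<mapsto> \<sigma>\<^bsub>j+k\<^esub>\<close>.\<close>

definition braid_embed :: "nat \<Rightarrow> nat \<Rightarrow> braid \<Rightarrow> braid" where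
  "braid_embed k m a = braid_rel m `` (map (map_prod (\<lambda>j. j + k) id) ` a)"

type_synonym galg = "braid \<Rightarrow>\<^sub>0 complex"

definition braid_algebra :: "nat \<Rightarrow> galg set" where
  "braid_algebra n = {\<alpha>. Poly_Mapping.keys \<alpha> \<subseteq> carrier (braid_group n)}"

definition galg_mult :: "nat \<Rightarrow> galg \<Rightarrow> galg \<Rightarrow> galg" where
  "galg_mult n \<alpha> \<beta> = (\<Sum>a\<in>Poly_Mapping.keys \<alpha>. \<Sum>b\<in>Poly_Mapping.keys \<beta>.
     Poly_Mapping.single (a \<otimes>\<^bsub>braid_group n\<^esub> b) (Poly_Mapping.lookup \<alpha> a * Poly_Mapping.lookup \<beta> b))"

definition galg_embed :: "nat \<Rightarrow> nat \<Rightarrow> galg \<Rightarrow> galg" where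
  "galg_embed k m \<alpha> = (\<Sum>a\<in>Poly_Mapping.keys \<alpha>. Poly_Mapping.single (braid_embed k m a) (Poly_Mapping.lookup \<alpha> a))"

definition star_word :: "nat \<Rightarrow> bword" where
  "star_word n =
     map (\<lambda>j. (j, True)) (rev [1..<n + 1]) @ map (\<lambda>j. (j, False)) [2..<n + 1]"

definition galg_star :: "nat \<Rightarrow> nat \<Rightarrow> galg \<Rightarrow> galg \<Rightarrow> galg" where
  "galg_star n i \<alpha> \<beta> =
     galg_mult (n + i)
       (galg_mult (n + i) (galg_embed 0 (n + i) \<alpha>) (galg_embed n (n + i) \<beta>))
       (Poly_Mapping.single (braid_class (n + i) (star_word n)) 1)"

text \<open>The representation \<open>\<rho>\<^sub>R\<close>.  The value on a braid is computed from an arbitrary word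
  representing it; for an R-matrix the result does not depend on the word.\<close>

definition rho_letter :: "nat \<Rightarrow> 'v::finite mat2 \<Rightarrow> nat \<times> bool \<Rightarrow> ('v, complex) tens_op" where
  "rho_letter n R l =
     act2 {1..n} (fst l) (fst l + 1) (if snd l then R else matrix_inv R)"

definition rho_word :: "nat \<Rightarrow> 'v::finite mat2 \<Rightarrow> bword \<Rightarrow> ('v, complex) tens_op" where
  "rho_word n R w = foldr (\<lambda>l T. op_mult {1..n} (rho_letter n R l) T) w op_one"

definition rho :: "nat \<Rightarrow> 'v::finite mat2 \<Rightarrow> galg \<Rightarrow> ('v, complex) tens_op" where
  "rho n R \<alpha> i j = (\<Sum>a\<in>Poly_Mapping.keys \<alpha>. Poly_Mapping.lookup \<alpha> a * rho_word n R (SOME w. w \<in> a) i j)"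

section \<open>Associative unital complex algebras, linear spans, matrices\<close>

text \<open>A complex algebra is a record carrying a ring structure and a scalar multiplication
  (the locale \<open>algebra\<close> of the library covers commutative algebras only).\<close>

abbreviation cplx :: "complex ring" where
  "cplx \<equiv> ring_of_type_algebra"

definition complex_algebra :: "(complex, 'a) module \<Rightarrow> bool" where
  "complex_algebra A \<longleftrightarrow> ring A \<and> Module.module cplx A \<and>
     (\<forall>c. \<forall>x\<in>carrier A. \<forall>y\<in>carrier A.
        (c \<odot>\<^bsub>A\<^esub> x) \<otimes>\<^bsub>A\<^esub> y = c \<odot>\<^bsub>A\<^esub> (x \<otimes>\<^bsub>A\<^esub> y) \<and>
        x \<otimes>\<^bsub>A\<^esub> (c \<odot>\<^bsub>A\<^esub> y) = c \<odot>\<^bsub>A\<^esub> (x \<otimes>\<^bsub>A\<^esub> y))"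

definition algebra_mono ::
  "(complex, 'a) module \<Rightarrow> (complex, 'b) module \<Rightarrow> ('a \<Rightarrow> 'b) \<Rightarrow> bool" where
  "algebra_mono A B h \<longleftrightarrow> complex_algebra A \<and> complex_algebra B \<and> h \<in> ring_hom A B \<and>
     (\<forall>c. \<forall>x\<in>carrier A. h (c \<odot>\<^bsub>A\<^esub> x) = c \<odot>\<^bsub>B\<^esub> h x) \<and> inj_on h (carrier A)"

definition lin_span :: "(complex, 'a) module \<Rightarrow> 'a set \<Rightarrow> 'a set" where
  "lin_span A S = \<Inter>{H. submodule H cplx A \<and> S \<subseteq> H}"

definition bilinear_mult :: "(complex, 'a) module \<Rightarrow> 'a set \<Rightarrow> ('a \<Rightarrow> 'a \<Rightarrow> 'a) \<Rightarrow> bool" where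
  "bilinear_mult A P s \<longleftrightarrow>
     (\<forall>x\<in>P. \<forall>y\<in>P. s x y \<in> P) \<and>
     (\<forall>x\<in>P. \<forall>y\<in>P. \<forall>z\<in>P. s (x \<oplus>\<^bsub>A\<^esub> y) z = s x z \<oplus>\<^bsub>A\<^esub> s y z \<and>
                            s z (x \<oplus>\<^bsub>A\<^esub> y) = s z x \<oplus>\<^bsub>A\<^esub> s z y) \<and>
     (\<forall>c. \<forall>x\<in>P. \<forall>y\<in>P. s (c \<odot>\<^bsub>A\<^esub> x) y = c \<odot>\<^bsub>A\<^esub> s x y \<and> s x (c \<odot>\<^bsub>A\<^esub> y) = c \<odot>\<^bsub>A\<^esub> s x y)"

definition scalar_mat :: "(complex, 'a) module \<Rightarrow> 'a \<Rightarrow> 'a ^ 'v::finite ^ 'v" where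
  "scalar_mat A c = (\<chi> a b. if a = b then c else \<zero>\<^bsub>A\<^esub>)"

definition mat_rmult :: "(complex, 'a) module \<Rightarrow> 'a ^ 'v::finite ^ 'v \<Rightarrow> 'a \<Rightarrow> 'a ^ 'v ^ 'v" where
  "mat_rmult A T c = (\<chi> a b. T $ a $ b \<otimes>\<^bsub>A\<^esub> c)"

definition mat_algebra ::
  "(complex, 'a) module \<Rightarrow> (complex, 'a ^ 'v::finite ^ 'v) module" where
  "mat_algebra A =
     \<lparr>carrier = {T. \<forall>a b. T $ a $ b \<in> carrier A},
      mult = (\<lambda>T Y. \<chi> a b. \<Oplus>\<^bsub>A\<^esub>c\<in>UNIV. T $ a $ c \<otimes>\<^bsub>A\<^esub> Y $ c $ b),
      one = scalar_mat A \<one>\<^bsub>A\<^esub>,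
      zero = scalar_mat A \<zero>\<^bsub>A\<^esub>,
      add = (\<lambda>T Y. \<chi> a b. T $ a $ b \<oplus>\<^bsub>A\<^esub> Y $ a $ b),
      smult = (\<lambda>c T. \<chi> a b. c \<odot>\<^bsub>A\<^esub> (T $ a $ b))\<rparr>"

section \<open>The quantum matrix algebra\<close>

text \<open>The free algebra is the algebra of finitely supported functions on the free monoid.\<close>

datatype 'g monomial = Monomial (letters: "'g list")

instantiation monomial :: (type) monoid_add
begin

definition zero_monomial :: "'a monomial" where
  "zero_monomial = Monomial []"

definition plus_monomial :: "'a monomial \<Rightarrow> 'a monomial \<Rightarrow> 'a monomial" where
  "plus_monomial u v = Monomial (letters u @ letters v)"

instance
  by standard (simp_all add: zero_monomial_def plus_monomial_def)

end

type_synonym 'g free_alg = "'g monomial \<Rightarrow>\<^sub>0 complex"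

definition fconst :: "complex \<Rightarrow> 'g free_alg" where
  "fconst c = Poly_Mapping.single 0 c"

definition fgen :: "'g \<Rightarrow> 'g free_alg" where
  "fgen g = Poly_Mapping.single (Monomial [g]) 1"

definition op_const :: "('v, complex) tens_op \<Rightarrow> ('v, 'g free_alg) tens_op" where
  "op_const T i j = fconst (T i j)"

text \<open>The matrix of free generators, and the operators \<open>M\<^bsub>\<overline>k\<^esub>\<close> built from it, acting
  on the tensor factors in \<open>A\<close> (the value at 0 is not used).\<close>

definition gen_mat :: "('v \<times> 'v) free_alg ^ 'v::finite ^ 'v" where
  "gen_mat = (\<chi> a b. fgen (a, b))"

fun Mbar :: "'v::finite mat2 \<Rightarrow> nat set \<Rightarrow> nat \<Rightarrow> ('v, ('v \<times> 'v) free_alg) tens_op" where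
  "Mbar F A 0 = op_one"
| "Mbar F A (Suc 0) = act1 A 1 gen_mat"
| "Mbar F A (Suc (Suc k)) =
     op_mult A (op_const (act2 A (Suc k) (Suc (Suc k)) F))
       (op_mult A (Mbar F A (Suc k))
          (op_const (act2 A (Suc k) (Suc (Suc k)) (matrix_inv F))))"

definition Mbar_prod :: "'v::finite mat2 \<Rightarrow> nat \<Rightarrow> ('v, ('v \<times> 'v) free_alg) tens_op" where
  "Mbar_prod F n = foldr (\<lambda>k T. op_mult {1..n} (Mbar F {1..n} k) T) [1..<n + 1] op_one"

definition qma_relations :: "'v::finite mat2 \<Rightarrow> 'v mat2 \<Rightarrow> ('v \<times> 'v) free_alg set" where
  "qma_relations R F =
     (let R1 = op_const (act2 {1..2} 1 2 R); MM = Mbar_prod F 2 in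
      {op_mult {1..2} R1 MM i j - op_mult {1..2} MM R1 i j | i j.
         i \<in> idx {1..2} \<and> j \<in> idx {1..2}})"

definition qma_ideal :: "'v::finite mat2 \<Rightarrow> 'v mat2 \<Rightarrow> ('v \<times> 'v) free_alg set" where
  "qma_ideal R F = Idl\<^bsub>ring_of_type_algebra\<^esub> (qma_relations R F)"

definition qproj ::
  "'v::finite mat2 \<Rightarrow> 'v mat2 \<Rightarrow> ('v \<times> 'v) free_alg \<Rightarrow> ('v \<times> 'v) free_alg set" where
  "qproj R F x = qma_ideal R F +>\<^bsub>ring_of_type_algebra\<^esub> x"

definition qma ::
  "'v::finite mat2 \<Rightarrow> 'v mat2 \<Rightarrow> (complex, ('v \<times> 'v) free_alg set) module" where
  "qma R F =
     (let Q = ring_of_type_algebra Quot qma_ideal R F in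
      \<lparr>carrier = carrier Q, mult = mult Q, one = one Q, zero = zero Q, add = add Q,
       smult = (\<lambda>c x. qproj R F (fconst c) \<otimes>\<^bsub>Q\<^esub> x)\<rparr>)"

section \<open>Characteristic subalgebra and the space of matrix powers\<close>

text \<open>\<open>Rtrace R A S T\<close> is the R-trace, over the factors in the list \<open>S\<close>, of an operator \<open>T\<close>
  on the factors \<open>A\<close>.\<close>

definition D_prod :: "'v::finite mat2 \<Rightarrow> nat set \<Rightarrow> nat list \<Rightarrow> ('v, complex) tens_op" where
  "D_prod R A S = foldr (\<lambda>k T. op_mult A (act1 A k (D_mat R)) T) S op_one"

definition Rtrace ::
  "'v::finite mat2 \<Rightarrow> nat set \<Rightarrow> nat list \<Rightarrow>
     ('v, 'g free_alg) tens_op \<Rightarrow> ('v, 'g free_alg) tens_op" where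
  "Rtrace R A S T = ptrace (set S) (op_mult A (op_const (D_prod R A S)) T)"

text \<open>Traces are evaluated on the free generators and then projected to the quantum matrix
  algebra; as the projection is an algebra homomorphism this is the same as evaluating them on
  the classes of the generators.  The trace over all factors is an operator on the empty set of
  factors, i.e. a single entry.\<close>

definition ch ::
  "'v::finite mat2 \<Rightarrow> 'v mat2 \<Rightarrow> nat \<Rightarrow> galg \<Rightarrow> ('v \<times> 'v) free_alg set" where
  "ch R F n \<alpha> = qproj R F
     (Rtrace R {1..n} [1..<n + 1]
        (op_mult {1..n} (Mbar_prod F n) (op_const (rho n R \<alpha>)))
        (\<lambda>_. undefined) (\<lambda>_. undefined))"

definition Mpow ::
  "'v::finite mat2 \<Rightarrow> 'v mat2 \<Rightarrow> nat \<Rightarrow> galg \<Rightarrow> ('v \<times> 'v) free_alg set ^ 'v ^ 'v" where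
  "Mpow R F n \<alpha> = (\<chi> a b. qproj R F
     (Rtrace R {1..n} [2..<n + 1]
        (op_mult {1..n} (Mbar_prod F n) (op_const (rho n R \<alpha>)))
        (\<lambda>k\<in>{1}. a) (\<lambda>k\<in>{1}. b)))"

text \<open>The spanning set of the characteristic subalgebra; its element 1 plays the role of the
  characteristic element of the empty braid.\<close>

definition char_gens :: "'v::finite mat2 \<Rightarrow> 'v mat2 \<Rightarrow> ('v \<times> 'v) free_alg set set" where
  "char_gens R F = {\<one>\<^bsub>qma R F\<^esub>} \<union> {ch R F n \<alpha> | n \<alpha>. n \<ge> 1 \<and> \<alpha> \<in> braid_algebra n}"

definition char_space :: "'v::finite mat2 \<Rightarrow> 'v mat2 \<Rightarrow> ('v \<times> 'v) free_alg set set" where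
  "char_space R F = lin_span (qma R F) (char_gens R F)"

definition char_subalgebra ::
  "'v::finite mat2 \<Rightarrow> 'v mat2 \<Rightarrow> (complex, ('v \<times> 'v) free_alg set) module" where
  "char_subalgebra R F = (qma R F)\<lparr>carrier := char_space R F\<rparr>"

definition power_space ::
  "'v::finite mat2 \<Rightarrow> 'v mat2 \<Rightarrow> (('v \<times> 'v) free_alg set ^ 'v ^ 'v) set" where
  "power_space R F = lin_span (mat_algebra (qma R F))
     ({scalar_mat (qma R F) c | c. c \<in> char_space R F} \<union>
      {Mpow R F n \<alpha> | n \<alpha>. n \<ge> 1 \<and> \<alpha> \<in> braid_algebra n})"

text \<open>The defining formulas of the multiplication.  Those involving \<open>I ch(\<beta>)\<close> are imposed for all
  elements of the spanning set of the characteristic subalgebra, including 1.\<close>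

definition star_formulas ::
  "'v::finite mat2 \<Rightarrow> 'v mat2 \<Rightarrow>
     (('v \<times> 'v) free_alg set ^ 'v ^ 'v \<Rightarrow> ('v \<times> 'v) free_alg set ^ 'v ^ 'v \<Rightarrow>
      ('v \<times> 'v) free_alg set ^ 'v ^ 'v) \<Rightarrow> bool" where
  "star_formulas R F s \<longleftrightarrow>
     (\<forall>n\<ge>1. \<forall>i\<ge>1. \<forall>\<alpha>\<in>braid_algebra n. \<forall>\<beta>\<in>braid_algebra i.
        s (Mpow R F n \<alpha>) (Mpow R F i \<beta>) = Mpow R F (n + i) (galg_star n i \<alpha> \<beta>)) \<and>
     (\<forall>n\<ge>1. \<forall>\<alpha>\<in>braid_algebra n. \<forall>c\<in>char_gens R F.
        s (scalar_mat (qma R F) c) (Mpow R F n \<alpha>) = mat_rmult (qma R F) (Mpow R F n \<alpha>) c \<and>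
        s (Mpow R F n \<alpha>) (scalar_mat (qma R F) c) = mat_rmult (qma R F) (Mpow R F n \<alpha>) c) \<and>
     (\<forall>c\<in>char_gens R F. \<forall>d\<in>char_gens R F.
        s (scalar_mat (qma R F) c) (scalar_mat (qma R F) d) =
          scalar_mat (qma R F) (c \<otimes>\<^bsub>qma R F\<^esub> d))"

definition power_algebra ::
  "'v::finite mat2 \<Rightarrow> 'v mat2 \<Rightarrow>
     (('v \<times> 'v) free_alg set ^ 'v ^ 'v \<Rightarrow> ('v \<times> 'v) free_alg set ^ 'v ^ 'v \<Rightarrow>
      ('v \<times> 'v) free_alg set ^ 'v ^ 'v) \<Rightarrow>
     (complex, ('v \<times> 'v) free_alg set ^ 'v ^ 'v) module" where
  "power_algebra R F s = (mat_algebra (qma R F))\<lparr>carrier := power_space R F, mult := s\<rparr>"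

end

theory Submission
  imports Defs
begin

text \<open>
  \<open>M\<^bsup>\<alpha>\<star>\<beta>\<^esup>\<close> can be written in two ways.  Taking the R-trace over the last factors first gives an expression
  \<open>R\<^bsub>\<alpha>\<^esub>(M\<^bsup>\<beta>\<^esup>)\<close> in which \<open>\<beta>\<close> enters only through the matrix \<open>M\<^bsup>\<beta>\<^esup>\<close>.  The braid that exchanges the first
  \<open>n\<close> strands with the last \<open>i\<close> ones commutes with \<open>M\<^sub>1\<dots>M\<^bsub>n+i\<^esub>\<close> (overlined indices) modulo the
  relations, and almost all of it can be moved around by the cyclicity of the R-trace; conjugating with
  it gives an expression \<open>L\<^bsub>\<beta>\<^esub>(M\<^bsup>\<alpha>\<^esup>)\<close> in which \<open>\<alpha>\<close> enters only through \<open>M\<^bsup>\<alpha>\<^esup>\<close>.  So the product is well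
  defined and bilinear.  The same exchange under the full trace shows that \<open>\<C>(R,F)\<close> is commutative.
  Associativity is the equality \<open>L\<^bsub>\<gamma>\<^esub>R\<^bsub>\<alpha>\<^esub> = R\<^bsub>\<alpha>\<^esub>L\<^bsub>\<gamma>\<^esub>\<close>, which comes from the braid identity
  \<open>s\<^sub>n s\<^bsub>n+i\<^esub> = s\<^sub>i\<^bsup>\<up>n\<^esup> s\<^sub>n\<close> for \<open>s\<^sub>n = \<sigma>\<^sub>n\<dots>\<sigma>\<^sub>2\<sigma>\<^sub>1\<sigma>\<^sub>2\<^sup>-\<^sup>1\<dots>\<sigma>\<^sub>n\<^sup>-\<^sup>1\<close>.  The properties of the R-trace
  follow by contracting the braid and compatibility relations with the skew inverse of \<open>R\<close>.

  The factors are not counted: every operator acts on an infinite tensor power of \<open>V\<close>, as a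
  row-finite matrix over the free algebra, and identities hold up to matrices with entries in the
  ideal of relations.
\<close>

text \<open>The obstacle is that a matrix in \<open>power_space\<close> determines neither the
  braids nor the numbers of strands in a presentation of it, so formulas given on braids need not
  define a map on matrices. It suffices that the product of two spanning elements is, for a fixed
  left one, a linear function of the right matrix, and for a fixed right one, a linear function of
  the left matrix: a vanishing combination on either side then has vanishing products. This is why
  two expressions are needed. Both are linear over the characteristic elements, and at the identity
  matrix they return M^\<alpha> and M^\<beta>, because the conjugates of R that they contain have
  R-trace 1 over their last factor; so the formulas with I c fit the others.

  The factor s_n compensates for the untraced factor 1. The exchange W of the two blocks moves the
  first strand and cannot be cycled under the trace over the factors 2, 3, ...; but W s_n involves
  only the strands from 2 on, so it can. Written as s' W, the same element yields the exchange on
  the other side, and s' is the conjugate of R that remains there.\<close>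

unbundle no fps_syntax
no_notation fps_nth (infixl "$" 75)

subsection \<open>Braided operators and block exchanges\<close>

lemma assoc_eq: "a * b = c * d \<Longrightarrow> a * (b * x) = c * (d * (x::'a::semigroup_mult))"
  by (simp only: mult.assoc[symmetric])

lemma assoc_eq3: "a * (b * c) = d * (e * g) \<Longrightarrow> a * (b * (c * x)) = d * (e * (g * (x::'a::semigroup_mult)))"
  by (simp only: mult.assoc[symmetric])

lemma intertwine_inverse:
  fixes a :: "'a::monoid_mult"
  assumes "a * x = y * a" "x * x' = 1" "y' * y = 1"
  shows "a * x' = y' * a"
proof -
  have "a * x' = (y' * y) * (a * x')" by (simp add: assms(3))
  also have "\<dots> = y' * ((a * x) * x')" by (simp only: assms(1) mult.assoc)
  also have "\<dots> = y' * (a * (x * x'))" by (simp only: mult.assoc)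
  finally show ?thesis by (simp add: assms(2))
qed

text \<open>\<open>loc A x\<close> stands for \<open>x\<close> acting trivially outside the factors in \<open>A\<close>, \<open>cst x\<close> for \<open>x\<close> having scalar
  entries, \<open>tr k\<close> for the R-trace over the factor \<open>k\<close>, and \<open>sh\<close> for the shift of all factors by one.\<close>

locale local_operators =
  fixes loc :: "nat set \<Rightarrow> 'o::ring_1 \<Rightarrow> bool" and cst :: "'o \<Rightarrow> bool"
    and tr :: "nat \<Rightarrow> 'o \<Rightarrow> 'o" and sh :: "'o \<Rightarrow> 'o"
  assumes loc_mono: "loc A x \<Longrightarrow> A \<subseteq> B \<Longrightarrow> loc B x"
    and loc_UNIV: "loc UNIV x"
    and loc_one: "loc A 1"
    and loc_mult: "loc A x \<Longrightarrow> loc A y \<Longrightarrow> loc A (x * y)"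
    and loc_add: "loc A x \<Longrightarrow> loc A y \<Longrightarrow> loc A (x + y)"
    and cst_one: "cst 1"
    and cst_mult: "cst x \<Longrightarrow> cst y \<Longrightarrow> cst (x * y)"
    and cst_add: "cst x \<Longrightarrow> cst y \<Longrightarrow> cst (x + y)"
    and com: "cst x \<Longrightarrow> loc A x \<Longrightarrow> loc B y \<Longrightarrow> A \<inter> B = {} \<Longrightarrow> x * y = y * x"
    and tr_add: "tr k (x + y) = tr k x + tr k y"
    and tr_loc: "loc A x \<Longrightarrow> loc (A - {k}) (tr k x)"
    and tr_left: "loc A a \<Longrightarrow> k \<notin> A \<Longrightarrow> finite A \<Longrightarrow> tr k (a * x) = a * tr k x"
    and tr_right: "loc A a \<Longrightarrow> k \<notin> A \<Longrightarrow> finite A \<Longrightarrow> tr k (x * a) = tr k x * a"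
    and sh_one: "sh 1 = 1"
    and sh_mult: "sh (x * y) = sh x * sh y"
    and sh_add: "sh (x + y) = sh x + sh y"
    and sh_loc: "loc A x \<Longrightarrow> loc (Suc ` A) (sh x)"
    and sh_cst: "cst x \<Longrightarrow> cst (sh x)"
    and sh_scalar: "loc {} x \<Longrightarrow> sh x = x"
begin

definition scalars :: "'o set" where
  "scalars = {z. cst z \<and> loc {} z}"

text \<open>An operator acting in no factor is disjoint even from \<open>UNIV\<close>, so
  \<open>com\<close> applies without any locality of \<open>y\<close>.\<close>

lemma scalar_com: "z \<in> scalars \<Longrightarrow> z * y = y * z"
  using com[of z "{}" UNIV y] by (auto simp: scalars_def loc_UNIV)

text \<open>The R-trace over the factors \<open>k + 1\<close>, ..., \<open>k + n\<close>, the
  highest one innermost. Operators on low factors can thus be pulled out of the inner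
  traces.\<close>

fun trs :: "nat \<Rightarrow> nat \<Rightarrow> 'o \<Rightarrow> 'o" where
  "trs k 0 x = x"
| "trs k (Suc n) x = trs k n (tr (k + n + 1) x)"

lemma trs_append: "trs k (n + i) x = trs k n (trs (k + n) i x)"
  by (induction i arbitrary: x) (auto simp: add.assoc)

lemma trs_add: "trs k n (x + y) = trs k n x + trs k n y"
  by (induction n arbitrary: x y) (auto simp: tr_add)

lemma trs_left: "loc A a \<Longrightarrow> A \<inter> {k + 1..k + n} = {} \<Longrightarrow> finite A \<Longrightarrow> trs k n (a * x) = a * trs k n x"
proof (induction n arbitrary: x)
  case (Suc n)
  have "tr (k + n + 1) (a * x) = a * tr (k + n + 1) x"
    using Suc.prems by (intro tr_left[of A]) auto
  moreover have "A \<inter> {k + 1..k + n} = {}" using Suc.prems by auto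
  ultimately show ?case using Suc.IH Suc.prems by simp
qed auto

lemma trs_right: "loc A a \<Longrightarrow> A \<inter> {k + 1..k + n} = {} \<Longrightarrow> finite A \<Longrightarrow> trs k n (x * a) = trs k n x * a"
proof (induction n arbitrary: x)
  case (Suc n)
  have "tr (k + n + 1) (x * a) = tr (k + n + 1) x * a"
    using Suc.prems by (intro tr_right[of A]) auto
  moreover have "A \<inter> {k + 1..k + n} = {}" using Suc.prems by auto
  ultimately show ?case using Suc.IH Suc.prems by simp
qed auto

lemma trs_loc: "loc A x \<Longrightarrow> loc (A - {k + 1..k + n}) (trs k n x)"
proof (induction n arbitrary: x A)
  case (Suc n)
  have "loc (A - {k + n + 1} - {k + 1..k + n}) (trs k n (tr (k + n + 1) x))"
    using Suc by (blast intro: tr_loc)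
  moreover have "A - {k + n + 1} - {k + 1..k + n} = A - {k + 1..k + Suc n}" by auto
  ultimately show ?case by simp
qed auto

lemma shn_simps:
  "(sh ^^ n) 1 = 1" "(sh ^^ n) (x * y) = (sh ^^ n) x * (sh ^^ n) y"
  "(sh ^^ n) (x + y) = (sh ^^ n) x + (sh ^^ n) y"
  "loc {} x \<Longrightarrow> (sh ^^ n) x = x"
  by (induction n) (auto simp: sh_one sh_mult sh_add sh_scalar)

lemma shn_loc: "loc A x \<Longrightarrow> loc ((\<lambda>j. j + n) ` A) ((sh ^^ n) x)"
proof (induction n)
  case (Suc n)
  then have "loc (Suc ` (\<lambda>j. j + n) ` A) (sh ((sh ^^ n) x))" by (blast intro: sh_loc)
  moreover have "Suc ` (\<lambda>j. j + n) ` A = (\<lambda>j. j + Suc n) ` A" by (auto simp: image_image)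
  ultimately show ?case by simp
qed (auto intro: loc_mono)

lemma shn_cst: "cst x \<Longrightarrow> cst ((sh ^^ n) x)"
  by (induction n) (auto intro: sh_cst)

end

text \<open>Two properties of the R-trace are added to the braid relations. \<open>tr_r\<close> is
  the normalization Tr_R R = 1 over the second factor. \<open>tr_cyc\<close> is cyclicity, claimed
  only for \<open>r k\<close>, with which D_k D_(k+1) commutes.\<close>

locale braided_operators = local_operators loc cst tr sh
  for loc :: "nat set \<Rightarrow> 'o::ring_1 \<Rightarrow> bool" and cst tr sh +
  fixes r ri :: "nat \<Rightarrow> 'o"
  assumes r_inv: "r k * ri k = 1" "ri k * r k = 1"
    and r_loc: "loc {k, k + 1} (r k)" "loc {k, k + 1} (ri k)"
    and r_cst: "cst (r k)" "cst (ri k)"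
    and r_braid: "r k * (r (Suc k) * r k) = r (Suc k) * (r k * r (Suc k))"
    and tr_r: "tr (Suc k) (r k) = 1"
    and tr_cyc: "tr k (tr (Suc k) (r k * x)) = tr k (tr (Suc k) (x * r k))"
    and sh_r: "sh (r k) = r (Suc k)" "sh (ri k) = ri (Suc k)"
begin

lemma r_inv_left: "r k * (ri k * x) = x" "ri k * (r k * x) = x"
  by (simp_all add: r_inv mult.assoc[symmetric])

section \<open>The algebra of braids on an interval of strands, and cyclicity of the R-trace\<close>

lemma far_com:
  assumes "j + 1 < k \<or> k + 1 < j"
  shows "r j * r k = r k * r j" "ri j * r k = r k * ri j" "ri j * ri k = ri k * ri j"
  by (intro com[of _ "{j, j + 1}" "{k, k + 1}"] r_loc r_cst; use assms in auto)+

lemma ri_ri_r: "ri j * (ri (Suc j) * r j) = r (Suc j) * (ri j * ri (Suc j))"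
proof -
  have "r (Suc j) * (r j * (r (Suc j) * (ri j * ri (Suc j)))) = r j * (r (Suc j) * (r j * (ri j * ri (Suc j))))"
    using r_braid[of j] by (metis mult.assoc)
  also have "\<dots> = r j" by (simp add: r_inv r_inv_left)
  finally have "ri j * (ri (Suc j) * r j) = 
    ri j * (ri (Suc j) * (r (Suc j) * (r j * (r (Suc j) * (ri j * ri (Suc j))))))" by simp
  then show ?thesis by (simp add: r_inv_left)
qed

lemma ri_ri_r': "ri (Suc j) * (ri j * r (Suc j)) = r j * (ri (Suc j) * ri j)"
proof -
  have "r j * (r (Suc j) * (r j * (ri (Suc j) * ri j))) = r (Suc j) * (r j * (r (Suc j) * (ri (Suc j) * ri j)))"
    using r_braid[of j] by (metis mult.assoc)
  also have "\<dots> = r (Suc j)" by (simp add: r_inv r_inv_left)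
  finally have "ri (Suc j) * (ri j * r (Suc j)) = 
    ri (Suc j) * (ri j * (r j * (r (Suc j) * (r j * (ri (Suc j) * ri j)))))" by simp
  then show ?thesis by (simp add: r_inv_left)
qed

text \<open>The algebra generated by the scalars and the braids on the strands \<open>a\<close>,
  ..., \<open>b\<close>; only the scalars remain if \<open>b \<le> a\<close>. The arguments below
  use braids only through membership in it and proceed by induction over the generators.\<close>

inductive_set gen :: "nat \<Rightarrow> nat \<Rightarrow> 'o set" for a b where
  scalar: "z \<in> scalars \<Longrightarrow> z \<in> gen a b"
| pos: "a \<le> k \<Longrightarrow> k < b \<Longrightarrow> r k \<in> gen a b"
| neg: "a \<le> k \<Longrightarrow> k < b \<Longrightarrow> ri k \<in> gen a b"
| mult: "x \<in> gen a b \<Longrightarrow> y \<in> gen a b \<Longrightarrow> x * y \<in> gen a b"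
| add: "x \<in> gen a b \<Longrightarrow> y \<in> gen a b \<Longrightarrow> x + y \<in> gen a b"

lemma gen_one: "1 \<in> gen a b"
  by (rule gen.scalar) (auto simp: scalars_def intro: loc_one cst_one)

lemma gen_mono: "x \<in> gen a b \<Longrightarrow> a' \<le> a \<Longrightarrow> b \<le> b' \<Longrightarrow> x \<in> gen a' b'"
  by (induction rule: gen.induct) (auto intro: gen.intros)

lemma gen_cst: "x \<in> gen a b \<Longrightarrow> cst x"
  by (induction rule: gen.induct) (auto simp: scalars_def intro: cst_mult cst_add r_cst)

lemma gen_loc: "x \<in> gen a b \<Longrightarrow> loc {a..b} x"
proof (induction rule: gen.induct)
  case (pos k)
  then show ?case by (intro loc_mono[OF r_loc(1)]) auto
next
  case (neg k)
  then show ?case by (intro loc_mono[OF r_loc(2)]) auto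
qed (auto simp: scalars_def intro: loc_mult loc_add loc_mono)

lemma gen_sh: "x \<in> gen a b \<Longrightarrow> (sh ^^ n) x \<in> gen (a + n) (b + n)"
proof -
  have *: "(sh ^^ n) (r k) = r (k + n)" "(sh ^^ n) (ri k) = ri (k + n)" for k
    by (induction n) (auto simp: sh_r)
  show "x \<in> gen a b \<Longrightarrow> (sh ^^ n) x \<in> gen (a + n) (b + n)"
    by (induction rule: gen.induct) (auto simp: shn_simps * scalars_def intro: gen.intros)
qed

lemma shn_r: "(sh ^^ n) (r k) = r (k + n)" "(sh ^^ n) (ri k) = ri (k + n)"
  by (induction n) (auto simp: sh_r)

text \<open>The traces over factors above \<open>j + 1\<close> are taken first and let
  \<open>r j\<close> through on either side. The next two, over \<open>j + 1\<close> and
  \<open>j\<close>, are those of \<open>tr_cyc\<close>.\<close>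

lemma trs_cyc_r:
  assumes "k + 1 \<le> j" "j + 1 \<le> k + n"
  shows "trs k n (r j * x) = trs k n (x * r j)"
proof -
  have split: "trs k n y = trs k (j - k - 1) (tr j (tr (Suc j) (trs (j + 1) (k + n - (j + 1)) y)))" for y
  proof -
    have "trs k n y = trs k (j + 1 - k) (trs (j + 1) (k + n - (j + 1)) y)"
      using trs_append[of k "j + 1 - k" "k + n - (j + 1)" y] assms by simp
    also have "j + 1 - k = Suc (Suc (j - k - 1))" using assms by simp
    finally show ?thesis using assms by simp
  qed
  show ?thesis
    unfolding split
    by (subst trs_left[OF r_loc(1)], force, force, subst trs_right[OF r_loc(1)], force, force, subst tr_cyc) (rule HOL.refl)
qed

lemma trs_cyc:
  assumes "y \<in> gen (k + 1) (k + n)"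
  shows "trs k n (y * x) = trs k n (x * y)"
  using assms
proof (induction arbitrary: x rule: gen.induct)
  case (scalar z)
  then show ?case by (simp add: scalar_com)
next
  case (pos j)
  then show ?case by (intro trs_cyc_r) auto
next
  case (neg j)
  \<comment> \<open>With y = ri_j x ri_j, the two sides are the traces of y r_j and of r_j y, so the
    case of \<open>r j\<close> applies.\<close>
  have "trs k n (ri j * x) = trs k n ((ri j * x * ri j) * r j)"
    by (simp add: mult.assoc r_inv)
  also have "\<dots> = trs k n (r j * (ri j * x * ri j))"
    using neg by (intro trs_cyc_r[symmetric]) auto
  finally show ?case by (simp add: mult.assoc r_inv_left)
next
  case (mult y y')
  show ?case
    using mult.IH(1)[of "y' * x"] mult.IH(2)[of "x * y"] by (simp add: mult.assoc)
next
  case (add y y')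
  then show ?case by (simp add: distrib_left distrib_right trs_add)
qed

text \<open>\<open>s n\<close> and \<open>s' n\<close> are the two conjugates of \<open>r (n + 1)\<close> that exchange the strands \<open>1\<close> and
  \<open>n + 2\<close>; \<open>s n\<close> is the image of \<open>\<sigma>\<^bsub>n+1\<^esub>\<dots>\<sigma>\<^sub>1\<sigma>\<^sub>2\<^sup>-\<^sup>1\<dots>\<sigma>\<^bsub>n+1\<^esub>\<^sup>-\<^sup>1\<close>.\<close>

fun s :: "nat \<Rightarrow> 'o" where
  "s 0 = r 1"
| "s (Suc n) = r (n + 2) * (s n * ri (n + 2))"

fun s' :: "nat \<Rightarrow> 'o" where
  "s' 0 = r 1"
| "s' (Suc n) = ri (n + 2) * (s' n * r (n + 2))"

lemma s_gen: "s n \<in> gen 1 (n + 2)"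
proof (induction n)
  case (Suc n)
  then have "s n \<in> gen 1 (Suc n + 2)" by (rule gen_mono) auto
  then show ?case by (auto intro!: gen.pos gen.neg gen.mult)
qed (auto intro!: gen.pos gen.neg gen.mult)

lemma s'_gen: "s' n \<in> gen 1 (n + 2)"
proof (induction n)
  case (Suc n)
  then have "s' n \<in> gen 1 (Suc n + 2)" by (rule gen_mono) auto
  then show ?case by (auto intro!: gen.pos gen.neg gen.mult)
qed (auto intro!: gen.pos gen.neg gen.mult)

lemma com_gen: "x \<in> gen a b \<Longrightarrow> loc B y \<Longrightarrow> {a..b} \<inter> B = {} \<Longrightarrow> x * y = y * x"
  using com gen_cst gen_loc by blast

text \<open>A conjugate of R_n by braids on the strands up to \<open>n\<close>, which do not touch
  the factor \<open>n + 1\<close>: its R-trace over that factor is therefore 1. The recursions for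
  \<open>s\<close> and \<open>s'\<close> conjugate by elements that do touch the last factor, so
  this form has to be derived.\<close>

definition conj_r :: "nat \<Rightarrow> 'o \<Rightarrow> bool" where
  "conj_r n x \<longleftrightarrow> (\<exists>h hi. h \<in> gen 1 n \<and> hi \<in> gen 1 n \<and> h * hi = 1 \<and> hi * h = 1 \<and> x = h * (r n * hi))"

text \<open>The conjugating elements \<open>h\<close>, \<open>hi\<close> commute with
  \<open>g\<close>, \<open>gi\<close>, which act in the factors \<open>n + 1\<close>,
  \<open>n + 2\<close>. So the outer conjugation reaches \<open>r n\<close> directly, where the
  braid relation turns it into a conjugation of \<open>r (n + 1)\<close> by lower braids.\<close>

lemma conj_r_step:
  assumes x: "conj_r n x"
    and g: "loc {n + 1, n + 2} g" "loc {n + 1, n + 2} gi" "g * (r n * gi) = k * (r (n + 1) * ki)"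
    and k: "k \<in> gen 1 (n + 1)" "ki \<in> gen 1 (n + 1)" "k * ki = 1" "ki * k = 1"
  shows "conj_r (n + 1) (g * (x * gi))"
proof -
  obtain h hi where h: "h \<in> gen 1 n" "hi \<in> gen 1 n" "h * hi = 1" "hi * h = 1" "x = h * (r n * hi)"
    using x unfolding conj_r_def by blast
  have c: "h * g = g * h" "hi * gi = gi * hi"
    by (rule com_gen[OF h(1) g(1)], simp, rule com_gen[OF h(2) g(2)], simp)
  have "g * (x * gi) = (h * g) * (r n * (hi * gi))"
    by (simp only: c(1)) (simp add: h(5) mult.assoc)
  also have "\<dots> = h * ((g * (r n * gi)) * hi)" by (simp only: c(2) mult.assoc)
  also have "\<dots> = (h * k) * (r (n + 1) * (ki * hi))" unfolding g(3) by (simp only: mult.assoc)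
  finally have "g * (x * gi) = (h * k) * (r (n + 1) * (ki * hi))" .
  moreover have "(h * k) * (ki * hi) = h * ((k * ki) * hi)" "(ki * hi) * (h * k) = ki * ((hi * h) * k)"
    by (simp_all only: mult.assoc)
  moreover have "h \<in> gen 1 (n + 1)" "hi \<in> gen 1 (n + 1)" using h gen_mono by auto
  ultimately show ?thesis
    unfolding conj_r_def using h k by (intro exI[of _ "h * k"] exI[of _ "ki * hi"]) (auto intro: gen.mult)
qed

lemma conj_r_r: "conj_r 1 (r 1)"
  unfolding conj_r_def by (intro exI[of _ 1]) (auto simp: gen_one)

lemma s_conj: "conj_r (n + 1) (s n)"
proof (induction n)
  case (Suc n)
  have "r (n + 2) * (r (n + 1) * ri (n + 2)) = ri (n + 1) * (r (n + 2) * r (n + 1))"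
    using r_braid[of "n + 1"] by (simp add: numeral_2_eq_2) (metis mult.assoc r_inv(1) r_inv_left(2) mult.right_neutral)
  then have "conj_r (n + 1 + 1) (r (n + 2) * (s n * ri (n + 2)))"
    using r_loc[of "n + 2"] by (intro conj_r_step[OF Suc]) (auto simp: r_inv intro: gen.pos gen.neg)
  then show ?case by simp
qed (use conj_r_r in simp)

lemma s'_conj: "conj_r (n + 1) (s' n)"
proof (induction n)
  case (Suc n)
  have "ri (n + 2) * (r (n + 1) * r (n + 2)) = r (n + 1) * (r (n + 2) * ri (n + 1))"
    using r_braid[of "n + 1"] by (simp add: numeral_2_eq_2) (metis mult.assoc r_inv(1) r_inv_left(2) mult.right_neutral)
  then have "conj_r (n + 1 + 1) (ri (n + 2) * (s' n * r (n + 2)))"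
    using r_loc[of "n + 2"] by (intro conj_r_step[OF Suc]) (auto simp: r_inv intro: gen.pos gen.neg)
  then show ?case by simp
qed (use conj_r_r in simp)

lemma tr_conj_r:
  assumes "conj_r (n + 1) x"
  shows "tr (n + 2) x = 1"
proof -
  obtain h hi where h: "h \<in> gen 1 (n + 1)" "hi \<in> gen 1 (n + 1)" "h * hi = 1" "x = h * (r (n + 1) * hi)"
    using assms unfolding conj_r_def by blast
  show ?thesis
    using h tr_left[OF gen_loc[OF h(1)], of "n + 2"] tr_right[OF gen_loc[OF h(2)], of "n + 2"] tr_r[of "n + 1"]
    by simp
qed

lemmas tr_s = tr_conj_r[OF s_conj] and tr_s' = tr_conj_r[OF s'_conj]

text \<open>For \<open>q = 0\<close> this amounts to the braid relation between \<open>s p\<close>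
  and \<open>r (p + 2)\<close>. It is the relation between \<open>r (p + 1)\<close> and
  \<open>r (p + 2)\<close>, conjugated by the element \<open>h\<close> of \<open>conj_r\<close>,
  which commutes with \<open>r (p + 2)\<close>. Raising \<open>q\<close> conjugates with
  \<open>r (p + q + 3)\<close>, which commutes with \<open>s p\<close>.\<close>

lemma s_s: "s p * s (p + 1 + q) = (sh ^^ (p + 1)) (s q) * s p"
proof (induction q)
  case 0
  obtain h hi where h: "h \<in> gen 1 (p + 1)" "hi \<in> gen 1 (p + 1)" "h * hi = 1" "hi * h = 1"
    "s p = h * (r (p + 1) * hi)" using s_conj unfolding conj_r_def by blast
  have c: "h * r (p + 2) = r (p + 2) * h" "hi * ri (p + 2) = ri (p + 2) * hi"
    by (rule com_gen[OF h(1) r_loc(1)], simp, rule com_gen[OF h(2) r_loc(2)], simp)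
  have "s p * (r (p + 2) * (s p * ri (p + 2))) =
      h * (r (p + 1) * (hi * ((r (p + 2) * h) * (r (p + 1) * (hi * ri (p + 2))))))"
    by (simp add: h(5) mult.assoc)
  also have "\<dots> = h * (r (p + 1) * ((hi * h) * (r (p + 2) * (r (p + 1) * (ri (p + 2) * hi)))))"
    by (simp only: c(2) c(1)[symmetric] mult.assoc)
  also have "\<dots> = h * ((r (p + 1) * (r (p + 2) * r (p + 1))) * (ri (p + 2) * hi))"
    by (simp add: h(4) mult.assoc)
  also have "\<dots> = h * ((r (p + 2) * (r (p + 1) * r (p + 2))) * (ri (p + 2) * hi))"
    using r_braid[of "p + 1"] by (simp add: numeral_2_eq_2)
  also have "\<dots> = (h * r (p + 2)) * (r (p + 1) * hi)"
    by (simp add: mult.assoc r_inv_left)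
  also have "\<dots> = r (p + 2) * s p"
    by (simp only: c(1)) (simp add: h(5) mult.assoc)
  finally show ?case by (simp add: sh_r shn_r numeral_2_eq_2)
next
  case (Suc q)
  let ?k = "p + q + 3"
  have c: "s p * r ?k = r ?k * s p" "s p * ri ?k = ri ?k * s p"
    by (rule com_gen[OF s_gen r_loc(1)], simp, rule com_gen[OF s_gen r_loc(2)], simp)
  have e: "s (p + 1 + Suc q) = r ?k * (s (p + 1 + q) * ri ?k)"
    by (simp add: numeral_3_eq_3)
  have "s p * s (p + 1 + Suc q) = r ?k * ((s p * s (p + 1 + q)) * ri ?k)"
    unfolding e by (simp only: mult.assoc[symmetric] c)
  also have "\<dots> = r ?k * ((sh ^^ (p + 1)) (s q) * (s p * ri ?k))"
    unfolding Suc by (simp add: mult.assoc)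
  also have "\<dots> = (r ?k * ((sh ^^ (p + 1)) (s q) * ri ?k)) * s p"
    unfolding c by (simp add: mult.assoc)
  also have "r ?k * ((sh ^^ (p + 1)) (s q) * ri ?k) = (sh ^^ (p + 1)) (s (Suc q))"
  proof -
    have "q + 2 + (p + 1) = ?k" by simp
    then show ?thesis by (simp only: s.simps shn_simps shn_r)
  qed
  finally show ?case .
qed

text \<open>\<open>cr n k\<close> moves one strand past \<open>n\<close> strands, \<open>W n i\<close> moves a block of \<open>i\<close> strands past \<open>n\<close>
  strands.\<close>

fun cr :: "nat \<Rightarrow> nat \<Rightarrow> 'o" where
  "cr 0 k = 1"
| "cr (Suc n) k = cr n k * ri (k + n)"

fun W :: "nat \<Rightarrow> nat \<Rightarrow> 'o" where
  "W n 0 = 1"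
| "W n (Suc i) = cr n (Suc i) * W n i"

text \<open>The exchange \<open>W n i\<close> moved up by one factor. It splits off the passage of
  the first strand from \<open>W n (Suc i)\<close> (see \<open>W_Suc_right\<close>) and lies in the
  strands from 2 on, the traced ones.\<close>

fun Wr :: "nat \<Rightarrow> nat \<Rightarrow> 'o" where
  "Wr n 0 = 1"
| "Wr n (Suc i) = cr n (i + 2) * Wr n i"

section \<open>Sliding braids through block exchanges\<close>

lemma cr_Suc_left: "cr (Suc n) k = ri k * cr n (Suc k)"
  by (induction n arbitrary: k) (auto simp: mult.assoc)

lemma cr_gen: "cr n k \<in> gen k (k + n)"
proof (induction n)
  case (Suc n)
  then have "cr n k \<in> gen k (k + Suc n)" by (rule gen_mono) auto
  then show ?case by (auto intro!: gen.pos gen.neg gen.mult)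
qed (auto simp: gen_one)

lemma W_gen: "W n i \<in> gen 1 (n + i)"
proof (induction i)
  case (Suc i)
  have "cr n (Suc i) \<in> gen 1 (n + Suc i)" "W n i \<in> gen 1 (n + Suc i)"
    by (rule gen_mono[OF cr_gen]; simp) (rule gen_mono[OF Suc]; simp)
  then show ?case by (auto intro: gen.mult)
qed (auto simp: gen_one)

lemma Wr_gen: "Wr n i \<in> gen 2 (n + i + 1)"
proof (induction i)
  case (Suc i)
  have "cr n (i + 2) \<in> gen 2 (n + Suc i + 1)" "Wr n i \<in> gen 2 (n + Suc i + 1)"
    by (rule gen_mono[OF cr_gen]; simp) (rule gen_mono[OF Suc]; simp)
  then show ?case by (auto intro: gen.mult)
qed (auto simp: gen_one)

lemma W_inverse: "\<exists>Wi \<in> gen 1 (n + i). Wi * W n i = 1 \<and> W n i * Wi = 1"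
proof -
  have c: "\<exists>ci \<in> gen k (k + n). ci * cr n k = 1 \<and> cr n k * ci = 1" for n k
  proof (induction n)
    case (Suc n)
    then obtain ci where ci: "ci \<in> gen k (k + n)" "ci * cr n k = 1" "cr n k * ci = 1" by blast
    have "ci \<in> gen k (k + Suc n)" using ci(1) by (rule gen_mono) auto
    moreover have "r (k + n) * ci * cr (Suc n) k = r (k + n) * ((ci * cr n k) * ri (k + n))"
      "cr (Suc n) k * (r (k + n) * ci) = cr n k * (ri (k + n) * (r (k + n) * ci))"
      by (auto simp: mult.assoc)
    ultimately show ?case
      by (intro bexI[of _ "r (k + n) * ci"]) (auto simp: r_inv r_inv_left ci intro!: gen.pos gen.neg gen.mult)
  qed (auto simp: gen_one)
  show ?thesis
  proof (induction i)
    case (Suc i)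
    then obtain Wi where Wi: "Wi \<in> gen 1 (n + i)" "Wi * W n i = 1" "W n i * Wi = 1" by blast
    obtain ci where ci: "ci \<in> gen (Suc i) (Suc i + n)" "ci * cr n (Suc i) = 1" "cr n (Suc i) * ci = 1"
      using c by blast
    have "Wi \<in> gen 1 (n + Suc i)" "ci \<in> gen 1 (n + Suc i)"
      using gen_mono[OF Wi(1)] gen_mono[OF ci(1)] by auto
    moreover have "Wi * ci * W n (Suc i) = Wi * ((ci * cr n (Suc i)) * W n i)"
      "W n (Suc i) * (Wi * ci) = cr n (Suc i) * ((W n i * Wi) * ci)"
      by (auto simp: mult.assoc)
    ultimately show ?case
      by (intro bexI[of _ "Wi * ci"]) (auto simp: Wi ci intro!: gen.pos gen.neg gen.mult)
  qed (auto simp: gen_one)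
qed

lemma cr_r:
  assumes "k \<le> j" "j + 1 < k + n"
  shows "cr n k * r j = r (Suc j) * cr n k"
  using assms
proof (induction n)
  case (Suc n)
  show ?case
  proof (cases "j + 1 < k + n")
    case True
    then have "ri (k + n) * r j = r j * ri (k + n)" by (intro far_com) auto
    then show ?thesis using Suc True by (simp add: mult.assoc) (metis mult.assoc)
  next
    case False
    then have "n = Suc (n - 1) \<and> j = k + (n - 1)" using Suc.prems by auto
    then obtain n' where n: "n = Suc n'" "j = k + n'" by blast
    have "cr n' k * r (Suc j) = r (Suc j) * cr n' k"
      by (rule com_gen[OF cr_gen r_loc(1)]) (auto simp: n)
    moreover have "cr (Suc n) k * r j = cr n' k * (ri j * (ri (Suc j) * r j))"
      by (simp add: n mult.assoc)
    ultimately show ?thesis unfolding ri_ri_r by (simp add: n mult.assoc[symmetric])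
  qed
qed auto

text \<open>A crossing of two strands that both pass the block of \<open>n\<close> strands can be
  made before or after the passage. This is the boundary case in \<open>W_r_right\<close>, where the
  crossing involves the last strand of the block.\<close>

lemma cr_cr_r: "cr n (Suc k) * (cr n k * r (k + n)) = r k * (cr n (Suc k) * cr n k)"
proof (induction n)
  case (Suc n)
  let ?j = "k + n"
  have e: "cr n k * ri (Suc ?j) = ri (Suc ?j) * cr n k"
    by (rule com_gen[OF cr_gen r_loc(2)]) auto
  have "cr (Suc n) (Suc k) * (cr (Suc n) k * r (k + Suc n)) =
      cr n (Suc k) * ((ri (Suc ?j) * cr n k) * (ri ?j * r (Suc ?j)))"
    by (simp add: mult.assoc)
  also have "\<dots> = cr n (Suc k) * (cr n k * (ri (Suc ?j) * (ri ?j * r (Suc ?j))))"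
    by (simp only: e[symmetric] mult.assoc)
  also have "\<dots> = (cr n (Suc k) * (cr n k * r ?j)) * (ri (Suc ?j) * ri ?j)"
    unfolding ri_ri_r' by (simp add: mult.assoc)
  also have "\<dots> = r k * (cr n (Suc k) * ((cr n k * ri (Suc ?j)) * ri ?j))"
    unfolding Suc by (simp add: mult.assoc)
  finally show ?case unfolding e by (simp add: mult.assoc)
qed auto

lemma W_r_left:
  assumes "1 \<le> k" "k < n"
  shows "W n i * r k = r (k + i) * W n i"
proof (induction i)
  case (Suc i)
  have "cr n (Suc i) * r (k + i) = r (Suc (k + i)) * cr n (Suc i)" using assms by (intro cr_r) auto
  then show ?case by (simp add: Suc mult.assoc) (simp add: mult.assoc[symmetric])
qed auto

lemma W_r_right:
  assumes "1 \<le> k" "k < i"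
  shows "W n i * r (k + n) = r k * W n i"
  using assms
proof (induction i)
  case (Suc i)
  show ?case
  proof (cases "k < i")
    case True
    have "cr n (Suc i) * r k = r k * cr n (Suc i)"
      by (rule com_gen[OF cr_gen r_loc(1)]) (use True in auto)
    then show ?thesis using Suc True by (simp add: mult.assoc) (simp add: mult.assoc[symmetric])
  next
    case False
    then obtain i' where i: "i = Suc i'" "k = i" using Suc.prems by (cases i) auto
    have e: "W n i' * r (i + n) = r (i + n) * W n i'"
      by (rule com_gen[OF W_gen r_loc(1)]) (auto simp: i)
    have "W n (Suc i) * r (k + n) = cr n (Suc i) * (cr n i * (W n i' * r (i + n)))"
      by (simp add: i mult.assoc)
    also have "\<dots> = (cr n (Suc i) * (cr n i * r (i + n))) * W n i'"
      unfolding e by (simp add: mult.assoc)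
    also have "\<dots> = r i * (cr n (Suc i) * cr n i * W n i')"
      unfolding cr_cr_r by (simp add: mult.assoc)
    finally show ?thesis by (simp add: i mult.assoc)
  qed
qed auto

text \<open>Follows from sliding the single generators. Together with \<open>W_right\<close> it
  turns a b^(up n), conjugated by the exchange, into a^(up i) b.\<close>

lemma W_left:
  assumes "a \<in> gen 1 n"
  shows "W n i * a = (sh ^^ i) a * W n i"
  using assms
proof (induction rule: gen.induct)
  case (scalar z)
  then show ?case using scalar_com[of z "W n i"] by (auto simp: shn_simps scalars_def)
next
  case (pos k)
  then show ?case by (simp add: W_r_left shn_r)
next
  case (neg k)
  then show ?case by (simp add: intertwine_inverse[OF W_r_left r_inv(1) r_inv(2)] shn_r)
next
  case (mult x y)
  then show ?case by (metis mult.assoc shn_simps(2))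
qed (auto simp: shn_simps algebra_simps)

lemma W_right:
  assumes "b \<in> gen 1 i"
  shows "W n i * (sh ^^ n) b = b * W n i"
  using assms
proof (induction rule: gen.induct)
  case (scalar z)
  then show ?case using scalar_com[of z "W n i"] by (auto simp: shn_simps scalars_def)
next
  case (pos k)
  then show ?case by (simp add: W_r_right shn_r)
next
  case (neg k)
  then show ?case by (simp add: intertwine_inverse[OF W_r_right r_inv(1) r_inv(2)] shn_r)
next
  case (mult x y)
  then show ?case by (metis mult.assoc shn_simps(2))
qed (auto simp: shn_simps algebra_simps)

lemma W_Suc_right: "W n (Suc i) = Wr n i * cr n 1"
  by (induction i) (auto simp: mult.assoc)

text \<open>\<open>cr (Suc p) 1\<close> is the product of the inverses of R_1, ..., R_(p+1). Each
  outer conjugation of \<open>s p\<close> first cancels the last inverse and then restores it on the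
  right; only R_1 at the centre removes its inverse for good.\<close>

lemma cr_s: "cr (Suc p) 1 * s p = cr p 2"
proof (induction p)
  case (Suc p)
  have "cr (Suc (Suc p)) 1 * s (Suc p) = (cr (Suc p) 1 * s p) * ri (p + 2)"
    by (simp add: mult.assoc r_inv_left)
  also have "\<dots> = cr (Suc p) 2" unfolding Suc by (simp add: add.commute)
  finally show ?case .
qed (auto simp: r_inv)

text \<open>The right side is a braid on the strands from 2 on, hence cyclic under the trace that
  leaves out factor 1. By \<open>s'_W\<close> the same element is
  \<open>s' q * W (Suc p) (Suc q)\<close>; these two readings of it are the core of
  \<open>pw_stp_Lop\<close>.\<close>

lemma W_s: "W (Suc p) (Suc q) * s p = Wr (Suc p) q * cr p 2"
  unfolding W_Suc_right mult.assoc cr_s ..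

lemma s'_Wr: "Wr (Suc p) q * r 1 = s' q * Wr (Suc p) q"
proof (induction q)
  case (Suc q)
  have e: "cr p (q + 3) * s' q = s' q * cr p (q + 3)"
    by (rule com_gen[OF s'_gen gen_loc[OF cr_gen], symmetric]) auto
  have cc: "cr (Suc p) (q + 2) = ri (q + 2) * cr p (q + 3)"
    using cr_Suc_left[of p "q + 2"] by (simp add: numeral_3_eq_3)
  have "Wr (Suc p) (Suc q) * r 1 = ri (q + 2) * ((cr p (q + 3) * s' q) * Wr (Suc p) q)"
    using Suc by (simp only: Wr.simps cc mult.assoc)
  also have "\<dots> = s' (Suc q) * Wr (Suc p) (Suc q)"
    by (simp only: e Wr.simps cc s'.simps mult.assoc r_inv_left)
  finally show ?case .
qed auto

lemma s'_W: "s' q * W (Suc p) (Suc q) = Wr (Suc p) q * cr p 2"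
proof -
  have "s' q * W (Suc p) (Suc q) = (s' q * Wr (Suc p) q) * cr (Suc p) 1"
    by (simp only: W_Suc_right mult.assoc)
  also have "\<dots> = Wr (Suc p) q * (r 1 * (ri 1 * cr p 2))"
    by (simp only: s'_Wr[symmetric] cr_Suc_left mult.assoc numeral_2_eq_2 One_nat_def)
  finally show ?thesis by (simp only: r_inv_left)
qed

end

subsection \<open>Quantum matrices\<close>

text \<open>\<open>r k\<close> and \<open>f k\<close> are \<open>R\<close> and \<open>F\<close> in the factors \<open>k\<close>, \<open>k + 1\<close>, \<open>m\<close> is \<open>M\<close> in the factor \<open>1\<close>, and \<open>J\<close>
  consists of the operators with entries in the ideal of relations.\<close>

locale quantum_matrix_operators = braided_operators loc cst tr sh r ri
  for loc :: "nat set \<Rightarrow> 'o::ring_1 \<Rightarrow> bool" and cst tr sh r ri +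
  fixes f fi :: "nat \<Rightarrow> 'o" and m :: 'o and J :: "'o set"
  assumes f_inv: "f k * fi k = 1" "fi k * f k = 1"
    and f_loc: "loc {k, k + 1} (f k)" "loc {k, k + 1} (fi k)"
    and f_cst: "cst (f k)" "cst (fi k)"
    and f_braid: "f k * (f (Suc k) * f k) = f (Suc k) * (f k * f (Suc k))"
    and compat_down: "r k * (f (Suc k) * f k) = f (Suc k) * (f k * r (Suc k))"
    and compat_up: "r (Suc k) * (f k * f (Suc k)) = f k * (f (Suc k) * r k)"
    and tr_f: "loc A x \<Longrightarrow> Suc k \<notin> A \<Longrightarrow> tr (Suc k) (f k * (x * fi k)) = tr k x"
    and m_loc: "loc {1} m"
    and J_zero: "0 \<in> J"
    and J_add: "x \<in> J \<Longrightarrow> y \<in> J \<Longrightarrow> x + y \<in> J"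
    and J_left: "x \<in> J \<Longrightarrow> y * x \<in> J"
    and J_right: "x \<in> J \<Longrightarrow> x * y \<in> J"
    and J_tr: "x \<in> J \<Longrightarrow> tr k x \<in> J"
    and rtt: "r 1 * (m * (f 1 * (m * fi 1))) - m * (f 1 * (m * fi 1)) * r 1 \<in> J"
begin

lemma f_inv_left: "f k * (fi k * x) = x" "fi k * (f k * x) = x"
  by (simp_all add: f_inv mult.assoc[symmetric])

definition eqv :: "'o \<Rightarrow> 'o \<Rightarrow> bool" (infix "\<doteq>" 50) where
  "x \<doteq> y \<longleftrightarrow> x - y \<in> J"

lemma eqv_refl [simp]: "x \<doteq> x"
  by (simp add: eqv_def J_zero)

lemma eqv_sym: "x \<doteq> y \<Longrightarrow> y \<doteq> x"
  using J_left[of "x - y" "- 1"] by (simp add: eqv_def)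

lemma eqv_trans [trans]: "x \<doteq> y \<Longrightarrow> y \<doteq> z \<Longrightarrow> x \<doteq> z"
  using J_add[of "x - y" "y - z"] by (simp add: eqv_def)

lemma eqv_add: "x \<doteq> y \<Longrightarrow> x' \<doteq> y' \<Longrightarrow> x + x' \<doteq> y + y'"
  using J_add[of "x - y" "x' - y'"] by (simp add: eqv_def algebra_simps)

lemma eqv_left: "x \<doteq> y \<Longrightarrow> z * x \<doteq> z * y"
  using J_left[of "x - y" z] by (simp add: eqv_def algebra_simps)

lemma eqv_right: "x \<doteq> y \<Longrightarrow> x * z \<doteq> y * z"
  using J_right[of "x - y" z] by (simp add: eqv_def algebra_simps)

lemma tr_minus: "tr k (x - y) = tr k x - tr k y"
  using tr_add[of k "x - y" y] by simp

lemma eqv_trs: "x \<doteq> y \<Longrightarrow> trs k n x \<doteq> trs k n y"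
proof (induction n arbitrary: x y)
  case (Suc n)
  have "tr (k + n + 1) x \<doteq> tr (k + n + 1) y"
    using Suc.prems J_tr[of "x - y"] by (simp add: eqv_def tr_minus)
  then show ?case using Suc.IH by simp
qed auto

section \<open>Transport of operators to higher factors by means of F\<close>

fun U :: "nat \<Rightarrow> 'o" where
  "U 0 = 1"
| "U (Suc n) = U n * f (Suc n)"

fun Ui :: "nat \<Rightarrow> 'o" where
  "Ui 0 = 1"
| "Ui (Suc n) = fi (Suc n) * Ui n"

lemma U_loc: "loc {1..n + 1} (U n)" "loc {1..n + 1} (Ui n)"
proof -
  have f: "loc {1..Suc n + 1} (f (Suc n))" "loc {1..Suc n + 1} (fi (Suc n))" for n
    by (rule loc_mono[OF f_loc(1)]; simp) (rule loc_mono[OF f_loc(2)]; simp)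
  show "loc {1..n + 1} (U n)"
  proof (induction n)
    case (Suc n)
    then have "loc {1..Suc n + 1} (U n)" by (rule loc_mono) auto
    then show ?case using f by (auto intro: loc_mult)
  qed (auto intro: loc_one)
  show "loc {1..n + 1} (Ui n)"
  proof (induction n)
    case (Suc n)
    then have "loc {1..Suc n + 1} (Ui n)" by (rule loc_mono) auto
    then show ?case using f by (auto intro: loc_mult)
  qed (auto intro: loc_one)
qed

lemma Ui_U: "Ui n * U n = 1"
proof (induction n)
  case (Suc n)
  have "Ui (Suc n) * U (Suc n) = fi (Suc n) * ((Ui n * U n) * f (Suc n))"
    by (simp add: mult.assoc)
  then show ?case by (simp add: Suc f_inv)
qed auto

lemma U_Ui: "U n * Ui n = 1"
proof (induction n)
  case (Suc n)
  have "U (Suc n) * Ui (Suc n) = U n * ((f (Suc n) * fi (Suc n)) * Ui n)"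
    by (simp add: mult.assoc)
  then show ?case by (simp add: Suc f_inv)
qed auto

text \<open>Conjugation with F_1 ... F_n is a shift by one factor twisted by F. On R-matrices it
  agrees with \<open>sh\<close> (\<open>theta_r\<close>), but it also takes M with index k overlined
  to M with index k + 1 overlined (\<open>thn_nb\<close>). The number \<open>n\<close> is only a
  cut-off: by \<open>theta_stable\<close> every large enough \<open>n\<close> gives the same
  result.\<close>

definition \<theta> :: "nat \<Rightarrow> 'o \<Rightarrow> 'o" where
  "\<theta> n x = U n * (x * Ui n)"

lemma theta_mult: "\<theta> n (x * y) = \<theta> n x * \<theta> n y"
proof -
  have "\<theta> n x * \<theta> n y = U n * (x * ((Ui n * U n) * (y * Ui n)))"
    by (simp add: \<theta>_def mult.assoc)
  then show ?thesis by (simp add: \<theta>_def Ui_U mult.assoc)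
qed

lemma theta_one: "\<theta> n 1 = 1"
  by (simp add: \<theta>_def U_Ui)

lemma theta_add: "\<theta> n (x + y) = \<theta> n x + \<theta> n y"
  by (simp add: \<theta>_def algebra_simps)

lemma eqv_theta: "x \<doteq> y \<Longrightarrow> \<theta> n x \<doteq> \<theta> n y"
  unfolding \<theta>_def by (intro eqv_left eqv_right)

lemma theta_stable:
  assumes "loc {..j} x" "j \<le> n"
  shows "\<theta> n x = \<theta> j x"
  using assms(2)
proof (induction n rule: dec_induct)
  case (step n)
  have "f (Suc n) * x = x * f (Suc n)"
    by (rule com[OF f_cst(1) f_loc(1) assms(1)]) (use step in auto)
  then have "\<theta> (Suc n) x = U n * (x * ((f (Suc n) * fi (Suc n)) * Ui n))"
    by (simp add: \<theta>_def mult.assoc) (simp add: mult.assoc[symmetric])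
  then show ?case using step by (simp add: f_inv \<theta>_def)
qed auto

lemma theta_scalar: "loc {} x \<Longrightarrow> \<theta> n x = x"
  using theta_stable[of 0 x n] loc_mono[of "{}" x "{..0}"] by (simp add: \<theta>_def)

lemma theta_loc:
  assumes "loc {..j} x" "j \<le> n"
  shows "loc {..j + 1} (\<theta> n x)"
proof -
  have "loc {..j + 1} (U j)" "loc {..j + 1} (Ui j)" "loc {..j + 1} x"
    using U_loc[of j] assms(1) by (auto intro: loc_mono)
  then have "loc {..j + 1} (\<theta> j x)" unfolding \<theta>_def by (intro loc_mult)
  then show ?thesis by (simp only: theta_stable[OF assms])
qed

text \<open>With the cut-off lowered to \<open>Suc j\<close>, the product \<open>U\<close> ends in
  \<open>f (Suc j)\<close>, its only factor acting in \<open>Suc (Suc j)\<close>. All others leave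
  the trace, and \<open>tr_f\<close> moves the trace down by one factor.\<close>

lemma tr_theta:
  assumes "loc {..Suc j} x" "Suc j \<le> n"
  shows "tr (Suc (Suc j)) (\<theta> n x) = \<theta> n (tr (Suc j) x)"
proof -
  have U: "loc {1..j + 1} (U j)" "loc {1..j + 1} (Ui j)" using U_loc by auto
  have "{..Suc j} - {Suc j} = {..j}" by auto
  then have l: "loc {..j} (tr (Suc j) x)" using tr_loc[OF assms(1), of "Suc j"] by simp
  have "tr (Suc (Suc j)) (\<theta> n x) = tr (Suc (Suc j)) (U j * (f (Suc j) * (x * fi (Suc j)) * Ui j))"
    unfolding theta_stable[OF assms] by (simp add: \<theta>_def mult.assoc)
  also have "\<dots> = U j * (tr (Suc (Suc j)) (f (Suc j) * (x * fi (Suc j))) * Ui j)"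
    using tr_left[OF U(1)] tr_right[OF U(2)] by simp
  also have "\<dots> = \<theta> j (tr (Suc j) x)"
    using tr_f[OF assms(1)] by (simp add: \<theta>_def)
  finally show ?thesis using theta_stable[OF l, of n] assms(2) by simp
qed

lemma trs_theta:
  assumes "loc {..k + n} x" "k + n \<le> N"
  shows "trs (Suc k) n (\<theta> N x) = \<theta> N (trs k n x)"
  using assms
proof (induction n arbitrary: x)
  case (Suc n)
  have "{..Suc (k + n)} - {Suc (k + n)} = {..k + n}" by auto
  then have l: "loc {..k + n} (tr (Suc (k + n)) x)" using tr_loc[of _ x "Suc (k + n)"] Suc.prems by fastforce
  show ?case using Suc.IH[OF l] Suc.prems tr_theta[of "k + n" x N] by simp
qed auto

lemma thn_simps:
  "(\<theta> N ^^ n) 1 = 1" "(\<theta> N ^^ n) (x * y) = (\<theta> N ^^ n) x * (\<theta> N ^^ n) y"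
  "(\<theta> N ^^ n) (x + y) = (\<theta> N ^^ n) x + (\<theta> N ^^ n) y"
  "loc {} x \<Longrightarrow> (\<theta> N ^^ n) x = x"
  by (induction n) (auto simp: theta_one theta_mult theta_add theta_scalar)

lemma eqv_thn: "x \<doteq> y \<Longrightarrow> (\<theta> N ^^ n) x \<doteq> (\<theta> N ^^ n) y"
  by (induction n) (auto intro: eqv_theta)

lemma thn_loc: "loc {..j} x \<Longrightarrow> j + n \<le> N + 1 \<Longrightarrow> loc {..j + n} ((\<theta> N ^^ n) x)"
proof (induction n)
  case (Suc n)
  then show ?case using theta_loc[of "j + n" _ N] by simp
qed auto

lemma trs_thn:
  assumes "loc {..k + n} x" "k + n + p \<le> N + 1"
  shows "trs (k + p) n ((\<theta> N ^^ p) x) = (\<theta> N ^^ p) (trs k n x)"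
  using assms
proof (induction p)
  case (Suc p)
  have "loc {..k + p + n} ((\<theta> N ^^ p) x)"
    using thn_loc[OF Suc.prems(1), of p N] Suc.prems by (simp add: ac_simps)
  from trs_theta[OF this, of N] show ?case using Suc by simp
qed auto

text \<open>The family \<open>g\<close> is R with \<open>compat_up\<close>, or F with its own braid
  relation. Of the factors of \<open>U n\<close> only \<open>f k * f (Suc k)\<close> changes
  \<open>g k\<close>; the earlier and later ones commute with what meets them.\<close>

lemma intertwine_up:
  assumes "\<And>k. cst (g k)" "\<And>k. loc {k, k + 1} (g k)"
    and "\<And>k. g (Suc k) * (f k * f (Suc k)) = f k * (f (Suc k) * g k)"
    and "1 \<le> k" "k < n"
  shows "U n * g k = g (Suc k) * U n"
  using assms(5)
proof (induction n)
  case (Suc n)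
  show ?case
  proof (cases "k < n")
    case True
    have "f (Suc n) * g k = g k * f (Suc n)"
      by (rule com[OF f_cst(1) f_loc(1) assms(2)]) (use True in auto)
    then show ?thesis using Suc True by (simp add: mult.assoc) (simp add: mult.assoc[symmetric])
  next
    case False
    then have k: "k = n" using Suc.prems by simp
    then obtain n' where n: "n = Suc n'" using assms(4) by (cases n) auto
    have e: "U n' * g (Suc (Suc n')) = g (Suc (Suc n')) * U n'"
      by (rule com[OF assms(1,2) U_loc(1), symmetric]) auto
    then show ?thesis
      by (simp only: U.simps k n mult.assoc assms(3)[symmetric] assoc_eq[OF e])
  qed
qed auto

lemma theta_r:
  assumes "1 \<le> k" "k < n"
  shows "\<theta> n (r k) = r (Suc k)" "\<theta> n (ri k) = ri (Suc k)"
    "\<theta> n (f k) = f (Suc k)" "\<theta> n (fi k) = fi (Suc k)"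
proof -
  have a: "U n * r k = r (Suc k) * U n" "U n * f k = f (Suc k) * U n"
    using intertwine_up[OF r_cst(1) r_loc(1) compat_up assms]
      intertwine_up[OF f_cst(1) f_loc(1) f_braid[symmetric] assms] by auto
  have b: "U n * ri k = ri (Suc k) * U n" "U n * fi k = fi (Suc k) * U n"
    using a intertwine_inverse r_inv f_inv by blast+
  show "\<theta> n (r k) = r (Suc k)" "\<theta> n (ri k) = ri (Suc k)"
    "\<theta> n (f k) = f (Suc k)" "\<theta> n (fi k) = fi (Suc k)"
    using a b by (simp_all add: \<theta>_def mult.assoc[symmetric]) (simp_all add: mult.assoc U_Ui)
qed

text \<open>\<open>nb k x\<close> is the matrix \<open>x\<close> transported to the factor \<open>k + 1\<close>, so \<open>nb k m\<close> is
  \<open>M\<close> with index \<open>k + 1\<close> overlined.\<close>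

fun nb :: "nat \<Rightarrow> 'o \<Rightarrow> 'o" where
  "nb 0 x = x"
| "nb (Suc k) x = f (Suc k) * (nb k x * fi (Suc k))"

fun Mp :: "nat \<Rightarrow> 'o" where
  "Mp 0 = 1"
| "Mp (Suc n) = Mp n * nb n m"

lemma nb_loc: "loc {1} x \<Longrightarrow> loc {1..k + 1} (nb k x)"
proof (induction k)
  case (Suc k)
  then have "loc {1..Suc k + 1} (nb k x)" by (auto intro: loc_mono)
  moreover have "loc {1..Suc k + 1} (f (Suc k))" "loc {1..Suc k + 1} (fi (Suc k))"
    by (rule loc_mono[OF f_loc(1)]; simp) (rule loc_mono[OF f_loc(2)]; simp)
  ultimately show ?case by (auto intro: loc_mult)
qed auto

lemma eqv_nb: "x \<doteq> y \<Longrightarrow> nb k x \<doteq> nb k y"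
  by (induction k) (auto intro: eqv_left eqv_right)

lemma nb_add: "nb k (x + y) = nb k x + nb k y"
  by (induction k) (auto simp: algebra_simps)

lemma nb_scalar: "loc {} z \<Longrightarrow> nb k z = z"
  by (induction k) (auto simp: f_inv com[OF f_cst(2) f_loc(2), symmetric] mult.assoc[symmetric])

lemma nb_mult_scalar:
  assumes "loc {} z"
  shows "nb k (x * z) = nb k x * z"
proof (induction k)
  case (Suc k)
  have "fi (Suc k) * z = z * fi (Suc k)" by (rule com[OF f_cst(2) f_loc(2) assms]) auto
  then show ?case using Suc by (simp add: mult.assoc)
qed auto

lemma Mp_loc: "loc {1..n} (Mp n)"
proof (induction n)
  case (Suc n)
  then have "loc {1..Suc n} (Mp n)" by (rule loc_mono) auto
  then show ?case using nb_loc[OF m_loc, of n] by (auto intro: loc_mult)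
qed (auto intro: loc_one)

lemma thn_nb:
  assumes "loc {1} x"
  shows "k + n \<le> N \<Longrightarrow> (\<theta> N ^^ n) (nb k x) = nb (k + n) x"
proof (induction n)
  case (Suc n)
  have "k < N \<Longrightarrow> \<theta> N (nb k x) = nb (Suc k) x" for k
  proof (induction k)
    case 0
    then show ?case
      using theta_stable[of 1 x N] loc_mono[OF assms, of "{..1}"] by (simp add: \<theta>_def)
  next
    case (Suc k)
    then show ?case by (simp add: theta_mult theta_r)
  qed
  then show ?case using Suc by simp
qed auto

text \<open>The overlined copies number \<open>n + 1\<close>, ..., \<open>n + i\<close> of M are the
  first \<open>i\<close> copies transported \<open>n\<close> times. This is what lets a trace over
  the last factors be evaluated as a trace over the first ones.\<close>

lemma Mp_append: "n + i \<le> N + 1 \<Longrightarrow> Mp (n + i) = Mp n * (\<theta> N ^^ n) (Mp i)"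
  by (induction i) (auto simp: thn_simps thn_nb[OF m_loc] mult.assoc add.commute)

lemma gen_thn:
  assumes "b \<in> gen 1 i" "n + i \<le> N + 1"
  shows "(\<theta> N ^^ n) b = (sh ^^ n) b"
proof -
  have r: "(\<theta> N ^^ n) (r k) = r (k + n)" "(\<theta> N ^^ n) (ri k) = ri (k + n)" if "1 \<le> k" "k + n \<le> N" for k n
    using that by (induction n) (auto simp: theta_r)
  from assms show ?thesis
  proof (induction rule: gen.induct)
    case (scalar z)
    then show ?case by (auto simp: scalars_def thn_simps shn_simps)
  qed (auto simp: thn_simps shn_simps r shn_r)
qed

text \<open>Carried inwards past F_(j+1) F_j by \<open>compat_down\<close>, \<open>r j\<close>
  becomes \<open>r (Suc j)\<close>, which is disjoint from the rest of the transported matrix. It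
  returns to \<open>r j\<close> on the way out.\<close>

lemma r_nb:
  assumes "1 \<le> j" "j < k" "loc {1} x"
  shows "r j * nb k x = nb k x * r j"
  using assms(2)
proof (induction k)
  case (Suc k)
  show ?case
  proof (cases "j < k")
    case True
    have e: "r j * f (Suc k) = f (Suc k) * r j" "r j * fi (Suc k) = fi (Suc k) * r j"
      by (rule com[OF r_cst(1) r_loc(1) f_loc(1)]; use True in simp)
         (rule com[OF r_cst(1) r_loc(1) f_loc(2)]; use True in simp)
    show ?thesis by (simp only: nb.simps mult.assoc e(2) assoc_eq[OF e(1)] assoc_eq[OF Suc.IH[OF True]])
  next
    case False
    then obtain k' where k: "j = Suc k'" "k = Suc k'" using Suc.prems assms(1) by (cases k) auto
    have e: "r (Suc j) * nb k' x = nb k' x * r (Suc j)"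
      by (rule com[OF r_cst(1) r_loc(1) nb_loc[OF assms(3)]]) (auto simp: k)
    have "fi j * (fi (Suc j) * (r j * (f (Suc j) * (f j * (fi j * fi (Suc j)))))) =
        fi j * (fi (Suc j) * (f (Suc j) * (f j * (r (Suc j) * (fi j * fi (Suc j))))))"
      by (simp only: assoc_eq3[OF compat_down])
    then have e': "r (Suc j) * (fi j * fi (Suc j)) = fi j * (fi (Suc j) * r j)"
      by (simp add: f_inv f_inv_left)
    have "r j * nb (Suc k) x = (r j * (f (Suc j) * f j)) * (nb k' x * (fi j * fi (Suc j)))"
      by (simp add: k mult.assoc)
    also have "\<dots> = f (Suc j) * (f j * ((r (Suc j) * nb k' x) * (fi j * fi (Suc j))))"
      unfolding compat_down by (simp add: mult.assoc)
    also have "\<dots> = f (Suc j) * (f j * (nb k' x * (r (Suc j) * (fi j * fi (Suc j)))))"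
      unfolding e by (simp add: mult.assoc)
    finally show ?thesis unfolding e' by (simp add: k mult.assoc)
  qed
qed auto

lemma gen_com_r:
  assumes "a \<in> gen 1 n" and "\<And>j. 1 \<le> j \<Longrightarrow> j < n \<Longrightarrow> r j * x = x * r j"
  shows "a * x = x * a"
  using assms(1)
proof (induction rule: gen.induct)
  case (scalar z)
  then show ?case by (rule scalar_com)
next
  case (neg k)
  then show ?case using intertwine_inverse[OF assms(2)[of k, symmetric] r_inv(1) r_inv(2)] by simp
next
  case (mult y z)
  show ?case by (simp only: mult.assoc mult.IH(2) assoc_eq[OF mult.IH(1)])
qed (auto simp: assms(2) algebra_simps)

lemma gen_Mp_shift:
  assumes "a \<in> gen 1 n" "n + i \<le> N + 1"
  shows "a * (\<theta> N ^^ n) (Mp i) = (\<theta> N ^^ n) (Mp i) * a"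
  using assms(2)
proof (induction i)
  case (Suc i)
  have e1: "a * nb (i + n) m = nb (i + n) m * a"
    by (rule gen_com_r[OF assms(1)]) (rule r_nb[OF _ _ m_loc], auto)
  have e2: "(\<theta> N ^^ n) (Mp (Suc i)) = (\<theta> N ^^ n) (Mp i) * nb (i + n) m"
    using Suc.prems by (simp add: thn_simps thn_nb[OF m_loc])
  have e3: "a * (\<theta> N ^^ n) (Mp i) = (\<theta> N ^^ n) (Mp i) * a" using Suc by simp
  show ?case by (simp only: e1 e2 mult.assoc assoc_eq[OF e3])
qed (auto simp: thn_simps)

lemma r_Mp:
  assumes "1 \<le> k" "k < n"
  shows "r k * Mp n \<doteq> Mp n * r k"
  using assms(2)
proof (induction n)
  case (Suc n)
  show ?case
  proof (cases "k < n")
    case True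
    have "r k * Mp (Suc n) \<doteq> Mp n * r k * nb n m"
      using eqv_right[OF Suc.IH[OF True], of "nb n m"] by (simp add: mult.assoc)
    then show ?thesis using r_nb[OF assms(1) True m_loc] by (simp add: mult.assoc)
  next
    case False
    then have "k = n" using Suc.prems by simp
    then obtain k' where k: "k = Suc k'" "n = Suc k'" using assms(1) by (cases k) auto
    define N where "N = k' + 2"
    have e: "r k * Mp k' = Mp k' * r k"
      by (rule com[OF r_cst(1) r_loc(1) Mp_loc]) (auto simp: k)
    \<comment> \<open>The commutation relation in the factors \<open>k\<close>, \<open>k + 1\<close>
      is the defining one in the factors 1, 2, transported \<open>k'\<close> times.\<close>
    have "(\<theta> N ^^ k') (r 1 * (m * (f 1 * (m * fi 1)))) \<doteq> (\<theta> N ^^ k') (m * (f 1 * (m * fi 1)) * r 1)"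
      by (rule eqv_thn) (use rtt in \<open>simp add: eqv_def\<close>)
    moreover have t1: "(\<theta> N ^^ k') (r 1) = r k"
      using gen_thn[OF gen.pos[of 1 1 2], of k' N] by (simp add: N_def shn_r k)
    moreover have t2: "(\<theta> N ^^ k') m = nb k' m" "(\<theta> N ^^ k') (f 1 * (m * fi 1)) = nb (Suc k') m"
      using thn_nb[OF m_loc, of 0 k' N] thn_nb[OF m_loc, of 1 k' N] by (auto simp: N_def)
    ultimately have "r k * (nb k' m * nb (Suc k') m) \<doteq> nb k' m * nb (Suc k') m * r k"
      by (simp only: thn_simps(2)[of _ _ "r 1"] thn_simps(2)[of _ _ m] thn_simps(2)[of _ _ _ "r 1"])
    from eqv_left[OF this, of "Mp k'"] e show ?thesis
      by (simp only: k(2) Mp.simps mult.assoc assoc_eq[OF e])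
  qed
qed auto

lemma gen_Mp:
  assumes "a \<in> gen 1 n"
  shows "a * Mp n \<doteq> Mp n * a"
  using assms
proof (induction rule: gen.induct)
  case (scalar z)
  then show ?case using scalar_com[of z "Mp n"] by simp
next
  case (pos k)
  then show ?case by (intro r_Mp) auto
next
  case (neg k)
  from eqv_right[OF eqv_left[OF r_Mp[of k n], of "ri k"], of "ri k"] neg
  show ?case by (simp add: mult.assoc r_inv r_inv_left eqv_sym)
next
  case (mult y z)
  show ?case
    using eqv_trans[OF eqv_left[OF mult.IH(2), of y], of "Mp n * (y * z)"] eqv_right[OF mult.IH(1), of z]
    by (simp only: mult.assoc)
next
  case (add y z)
  then show ?case by (simp add: algebra_simps eqv_add)
qed

text \<open>\<open>pw p a\<close> is \<open>M\<^bsup>a\<^esup>\<close> for \<open>a\<close> on \<open>p + 1\<close> strands, \<open>chr n a\<close> is \<open>ch(a)\<close> for \<open>a\<close> on \<open>n\<close> strands, and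
  \<open>stp p a b\<close> is \<open>a \<star> b\<close>.  \<open>Rop p a\<close> and \<open>Lop q b\<close> are the two maps with
  \<open>M\<^bsup>a\<star>b\<^esup> = Rop p a (M\<^bsup>b\<^esup>) \<doteq> Lop q b (M\<^bsup>a\<^esup>)\<close>.\<close>

definition pw :: "nat \<Rightarrow> 'o \<Rightarrow> 'o" where
  "pw p a = trs 1 p (Mp (Suc p) * a)"

definition chr :: "nat \<Rightarrow> 'o \<Rightarrow> 'o" where
  "chr n a = trs 0 n (Mp n * a)"

definition Rop :: "nat \<Rightarrow> 'o \<Rightarrow> 'o \<Rightarrow> 'o" where
  "Rop p a x = trs 1 (Suc p) (Mp (Suc p) * (a * (nb (Suc p) x * s p)))"

definition Lop :: "nat \<Rightarrow> 'o \<Rightarrow> 'o \<Rightarrow> 'o" where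
  "Lop q b x = trs 1 (Suc q) (s' q * (Mp (Suc q) * (nb (Suc q) x * b)))"

definition stp :: "nat \<Rightarrow> 'o \<Rightarrow> 'o \<Rightarrow> 'o" where
  "stp p a b = a * ((sh ^^ Suc p) b * s p)"

section \<open>The two expressions for the star product\<close>

lemma gen_loc_sharp:
  assumes "a \<in> gen 1 n"
  shows "loc {1..n} a"
proof (cases "n = 0")
  case True
  from assms have "a \<in> scalars" unfolding True
  proof (induction rule: gen.induct)
    case (mult x y)
    then show ?case by (auto simp: scalars_def intro: loc_mult cst_mult)
  next
    case (add x y)
    then show ?case by (auto simp: scalars_def intro: loc_add cst_add)
  qed auto
  then show ?thesis by (auto simp: scalars_def intro: loc_mono)
qed (use assms gen_loc in blast)

lemma chr_loc: "a \<in> gen 1 n \<Longrightarrow> loc {} (chr n a)"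
  unfolding chr_def
  using trs_loc[OF loc_mult[OF Mp_loc gen_loc_sharp], of a n 0 n] by simp

lemma pw_loc: "a \<in> gen 1 (Suc p) \<Longrightarrow> loc {1} (pw p a)"
proof -
  assume "a \<in> gen 1 (Suc p)"
  from trs_loc[OF loc_mult[OF Mp_loc gen_loc_sharp[OF this]], of 1 p]
  have "loc ({1..Suc p} - {1 + 1..1 + p}) (pw p a)" unfolding pw_def .
  moreover have "{1..Suc p} - {1 + 1..1 + p} = {1}" by auto
  ultimately show ?thesis by simp
qed

lemma loc_le: "loc {1..n} x \<Longrightarrow> loc {..n} x"
  by (auto intro: loc_mono)

text \<open>Of the product for a \<star> b, the last \<open>q\<close> factors meet only the
  transported \<open>Mp (Suc q) * b\<close>: the braids \<open>a\<close> and \<open>s p\<close> end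
  at strand \<open>p + 2\<close>, and \<open>a\<close> commutes with the later copies of M. Tracing
  over them produces M^b, transported to the factor \<open>p + 2\<close>.\<close>

lemma Rop_pw:
  assumes "a \<in> gen 1 (Suc p)" "b \<in> gen 1 (Suc q)"
  shows "Rop p a (pw q b) = pw (Suc p + q) (stp p a b)"
proof -
  define N where "N = Suc p + Suc q"
  let ?T = "\<theta> N ^^ Suc p"
  have e: "Mp (Suc (Suc p + q)) = Mp (Suc p) * ?T (Mp (Suc q))" 
    using Mp_append[of "Suc p" "Suc q" N] by (simp add: N_def)
  have e1: "a * ?T (Mp (Suc q)) = ?T (Mp (Suc q)) * a"
    by (rule gen_Mp_shift[OF assms(1)]) (simp add: N_def)
  have e2: "?T b = (sh ^^ Suc p) b"
    by (rule gen_thn[OF assms(2)]) (simp add: N_def)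
  have "Mp (Suc (Suc p + q)) * stp p a b = Mp (Suc p) * (a * (?T (Mp (Suc q) * b) * s p))"
    by (simp only: e stp_def thn_simps(2) e2 mult.assoc assoc_eq[OF e1])
  then have "pw (Suc p + q) (stp p a b) =
      trs 1 (Suc p) (trs (1 + Suc p) q (Mp (Suc p) * (a * (?T (Mp (Suc q) * b) * s p))))"
    unfolding pw_def trs_append by simp
  also have "trs (1 + Suc p) q (Mp (Suc p) * (a * (?T (Mp (Suc q) * b) * s p))) =
      Mp (Suc p) * (a * (trs (1 + Suc p) q (?T (Mp (Suc q) * b)) * s p))"
  proof -
    have "trs (1 + Suc p) q (a * y) = a * trs (1 + Suc p) q y"
      "trs (1 + Suc p) q (Mp (Suc p) * y) = Mp (Suc p) * trs (1 + Suc p) q y"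
      "trs (1 + Suc p) q (y * s p) = trs (1 + Suc p) q y * s p" for y
      by ((rule trs_left[OF gen_loc[OF assms(1)]]; simp), (rule trs_left[OF Mp_loc]; simp),
          (rule trs_right[OF gen_loc[OF s_gen]]; simp))
    then show ?thesis by (simp only:)
  qed
  also have "trs (1 + Suc p) q (?T (Mp (Suc q) * b)) = ?T (pw q b)"
    unfolding pw_def
    using loc_le[OF loc_mult[OF Mp_loc gen_loc_sharp[OF assms(2)]]]
    by (intro trs_thn) (auto simp: N_def)
  also have "?T (pw q b) = nb (Suc p) (pw q b)"
    using thn_nb[OF pw_loc[OF assms(2)], of 0 "Suc p" N] by (simp add: N_def)
  finally show ?thesis by (simp add: Rop_def)
qed

text \<open>The same evaluation after the blocks have been exchanged: now \<open>b\<close> occupies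
  the first \<open>q + 1\<close> strands, and tracing over the last \<open>p\<close> factors
  produces M^a.\<close>

lemma Lop_pw:
  assumes "a \<in> gen 1 (Suc p)" "b \<in> gen 1 (Suc q)"
  shows "Lop q b (pw p a) = trs 1 (Suc p + q) (s' q * (Mp (Suc p + Suc q) * ((sh ^^ Suc q) a * b)))"
proof -
  define N where "N = Suc q + Suc p"
  let ?T = "\<theta> N ^^ Suc q"
  have e: "Mp (Suc p + Suc q) = Mp (Suc q) * ?T (Mp (Suc p))" 
    using Mp_append[of "Suc q" "Suc p" N] by (simp add: N_def add.commute)
  have "s' q * (Mp (Suc p + Suc q) * ((sh ^^ Suc q) a * b)) = s' q * (Mp (Suc q) * (?T (Mp (Suc p) * a) * b))"
    using gen_thn[OF assms(1), of "Suc q" N] unfolding e thn_simps by (simp add: N_def mult.assoc)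
  moreover have "trs 1 (Suc p + q) y = trs 1 (Suc q) (trs (1 + Suc q) p y)" for y
    using trs_append[of 1 "Suc q" p y] by (simp add: add.commute)
  moreover have "trs (1 + Suc q) p (s' q * (Mp (Suc q) * (?T (Mp (Suc p) * a) * b))) =
      s' q * (Mp (Suc q) * (trs (1 + Suc q) p (?T (Mp (Suc p) * a)) * b))"
  proof -
    have "trs (1 + Suc q) p (s' q * y) = s' q * trs (1 + Suc q) p y"
      "trs (1 + Suc q) p (Mp (Suc q) * y) = Mp (Suc q) * trs (1 + Suc q) p y"
      "trs (1 + Suc q) p (y * b) = trs (1 + Suc q) p y * b" for y
      by ((rule trs_left[OF gen_loc[OF s'_gen]]; simp), (rule trs_left[OF Mp_loc]; simp),
          (rule trs_right[OF gen_loc[OF assms(2)]]; simp))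
    then show ?thesis by (simp only:)
  qed
  moreover have "trs (1 + Suc q) p (?T (Mp (Suc p) * a)) = ?T (pw p a)"
    unfolding pw_def
    using loc_le[OF loc_mult[OF Mp_loc gen_loc_sharp[OF assms(1)]]]
    by (intro trs_thn) (auto simp: N_def)
  moreover have "?T (pw p a) = nb (Suc q) (pw p a)"
    using thn_nb[OF pw_loc[OF assms(1)], of 0 "Suc q" N] by (simp add: N_def)
  ultimately show ?thesis by (simp add: Lop_def)
qed

text \<open>By \<open>W_s\<close>, s_p = W^(-1) u with u on the strands from 2 on. Cyclicity brings
  u to the front, and the relations carry it past the copies of M. There u is read as s' W; W
  exchanges a and b and cancels W^(-1), and s' returns to the front of the copies of M.\<close>

lemma pw_stp_Lop:
  assumes "a \<in> gen 1 (Suc p)" "b \<in> gen 1 (Suc q)"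
  shows "pw (Suc p + q) (stp p a b) \<doteq> Lop q b (pw p a)"
proof -
  let ?W = "W (Suc p) (Suc q)" and ?a = "(sh ^^ Suc q) a" and ?b = "(sh ^^ Suc p) b"
  let ?u = "Wr (Suc p) q * cr p 2" and ?M = "Mp (Suc p + Suc q)"
  obtain Wi where Wi: "Wi * ?W = 1" "?W * Wi = 1" using W_inverse by blast
  have u: "?u \<in> gen (1 + 1) (1 + (Suc p + q))"
    using gen_mono[OF Wr_gen[of "Suc p" q], of 2 "1 + (Suc p + q)"] gen_mono[OF cr_gen[of p 2], of 2 "1 + (Suc p + q)"]
    by (simp add: gen.mult numeral_2_eq_2)
  have u1: "?u \<in> gen 1 (Suc p + Suc q)" by (rule gen_mono[OF u]) auto
  have s': "s' q \<in> gen 1 (Suc p + Suc q)" by (rule gen_mono[OF s'_gen]) auto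
  have "Wi * (?W * s p) = s p" by (simp only: mult.assoc[symmetric] Wi mult_1_left)
  then have su: "s p = Wi * ?u" by (simp only: W_s)
  have "pw (Suc p + q) (stp p a b) = trs 1 (Suc p + q) ((?M * (a * (?b * Wi))) * ?u)"
    by (simp add: pw_def stp_def su mult.assoc)
  also have "\<dots> = trs 1 (Suc p + q) (?u * (?M * (a * (?b * Wi))))"
    using trs_cyc[OF u] by simp
  also have "\<dots> \<doteq> trs 1 (Suc p + q) (?M * ?u * (a * (?b * Wi)))"
    using eqv_right[OF gen_Mp[OF u1], of "a * (?b * Wi)"] by (intro eqv_trs) (simp add: mult.assoc)
  also have "?M * ?u * (a * (?b * Wi)) = ?M * (s' q * ((?W * a) * (?b * Wi)))"
    unfolding s'_W[symmetric] by (simp add: mult.assoc)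
  also have "\<dots> = ?M * (s' q * (?a * ((?W * ?b) * Wi)))"
    unfolding W_left[OF assms(1)] by (simp only: mult.assoc)
  also have "\<dots> = (?M * s' q) * (?a * b)"
    unfolding W_right[OF assms(2)] by (simp only: mult.assoc Wi mult.right_neutral)
  also have "trs 1 (Suc p + q) ((?M * s' q) * (?a * b)) \<doteq> trs 1 (Suc p + q) ((s' q * ?M) * (?a * b))"
    by (intro eqv_trs eqv_right eqv_sym[OF gen_Mp[OF s']])
  finally show ?thesis unfolding Lop_pw[OF assms] by (simp only: mult.assoc)
qed

lemma Rop_Lop:
  "a \<in> gen 1 (Suc p) \<Longrightarrow> b \<in> gen 1 (Suc q) \<Longrightarrow> Rop p a (pw q b) \<doteq> Lop q b (pw p a)"
  using pw_stp_Lop Rop_pw by simp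

text \<open>At the identity matrix only \<open>s p\<close> acts in the last factor, and its R-trace
  over that factor is 1. With \<open>Lop_one\<close> this makes the product compatible with I
  c.\<close>

lemma Rop_one:
  assumes "a \<in> gen 1 (Suc p)"
  shows "Rop p a 1 = pw p a"
proof -
  have "tr (Suc (Suc p)) (Mp (Suc p) * (a * s p)) = Mp (Suc p) * (a * tr (Suc (Suc p)) (s p))"
    by (subst tr_left[OF Mp_loc] tr_left[OF gen_loc[OF assms]]; simp)+
  then show ?thesis using tr_s[of p] by (simp add: Rop_def pw_def nb_scalar[OF loc_one] del: nb.simps)
qed

lemma Lop_one:
  assumes "b \<in> gen 1 (Suc q)"
  shows "Lop q b 1 = pw q b"
proof -
  have l: "loc {1..Suc q} (Mp (Suc q) * b)"
    by (intro loc_mult Mp_loc gen_loc_sharp assms)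
  have "tr (Suc (Suc q)) (s' q * (Mp (Suc q) * b)) = tr (Suc (Suc q)) (s' q) * (Mp (Suc q) * b)"
    by (subst tr_right[OF l]; simp)
  then show ?thesis using tr_s'[of q] by (simp add: Lop_def pw_def nb_scalar[OF loc_one] del: nb.simps)
qed

lemma Rop_mult_scalar:
  assumes "loc {} z"
  shows "Rop p a (x * z) = Rop p a x * z"
proof -
  have e: "s p * z = z * s p" by (rule com_gen[OF s_gen assms]) simp
  have "Mp (Suc p) * (a * (nb (Suc p) (x * z) * s p)) = Mp (Suc p) * (a * (nb (Suc p) x * s p)) * z"
    unfolding nb_mult_scalar[OF assms] by (simp only: mult.assoc e)
  then show ?thesis unfolding Rop_def using trs_right[OF assms] by simp
qed

lemma Lop_mult_scalar:
  assumes "loc {} z" "b \<in> gen 1 (Suc q)"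
  shows "Lop q b (x * z) = Lop q b x * z"
proof -
  have e: "b * z = z * b" by (rule com_gen[OF assms(2,1)]) simp
  have "s' q * (Mp (Suc q) * (nb (Suc q) (x * z) * b)) = s' q * (Mp (Suc q) * (nb (Suc q) x * b)) * z"
    unfolding nb_mult_scalar[OF assms(1)] by (simp only: mult.assoc e)
  then show ?thesis unfolding Lop_def using trs_right[OF assms(1)] by simp
qed

lemma Rop_add: "Rop p a (x + y) = Rop p a x + Rop p a y"
  by (simp only: Rop_def nb_add distrib_left distrib_right trs_add)

lemma Lop_add: "Lop q b (x + y) = Lop q b x + Lop q b y"
  by (simp only: Lop_def nb_add distrib_left distrib_right trs_add)

lemma eqv_Rop: "x \<doteq> y \<Longrightarrow> Rop p a x \<doteq> Rop p a y"
  unfolding Rop_def by (intro eqv_trs eqv_left eqv_right eqv_nb)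

lemma eqv_Lop: "x \<doteq> y \<Longrightarrow> Lop q b x \<doteq> Lop q b y"
  unfolding Lop_def by (intro eqv_trs eqv_left eqv_right eqv_nb)

text \<open>The braid of the third factor lies beyond the strands of \<open>s p\<close> and commutes
  with it. What remains to be compared are the products of the two conjugates of R, which is
  \<open>s_s\<close>.\<close>

lemma stp_assoc: 
  assumes "b' \<in> gen 1 k"
  shows "stp (Suc p + q) (stp p a b) b' = stp p a (stp q b b')"
proof -
  let ?b' = "(sh ^^ Suc (Suc p + q)) b'"
  have "?b' \<in> gen (1 + Suc (Suc p + q)) (k + Suc (Suc p + q))" by (rule gen_sh[OF assms])
  from com_gen[OF s_gen gen_loc[OF this], of p] have e: "s p * ?b' = ?b' * s p" by auto
  have e': "(sh ^^ Suc p) ((sh ^^ Suc q) b') = ?b'"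
    using funpow_add[of "Suc p" "Suc q" sh] by (simp add: comp_def)
  have "stp (Suc p + q) (stp p a b) b' = a * ((sh ^^ Suc p) b * ((s p * ?b') * s (Suc p + q)))"
    by (simp only: stp_def mult.assoc)
  also have "\<dots> = a * ((sh ^^ Suc p) b * (?b' * (s p * s (p + 1 + q))))"
    unfolding e by (simp add: mult.assoc)
  also have "\<dots> = stp p a (stp q b b')"
    unfolding s_s stp_def shn_simps e' by (simp add: mult.assoc)
  finally show ?thesis .
qed

text \<open>Only the last \<open>i\<close> factors are traced here; tracing further over the factors
  from 2, or from 1, gives \<open>pw_chr\<close> and \<open>chr_chr\<close>.\<close>

lemma mult_chr:
  assumes "a \<in> gen 1 n" "b \<in> gen 1 i"
  shows "trs n i (Mp (n + i) * (a * (sh ^^ n) b)) = Mp n * a * chr i b"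
proof -
  define N where "N = n + i"
  let ?T = "\<theta> N ^^ n"
  have e: "Mp (n + i) = Mp n * ?T (Mp i)" using Mp_append[of n i N] by (simp add: N_def)
  have e1: "a * ?T (Mp i) = ?T (Mp i) * a"
    by (rule gen_Mp_shift[OF assms(1)]) (simp add: N_def)
  have e2: "?T b = (sh ^^ n) b"
    by (rule gen_thn[OF assms(2)]) (simp add: N_def)
  have "Mp (n + i) * (a * (sh ^^ n) b) = Mp n * (a * ?T (Mp i * b))"
    by (simp only: e thn_simps(2) e2 mult.assoc assoc_eq[OF e1])
  moreover have "trs n i (Mp n * (a * ?T (Mp i * b))) = Mp n * (a * trs n i (?T (Mp i * b)))"
  proof -
    have "trs n i (a * y) = a * trs n i y" "trs n i (Mp n * y) = Mp n * trs n i y" for y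
      by (rule trs_left[OF gen_loc_sharp[OF assms(1)]]; simp) (rule trs_left[OF Mp_loc]; simp)
    then show ?thesis by (simp only:)
  qed
  moreover have "trs (0 + n) i (?T (Mp i * b)) = ?T (chr i b)"
    unfolding chr_def
    using loc_le[OF loc_mult[OF Mp_loc gen_loc_sharp[OF assms(2)]]]
    by (intro trs_thn) (auto simp: N_def)
  moreover have "?T (chr i b) = chr i b" using thn_simps(4)[OF chr_loc[OF assms(2)]] .
  ultimately show ?thesis by (simp add: mult.assoc)
qed

lemma pw_chr:
  assumes "a \<in> gen 1 (Suc p)" "b \<in> gen 1 i"
  shows "pw p a * chr i b = pw (p + i) (a * (sh ^^ Suc p) b)"
proof -
  have "pw (p + i) (a * (sh ^^ Suc p) b) = trs 1 p (Mp (Suc p) * a * chr i b)"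
    using mult_chr[OF assms] unfolding pw_def trs_append by simp
  then show ?thesis using trs_right[OF chr_loc[OF assms(2)]] by (simp add: pw_def)
qed

lemma chr_chr:
  assumes "a \<in> gen 1 n" "b \<in> gen 1 i"
  shows "chr n a * chr i b = chr (n + i) (a * (sh ^^ n) b)"
proof -
  have "chr (n + i) (a * (sh ^^ n) b) = trs 0 n (Mp n * a * chr i b)"
    using mult_chr[OF assms] unfolding chr_def trs_append by simp
  then show ?thesis using trs_right[OF chr_loc[OF assms(2)]] by (simp add: chr_def)
qed

text \<open>As in \<open>pw_stp_Lop\<close>, but with factor 1 traced as well: the whole exchange
  \<open>W\<close> is then cyclic, and no conjugate of R is left over. The two braids end up on
  disjoint strands and may be reordered.\<close>

lemma chr_com:
  assumes "a \<in> gen 1 n" "b \<in> gen 1 i"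
  shows "chr n a * chr i b \<doteq> chr i b * chr n a"
proof -
  let ?W = "W n i" and ?a = "(sh ^^ i) a" and ?b = "(sh ^^ n) b"
  obtain Wi where Wi: "Wi * ?W = 1" "?W * Wi = 1" using W_inverse by blast
  have Wg: "?W \<in> gen (0 + 1) (0 + (n + i))" using W_gen by simp
  have "Mp (n + i) * (a * ?b) = Mp (n + i) * (a * (?b * Wi)) * ?W"
    by (simp add: mult.assoc Wi)
  then have "chr n a * chr i b = trs 0 (n + i) (?W * (Mp (n + i) * (a * (?b * Wi))))"
    unfolding chr_chr[OF assms] unfolding chr_def trs_cyc[OF Wg, unfolded add_0] by simp
  also have "\<dots> \<doteq> trs 0 (n + i) (Mp (n + i) * ?W * (a * (?b * Wi)))"
    using eqv_right[OF gen_Mp[OF W_gen], of n i "a * (?b * Wi)"] by (intro eqv_trs) (simp add: mult.assoc)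
  also have "Mp (n + i) * ?W * (a * (?b * Wi)) = Mp (n + i) * ((?W * a) * (?b * Wi))"
    by (simp only: mult.assoc)
  also have "\<dots> = Mp (n + i) * (?a * ((?W * ?b) * Wi))"
    unfolding W_left[OF assms(1)] by (simp only: mult.assoc)
  also have "\<dots> = Mp (n + i) * (?a * b)"
    unfolding W_right[OF assms(2)] by (simp only: mult.assoc Wi mult.right_neutral)
  also have "?a * b = b * ?a"
  proof (rule com)
    show "cst ?a" using gen_cst[OF assms(1)] by (rule shn_cst)
    show "loc ((\<lambda>j. j + i) ` {1..n}) ?a" using shn_loc[OF gen_loc_sharp[OF assms(1)]] .
    show "loc {1..i} b" using gen_loc_sharp[OF assms(2)] .
  qed auto
  also have "trs 0 (n + i) (Mp (n + i) * (b * ?a)) = chr i b * chr n a"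
    unfolding chr_chr[OF assms(2,1)] unfolding chr_def by (simp add: add.commute)
  finally show ?thesis .
qed

end

subsection \<open>The star product on representatives\<close>

text \<open>\<open>G n\<close> is the image of the group algebra of the braid group on \<open>n\<close> strands; \<open>csp\<close> and \<open>psp\<close>
  consist of operators representing the elements of \<open>\<C>(R,F)\<close> and \<open>\<P>(R,F)\<close>.\<close>

locale star_operators = quantum_matrix_operators loc cst tr sh r ri f fi m J
  for loc :: "nat set \<Rightarrow> 'o::ring_1 \<Rightarrow> bool" and cst tr sh r ri f fi m J +
  fixes G :: "nat \<Rightarrow> 'o set"
  assumes G_gen: "a \<in> G n \<Longrightarrow> a \<in> gen 1 n"
    and G_shift: "a \<in> G n \<Longrightarrow> b \<in> G i \<Longrightarrow> a * (sh ^^ n) b \<in> G (n + i)"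
    and G_stp: "a \<in> G (Suc p) \<Longrightarrow> b \<in> G (Suc q) \<Longrightarrow> stp p a b \<in> G (Suc (Suc p + q))"
begin

inductive_set csp :: "'o set" where
  one: "1 \<in> csp"
| chr: "1 \<le> n \<Longrightarrow> a \<in> G n \<Longrightarrow> chr n a \<in> csp"
| add: "x \<in> csp \<Longrightarrow> y \<in> csp \<Longrightarrow> x + y \<in> csp"
| scal: "z \<in> scalars \<Longrightarrow> x \<in> csp \<Longrightarrow> z * x \<in> csp"

inductive_set psp :: "'o set" where
  pw: "a \<in> G (Suc p) \<Longrightarrow> pw p a \<in> psp"
| csp: "x \<in> csp \<Longrightarrow> x \<in> psp"
| add: "x \<in> psp \<Longrightarrow> y \<in> psp \<Longrightarrow> x + y \<in> psp"
| scal: "z \<in> scalars \<Longrightarrow> x \<in> psp \<Longrightarrow> z * x \<in> psp"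

lemma scalars_csp: "z \<in> scalars \<Longrightarrow> z \<in> csp"
  using csp.scal[OF _ csp.one] by simp

lemma csp_loc: "x \<in> csp \<Longrightarrow> loc {} x"
  by (induction rule: csp.induct) (auto simp: scalars_def intro: loc_one loc_add loc_mult chr_loc G_gen)

lemma psp_loc: "x \<in> psp \<Longrightarrow> loc {1} x"
proof (induction rule: psp.induct)
  case (csp x)
  then show ?case using csp_loc loc_mono by blast
next
  case (scal z x)
  then show ?case using loc_mono[of "{}" z] loc_mult by (auto simp: scalars_def)
qed (auto intro!: loc_add pw_loc[simplified] dest: G_gen)

lemma csp_mult: "x \<in> csp \<Longrightarrow> y \<in> csp \<Longrightarrow> x * y \<in> csp"
proof (induction rule: csp.induct)
  case (chr n a)
  from chr(3) show ?case
  proof (induction rule: csp.induct)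
    case (scal z x)
    have "chr n a * (z * x) = z * (chr n a * x)"
      using assoc_eq[OF scalar_com[OF scal(1), of "chr n a", symmetric], of x] by simp
    then show ?case using scal by (auto intro: csp.scal)
  next
    case (chr i b)
    then show ?case
      using csp.chr[OF _ G_shift[OF \<open>a \<in> G n\<close> chr(2)]] chr_chr[OF G_gen[OF \<open>a \<in> G n\<close>] G_gen[OF chr(2)]]
      by simp
  qed (use chr in \<open>auto simp: distrib_left intro: csp.chr csp.add\<close>)
qed (auto simp: distrib_right mult.assoc intro: csp.add csp.scal)

lemma csp_com: "x \<in> csp \<Longrightarrow> y \<in> csp \<Longrightarrow> x * y \<doteq> y * x"
proof (induction rule: csp.induct)
  case (chr n a)
  from chr(3) show ?case
  proof (induction rule: csp.induct)
    case (scal z x)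
    have "chr n a * (z * x) = z * (chr n a * x)"
      using assoc_eq[OF scalar_com[OF scal(1), of "chr n a", symmetric], of x] by simp
    then show ?case using eqv_left[OF scal(3), of z] by (simp add: mult.assoc)
  qed (auto simp: distrib_left distrib_right intro: chr_com eqv_add G_gen chr)
next
  case (scal z x)
  have "y * (z * x) = z * (y * x)"
    using assoc_eq[OF scalar_com[OF scal(1), of y, symmetric], of x] by simp
  then show ?case using eqv_left[OF scal(3), of z] scal(4) by (simp add: mult.assoc)
qed (auto simp: distrib_left distrib_right intro: eqv_add)

lemma psp_mult_csp: "x \<in> psp \<Longrightarrow> y \<in> csp \<Longrightarrow> x * y \<in> psp"
proof (induction rule: psp.induct)
  case (pw a p)
  from pw(2) show ?case
  proof (induction rule: csp.induct)
    case one
    then show ?case using pw by (auto intro: psp.pw)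
  next
    case (chr n b)
    then show ?case
      using psp.pw[of _ "p + n"] G_shift[OF pw(1) chr(2)] pw_chr[OF G_gen[OF pw(1)] G_gen[OF chr(2)]] by simp
  next
    case (scal z x)
    have "pw p a * (z * x) = z * (pw p a * x)"
      using assoc_eq[OF scalar_com[OF scal(1), of "pw p a", symmetric], of x] by simp
    then show ?case using scal by (auto intro: psp.scal)
  qed (auto simp: distrib_left intro: psp.add)
qed (auto simp: distrib_right mult.assoc intro: psp.intros csp_mult)

text \<open>For a fixed \<open>T\<close> such a map is unique on \<open>psp\<close> modulo \<open>J\<close>, and it respects \<open>\<doteq>\<close> in its argument; the last
  two clauses depend on \<open>T\<close> only modulo \<open>J\<close>.  So existence for every \<open>T\<close> is well-definedness of the
  product in both arguments.\<close>

definition left_mult :: "'o \<Rightarrow> ('o \<Rightarrow> 'o) \<Rightarrow> bool" where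
  "left_mult T F \<longleftrightarrow> (\<forall>x y. F (x + y) = F x + F y) \<and> (\<forall>x y. x \<doteq> y \<longrightarrow> F x \<doteq> F y) \<and>
     (\<forall>x. \<forall>c\<in>csp. F (x * c) \<doteq> F x * c) \<and> F 1 \<doteq> T \<and>
     (\<forall>q. \<forall>b\<in>G (Suc q). F (pw q b) \<doteq> Lop q b T)"

text \<open>A power is served by \<open>Rop p a\<close>, a characteristic element by right
  multiplication with it; sums and multiples are formed pointwise. Different presentations of
  \<open>T\<close> may yield different maps, but each satisfies \<open>left_mult\<close>, in which
  the presentation no longer occurs.\<close>

lemma left_mult_exists:
  assumes "T \<in> psp"
  shows "\<exists>F. left_mult T F"
  using assms
proof (induction rule: psp.induct)
  case (pw a p)
  have "left_mult (pw p a) (Rop p a)"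
    unfolding left_mult_def using G_gen[OF pw] G_gen
    by (auto simp: Rop_add eqv_Rop Rop_mult_scalar csp_loc Rop_one simp del: One_nat_def intro!: Rop_Lop)
  then show ?case by blast
next
  case (csp x)
  have "left_mult x (\<lambda>y. y * x)"
    unfolding left_mult_def
  proof (intro conjI allI ballI impI)
    fix y c
    assume c: "c \<in> csp"
    show "y * c * x \<doteq> y * x * c"
      using eqv_left[OF csp_com[OF c csp], of y] by (simp add: mult.assoc)
  next
    fix q b
    assume "b \<in> G (Suc q)"
    then show "pw q b * x \<doteq> Lop q b x"
      using Lop_mult_scalar[OF csp_loc[OF csp], of b q 1] Lop_one[of b q] G_gen by simp
  qed (auto simp: distrib_right eqv_right)
  then show ?case by blast
next
  case (add x y)
  then obtain F F' where F: "left_mult x F" "left_mult y F'" by blast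
  have "left_mult (x + y) (\<lambda>v. F v + F' v)"
    unfolding left_mult_def
  proof (intro conjI allI ballI impI)
    fix v w
    show "F (v + w) + F' (v + w) = F v + F' v + (F w + F' w)"
      using F by (simp add: left_mult_def algebra_simps)
  qed (use F in \<open>simp_all add: left_mult_def distrib_right Lop_add eqv_add\<close>)
  then show ?case by blast
next
  case (scal z x)
  then obtain F where F: "left_mult x F" by blast
  have z: "loc {} z" using scal by (simp add: scalars_def)
  have "left_mult (z * x) (\<lambda>v. z * F v)"
    unfolding left_mult_def
  proof (intro conjI allI ballI impI)
    fix q b
    assume b: "b \<in> G (Suc q)"
    have "Lop q b (z * x) = z * Lop q b x"
      using Lop_mult_scalar[OF z, of b q x] G_gen[OF b] scalar_com[OF scal(1), of x]
        scalar_com[OF scal(1), of "Lop q b x"] by simp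
    then show "z * F (pw q b) \<doteq> Lop q b (z * x)"
      using F b unfolding left_mult_def by (simp add: eqv_left)
  qed (use F in \<open>auto simp: left_mult_def algebra_simps eqv_left\<close>)
  then show ?case by blast
qed

definition star :: "'o \<Rightarrow> 'o \<Rightarrow> 'o" where
  "star T = (SOME F. left_mult T F)"

lemma left_mult_star: "T \<in> psp \<Longrightarrow> left_mult T (star T)"
  unfolding star_def by (rule someI_ex[OF left_mult_exists])

section \<open>Bilinearity and special values of the star product\<close>

lemma star_add_right: "T \<in> psp \<Longrightarrow> star T (x + y) = star T x + star T y"
  using left_mult_star unfolding left_mult_def by blast

lemma star_eqv_right: "T \<in> psp \<Longrightarrow> x \<doteq> y \<Longrightarrow> star T x \<doteq> star T y"
  using left_mult_star unfolding left_mult_def by blast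

lemma star_mult_right: "T \<in> psp \<Longrightarrow> c \<in> csp \<Longrightarrow> star T (x * c) \<doteq> star T x * c"
  using left_mult_star unfolding left_mult_def by blast

lemma star_pw_right: "T \<in> psp \<Longrightarrow> b \<in> G (Suc q) \<Longrightarrow> star T (pw q b) \<doteq> Lop q b T"
  using left_mult_star unfolding left_mult_def by blast

lemma star_csp_right:
  assumes "T \<in> psp" "c \<in> csp"
  shows "star T c \<doteq> T * c"
proof -
  have "star T 1 \<doteq> T" using left_mult_star[OF assms(1)] unfolding left_mult_def by blast
  then show ?thesis using star_mult_right[OF assms, of 1] eqv_trans[OF _ eqv_right] by simp
qed

lemma star_scal_right: "T \<in> psp \<Longrightarrow> z \<in> scalars \<Longrightarrow> star T (z * x) \<doteq> z * star T x"
  using star_mult_right[of T z x] scalars_csp[of z] scalar_com[of z x] scalar_com[of z "star T x"] by simp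

text \<open>Agreement modulo \<open>J\<close> need only be checked on the powers and on
  \<open>csp\<close>. The latter enters as a whole because \<open>star_csp_right\<close> gives the
  value at each of its elements.\<close>

lemma psp_eqv_extend:
  assumes "Y \<in> psp"
    and "\<And>x y. x \<in> psp \<Longrightarrow> y \<in> psp \<Longrightarrow> F (x + y) \<doteq> F x + F y"
    and "\<And>x y. x \<in> psp \<Longrightarrow> y \<in> psp \<Longrightarrow> F' (x + y) \<doteq> F' x + F' y"
    and "\<And>z x. z \<in> scalars \<Longrightarrow> x \<in> psp \<Longrightarrow> F (z * x) \<doteq> z * F x"
    and "\<And>z x. z \<in> scalars \<Longrightarrow> x \<in> psp \<Longrightarrow> F' (z * x) \<doteq> z * F' x"
    and "\<And>c. c \<in> csp \<Longrightarrow> F c \<doteq> F' c"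
    and "\<And>q b. b \<in> G (Suc q) \<Longrightarrow> F (pw q b) \<doteq> F' (pw q b)"
  shows "F Y \<doteq> F' Y"
  using assms(1)
proof (induction rule: psp.induct)
  case (add x y)
  show ?case
    using eqv_trans[OF assms(2)[OF add(1,2)] eqv_trans[OF eqv_add[OF add(3,4)] eqv_sym[OF assms(3)[OF add(1,2)]]]]
    by simp
next
  case (scal z x)
  show ?case
    using eqv_trans[OF assms(4)[OF scal(1,2)] eqv_trans[OF eqv_left[OF scal(3)] eqv_sym[OF assms(5)[OF scal(1,2)]]]]
    by simp
qed (use assms in auto)

text \<open>The values at characteristic elements and at powers are \<open>T * c\<close> and
  \<open>Lop q b T\<close> modulo \<open>J\<close>, and both respect \<open>eqv\<close> in
  \<open>T\<close>. Here the second expression for the product is indispensable.\<close>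

lemma star_eqv_left:
  assumes "T \<in> psp" "T' \<in> psp" "T \<doteq> T'" "Y \<in> psp"
  shows "star T Y \<doteq> star T' Y"
proof (rule psp_eqv_extend[OF assms(4)])
  fix c assume "c \<in> csp"
  then show "star T c \<doteq> star T' c"
    using eqv_trans[OF star_csp_right[OF assms(1)]
        eqv_trans[OF eqv_right[OF assms(3)] eqv_sym[OF star_csp_right[OF assms(2)]]]] by blast
next
  fix q b assume "b \<in> G (Suc q)"
  then show "star T (pw q b) \<doteq> star T' (pw q b)"
    using eqv_trans[OF star_pw_right[OF assms(1)]
        eqv_trans[OF eqv_Lop[OF assms(3)] eqv_sym[OF star_pw_right[OF assms(2)]]]] by blast
qed (use assms in \<open>simp_all add: star_add_right star_scal_right\<close>)

lemma star_add_left: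
  assumes "T \<in> psp" "T' \<in> psp" "Y \<in> psp"
  shows "star (T + T') Y \<doteq> star T Y + star T' Y"
proof (rule psp_eqv_extend[OF assms(3)])
  have TT: "T + T' \<in> psp" using assms by (auto intro: psp.add)
  fix c assume c: "c \<in> csp"
  have "star (T + T') c \<doteq> (T + T') * c" using star_csp_right[OF TT c] .
  moreover have "star T c + star T' c \<doteq> (T + T') * c"
    unfolding distrib_right using assms c by (intro eqv_add star_csp_right)
  ultimately show "star (T + T') c \<doteq> star T c + star T' c" using eqv_trans eqv_sym by blast
next
  have TT: "T + T' \<in> psp" using assms by (auto intro: psp.add)
  fix q b assume b: "b \<in> G (Suc q)"
  have "star (T + T') (pw q b) \<doteq> Lop q b (T + T')" using star_pw_right[OF TT b] .
  moreover have "star T (pw q b) + star T' (pw q b) \<doteq> Lop q b (T + T')"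
    unfolding Lop_add using assms b by (intro eqv_add star_pw_right)
  ultimately show "star (T + T') (pw q b) \<doteq> star T (pw q b) + star T' (pw q b)"
    using eqv_trans eqv_sym by blast
next
  fix z x assume "z \<in> scalars" "x \<in> psp"
  then show "star T (z * x) + star T' (z * x) \<doteq> z * (star T x + star T' x)"
    unfolding distrib_left using assms by (intro eqv_add star_scal_right)
qed (use assms in \<open>simp_all add: star_add_right star_scal_right psp.add algebra_simps\<close>)

lemma eqv_csp_right_com: "c \<in> csp \<Longrightarrow> d \<in> csp \<Longrightarrow> x * c * d \<doteq> x * d * c"
  using eqv_left[OF csp_com, of c d x] by (simp add: mult.assoc)

lemma star_mult_left:
  assumes "T \<in> psp" "c \<in> csp" "Y \<in> psp"
  shows "star (T * c) Y \<doteq> star T Y * c"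
proof (rule psp_eqv_extend[OF assms(3)])
  have T: "T * c \<in> psp" using assms by (auto intro: psp_mult_csp)
  fix d assume d: "d \<in> csp"
  have "star (T * c) d \<doteq> T * c * d" using star_csp_right[OF T d] .
  also have "\<dots> \<doteq> T * d * c" by (rule eqv_csp_right_com[OF assms(2) d])
  also have "\<dots> \<doteq> star T d * c" by (intro eqv_right eqv_sym[OF star_csp_right[OF assms(1) d]])
  finally show "star (T * c) d \<doteq> star T d * c" .
next
  have T: "T * c \<in> psp" using assms by (auto intro: psp_mult_csp)
  fix q b assume b: "b \<in> G (Suc q)"
  have "star (T * c) (pw q b) \<doteq> Lop q b T * c"
    using star_pw_right[OF T b] Lop_mult_scalar[OF csp_loc[OF assms(2)] G_gen[OF b]] by simp
  also have "\<dots> \<doteq> star T (pw q b) * c"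
    by (intro eqv_right eqv_sym[OF star_pw_right[OF assms(1) b]])
  finally show "star (T * c) (pw q b) \<doteq> star T (pw q b) * c" .
next
  fix z x assume "z \<in> scalars" "x \<in> psp"
  then show "star T (z * x) * c \<doteq> z * (star T x * c)"
    using eqv_right[OF star_scal_right[OF assms(1)], of z x c] by (simp add: mult.assoc)
next
  fix z x assume "z \<in> scalars" "x \<in> psp"
  then show "star (T * c) (z * x) \<doteq> z * star (T * c) x"
    using star_scal_right[OF psp_mult_csp[OF assms(1,2)]] by simp
qed (use assms in \<open>simp_all add: star_add_right psp_mult_csp distrib_right\<close>)

lemma star_scal_left:
  assumes "T \<in> psp" "z \<in> scalars" "Y \<in> psp"
  shows "star (z * T) Y \<doteq> z * star T Y"
  using star_mult_left[OF assms(1) scalars_csp[OF assms(2)] assms(3)]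
  by (simp only: scalar_com[OF assms(2), of T] scalar_com[OF assms(2), of "star T Y"])

text \<open>\<open>star (pw p a)\<close> is a map picked by choice, known only through
  \<open>left_mult\<close>. On \<open>psp\<close> it is identified here, modulo \<open>J\<close>,
  with the explicit map \<open>Rop p a\<close>.\<close>

lemma star_pw_left:
  assumes "a \<in> G (Suc p)" "Y \<in> psp"
  shows "star (pw p a) Y \<doteq> Rop p a Y"
proof (rule psp_eqv_extend[OF assms(2)])
  have T: "pw p a \<in> psp" using assms by (auto intro: psp.pw)
  { fix d assume d: "d \<in> csp"
    show "star (pw p a) d \<doteq> Rop p a d"
      using star_csp_right[OF T d] Rop_mult_scalar[OF csp_loc[OF d], of p a 1] Rop_one[OF G_gen[OF assms(1)]]
      by simp }
  { fix q b assume b: "b \<in> G (Suc q)"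
    show "star (pw p a) (pw q b) \<doteq> Rop p a (pw q b)"
      using star_pw_right[OF T b] Rop_Lop[OF assms(1)[THEN G_gen] G_gen[OF b]] eqv_trans eqv_sym by blast }
  { fix z x assume z: "z \<in> scalars"
    then show "Rop p a (z * x) \<doteq> z * Rop p a x"
      using Rop_mult_scalar[of z p a x] scalar_com[OF z, of x] scalar_com[OF z, of "Rop p a x"]
      by (simp add: scalars_def) }
  { fix z x assume "z \<in> scalars"
    then show "star (pw p a) (z * x) \<doteq> z * star (pw p a) x"
      using star_scal_right[OF T] by simp }
  { fix x y
    show "star (pw p a) (x + y) \<doteq> star (pw p a) x + star (pw p a) y"
      using star_add_right[OF T] by simp }
qed (simp add: Rop_add)

lemma star_pw_pw:
  assumes "a \<in> G (Suc p)" "b \<in> G (Suc q)"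
  shows "star (pw p a) (pw q b) \<doteq> pw (Suc p + q) (stp p a b)"
  using star_pw_left[OF assms(1) psp.pw[OF assms(2)]] Rop_pw[OF assms[THEN G_gen]] by simp

lemma star_csp_left:
  assumes "c \<in> csp" "Y \<in> psp"
  shows "star c Y \<doteq> Y * c"
proof (rule psp_eqv_extend[OF assms(2)])
  have T: "c \<in> psp" using assms by (auto intro: psp.csp)
  { fix d assume d: "d \<in> csp"
    show "star c d \<doteq> d * c"
      using star_csp_right[OF T d] csp_com[OF assms(1) d] eqv_trans by blast }
  { fix q b assume b: "b \<in> G (Suc q)"
    show "star c (pw q b) \<doteq> pw q b * c"
      using star_pw_right[OF T b] Lop_mult_scalar[OF csp_loc[OF assms(1)] G_gen[OF b], of 1]
        Lop_one[OF G_gen[OF b]] by simp }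
  { fix z x assume "z \<in> scalars"
    then show "star c (z * x) \<doteq> z * star c x" using star_scal_right[OF T] by simp }
  { fix x y
    show "star c (x + y) \<doteq> star c x + star c y" using star_add_right[OF T] by simp }
qed (simp_all add: distrib_right mult.assoc)

text \<open>Closure can only be claimed modulo \<open>J\<close>: the chosen map is not known to send
  \<open>psp\<close> into \<open>psp\<close>. The representative \<open>Z\<close> stands in for the
  product when it is multiplied again.\<close>

lemma star_closed:
  assumes "T \<in> psp" "Y \<in> psp"
  shows "\<exists>Z\<in>psp. star T Y \<doteq> Z"
  using assms(1)
proof (induction rule: psp.induct)
  case (pw a p)
  have T: "pw p a \<in> psp" using pw by (auto intro: psp.pw)
  from assms(2) show ?case
  proof (induction rule: psp.induct)
    case (pw b q)
    then show ?case using star_pw_pw[OF \<open>a \<in> G (Suc p)\<close> pw] G_stp[OF \<open>a \<in> G (Suc p)\<close> pw] psp.pw by blast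
  next
    case (csp x)
    then show ?case using star_csp_right[OF T csp] psp_mult_csp[OF T csp] by blast
  next
    case (add x y)
    then obtain Z Z' where "Z \<in> psp" "star (pw p a) x \<doteq> Z" "Z' \<in> psp" "star (pw p a) y \<doteq> Z'" by blast
    then show ?case using star_add_right[OF T, of x y] eqv_add[of _ Z _ Z'] psp.add[of Z Z'] by fastforce
  next
    case (scal z x)
    then obtain Z where "Z \<in> psp" "star (pw p a) x \<doteq> Z" by blast
    then show ?case
      using eqv_trans[OF star_scal_right[OF T scal(1), of x] eqv_left[of _ Z z]] psp.scal[OF scal(1)] by blast
  qed
next
  case (csp x)
  then show ?case using star_csp_left[OF csp assms(2)] psp_mult_csp[OF assms(2) csp] by blast
next
  case (add x y)
  then obtain Z Z' where "Z \<in> psp" "star x Y \<doteq> Z" "Z' \<in> psp" "star y Y \<doteq> Z'" by blast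
  then show ?case
    using eqv_trans[OF star_add_left[OF add(1,2) assms(2)] eqv_add[of _ Z _ Z']] psp.add[of Z Z'] by blast
next
  case (scal z x)
  then obtain Z where "Z \<in> psp" "star x Y \<doteq> Z" by blast
  then show ?case
    using eqv_trans[OF star_scal_left[OF scal(2,1) assms(2)] eqv_left[of _ Z z]] psp.scal[OF scal(1)] by blast
qed

text \<open>On powers this is associativity of \<open>stp\<close>. On a characteristic element both
  sides are linear in it, and at 1 they reduce to \<open>Rop_Lop\<close>.\<close>

lemma Lop_Rop_com:
  assumes "a \<in> G (Suc p)" "d \<in> G (Suc k)" "Y \<in> psp"
  shows "Lop k d (Rop p a Y) \<doteq> Rop p a (Lop k d Y)"
proof (rule psp_eqv_extend[OF assms(3)])
  note a = G_gen[OF assms(1)] and d = G_gen[OF assms(2)]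
  { fix q b assume b: "b \<in> G (Suc q)"
    have "Lop k d (Rop p a (pw q b)) \<doteq> pw (Suc (Suc p + q) + k) (stp (Suc p + q) (stp p a b) d)"
      unfolding Rop_pw[OF a G_gen[OF b]]
      by (rule eqv_sym[OF pw_stp_Lop[OF G_gen[OF G_stp[OF assms(1) b]] d]])
    also have "\<dots> = Rop p a (pw (Suc q + k) (stp q b d))"
      using Rop_pw[OF a G_gen[OF G_stp[OF b assms(2)]]] stp_assoc[OF d, of p q a b]
      by (simp add: add.assoc)
    also have "\<dots> \<doteq> Rop p a (Lop k d (pw q b))"
      by (rule eqv_Rop[OF pw_stp_Lop[OF G_gen[OF b] d]])
    finally show "Lop k d (Rop p a (pw q b)) \<doteq> Rop p a (Lop k d (pw q b))" . }
  { fix c assume c: "c \<in> csp"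
    have "Lop k d (Rop p a (1 * c)) = Lop k d (pw p a) * c"
      unfolding Rop_mult_scalar[OF csp_loc[OF c]] Lop_mult_scalar[OF csp_loc[OF c] d] Rop_one[OF a] ..
    moreover have "Rop p a (Lop k d (1 * c)) = Rop p a (pw k d) * c"
      unfolding Lop_mult_scalar[OF csp_loc[OF c] d] Rop_mult_scalar[OF csp_loc[OF c]] Lop_one[OF d] ..
    ultimately show "Lop k d (Rop p a c) \<doteq> Rop p a (Lop k d c)"
      using eqv_right[OF eqv_sym[OF Rop_Lop[OF a d]], of c] by simp }
  { fix z x assume z: "z \<in> scalars"
    then have l: "loc {} z" by (simp add: scalars_def)
    show "Lop k d (Rop p a (z * x)) \<doteq> z * Lop k d (Rop p a x)"
      using Rop_mult_scalar[OF l, of p a x] Lop_mult_scalar[OF l d, of "Rop p a x"]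
        scalar_com[OF z, of x] scalar_com[OF z, of "Lop k d (Rop p a x)"] by simp
    show "Rop p a (Lop k d (z * x)) \<doteq> z * Rop p a (Lop k d x)"
      using Rop_mult_scalar[OF l, of p a "Lop k d x"] Lop_mult_scalar[OF l d, of x]
        scalar_com[OF z, of x] scalar_com[OF z, of "Rop p a (Lop k d x)"] by simp }
qed (simp_all add: Rop_add Lop_add)

text \<open>\<open>A\<close> represents the product of \<open>T\<close> and \<open>Y\<close> inside
  \<open>psp\<close>, where the properties of \<open>star\<close> as a function of its left argument
  hold. It stays arbitrary in the induction over \<open>T\<close>, since each part of
  \<open>T\<close> needs its own representative.\<close>

lemma star_assoc:
  assumes "T \<in> psp" "Y \<in> psp" "V \<in> psp" "A \<in> psp" "A \<doteq> star T Y"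
  shows "star A V \<doteq> star T (star Y V)"
  using assms(1,4,5)
proof (induction arbitrary: A rule: psp.induct)
  case (pw a p)
  have T: "pw p a \<in> psp" using pw by (auto intro: psp.pw)
  show ?case
  proof (rule psp_eqv_extend[OF assms(3)])
    { fix c assume c: "c \<in> csp"
      have "star A c \<doteq> A * c" by (rule star_csp_right[OF pw(2) c])
      also have "\<dots> \<doteq> star (pw p a) Y * c" by (rule eqv_right[OF pw(3)])
      also have "\<dots> \<doteq> star (pw p a) (Y * c)" by (rule eqv_sym[OF star_mult_right[OF T c]])
      also have "\<dots> \<doteq> star (pw p a) (star Y c)"
        by (rule star_eqv_right[OF T eqv_sym[OF star_csp_right[OF assms(2) c]]])
      finally show "star A c \<doteq> star (pw p a) (star Y c)" . }
    { fix k d assume d: "d \<in> G (Suc k)"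
      obtain Z where Z: "Z \<in> psp" "star Y (pw k d) \<doteq> Z" using star_closed[OF assms(2) psp.pw[OF d]] by blast
      have "star A (pw k d) \<doteq> Lop k d A" by (rule star_pw_right[OF pw(2) d])
      also have "\<dots> \<doteq> Lop k d (Rop p a Y)"
        by (intro eqv_Lop eqv_trans[OF pw(3)] star_pw_left pw assms)
      also have "\<dots> \<doteq> Rop p a (Lop k d Y)" by (rule Lop_Rop_com[OF pw(1) d assms(2)])
      also have "\<dots> \<doteq> Rop p a Z"
        by (intro eqv_Rop eqv_trans[OF _ Z(2)] eqv_sym[OF star_pw_right[OF assms(2) d]])
      also have "\<dots> \<doteq> star (pw p a) Z" by (rule eqv_sym[OF star_pw_left[OF pw(1) Z(1)]])
      also have "\<dots> \<doteq> star (pw p a) (star Y (pw k d))" by (rule star_eqv_right[OF T eqv_sym[OF Z(2)]])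
      finally show "star A (pw k d) \<doteq> star (pw p a) (star Y (pw k d))" . }
    { fix z x assume z: "z \<in> scalars"
      show "star A (z * x) \<doteq> z * star A x" using star_scal_right[OF pw(2) z] .
      show "star (pw p a) (star Y (z * x)) \<doteq> z * star (pw p a) (star Y x)"
        using eqv_trans[OF star_eqv_right[OF T star_scal_right[OF assms(2) z]] star_scal_right[OF T z]] . }
  qed (simp_all add: star_add_right pw T assms)
next
  case (csp x)
  have xY: "Y * x \<in> psp" using psp_mult_csp[OF assms(2) csp(1)] .
  have "A \<doteq> Y * x" using eqv_trans[OF csp(3) star_csp_left[OF csp(1) assms(2)]] .
  from star_eqv_left[OF csp(2) xY this assms(3)]
  have "star A V \<doteq> star (Y * x) V" .
  also have "\<dots> \<doteq> star Y V * x" by (rule star_mult_left[OF assms(2) csp(1) assms(3)])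
  also obtain Z where Z: "Z \<in> psp" "star Y V \<doteq> Z" using star_closed[OF assms(2,3)] by blast
  have "star Y V * x \<doteq> Z * x" by (rule eqv_right[OF Z(2)])
  also have "\<dots> \<doteq> star x Z" by (rule eqv_sym[OF star_csp_left[OF csp(1) Z(1)]])
  also have "\<dots> \<doteq> star x (star Y V)"
    by (rule star_eqv_right[OF psp.csp[OF csp(1)] eqv_sym[OF Z(2)]])
  finally show ?case .
next
  case (add x y)
  obtain B B' where B: "B \<in> psp" "star x Y \<doteq> B" "B' \<in> psp" "star y Y \<doteq> B'"
    using star_closed add(1,2) assms(2) by meson
  obtain Z where Z: "Z \<in> psp" "star Y V \<doteq> Z" using star_closed[OF assms(2,3)] by blast
  have BB: "B + B' \<in> psp" and xy: "x + y \<in> psp" using B add by (auto intro: psp.add)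
  have "A \<doteq> star x Y + star y Y" using eqv_trans[OF add(6) star_add_left[OF add(1,2) assms(2)]] .
  also have "\<dots> \<doteq> B + B'" using B by (intro eqv_add)
  finally have "star A V \<doteq> star (B + B') V" by (rule star_eqv_left[OF add(5) BB _ assms(3)])
  also have "\<dots> \<doteq> star B V + star B' V" by (rule star_add_left[OF B(1,3) assms(3)])
  also have "\<dots> \<doteq> star x (star Y V) + star y (star Y V)"
    using B by (intro eqv_add add(3,4) eqv_sym[of _ B] eqv_sym[of _ B'])
  also have "\<dots> \<doteq> star x Z + star y Z" by (intro eqv_add star_eqv_right add Z)
  also have "\<dots> \<doteq> star (x + y) Z" by (rule eqv_sym[OF star_add_left[OF add(1,2) Z(1)]])
  also have "\<dots> \<doteq> star (x + y) (star Y V)" by (rule star_eqv_right[OF xy eqv_sym[OF Z(2)]])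
  finally show ?case .
next
  case (scal z x)
  obtain B where B: "B \<in> psp" "star x Y \<doteq> B" using star_closed[OF scal(2) assms(2)] by blast
  obtain Z where Z: "Z \<in> psp" "star Y V \<doteq> Z" using star_closed[OF assms(2,3)] by blast
  have zB: "z * B \<in> psp" and zx: "z * x \<in> psp" using B scal by (auto intro: psp.scal)
  have "A \<doteq> z * star x Y" using eqv_trans[OF scal(5) star_scal_left[OF scal(2,1) assms(2)]] .
  also have "\<dots> \<doteq> z * B" using B by (intro eqv_left)
  finally have "star A V \<doteq> star (z * B) V" by (rule star_eqv_left[OF scal(4) zB _ assms(3)])
  also have "\<dots> \<doteq> z * star B V" by (rule star_scal_left[OF B(1) scal(1) assms(3)])
  also have "\<dots> \<doteq> z * star x (star Y V)"
    using B by (intro eqv_left scal(3) eqv_sym[of _ B])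
  also have "\<dots> \<doteq> z * star x Z" by (intro eqv_left star_eqv_right scal Z)
  also have "\<dots> \<doteq> star (z * x) Z" by (rule eqv_sym[OF star_scal_left[OF scal(2,1) Z(1)]])
  also have "\<dots> \<doteq> star (z * x) (star Y V)" by (rule star_eqv_right[OF zx eqv_sym[OF Z(2)]])
  finally show ?case .
qed

end

subsection \<open>Row-finite matrices\<close>

text \<open>The indices will be whole sequences of basis labels. Finite rows make each entry of a
  product a finite sum, and products have finite rows again.\<close>

typedef (overloaded) ('i, 'a::zero) rfmat = "{x :: 'i \<Rightarrow> 'i \<Rightarrow> 'a. \<forall>i. finite {j. x i j \<noteq> 0}}"
  morphisms ent Rfmat
  by (rule exI[of _ "\<lambda>_ _. 0"]) simp

setup_lifting type_definition_rfmat

lemma sum_nonzeroD: "sum f A \<noteq> 0 \<Longrightarrow> \<exists>a\<in>A. f a \<noteq> 0"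
  by (meson sum.neutral)

lemma finite_row: "finite {j. ent x i j \<noteq> 0}"
  using ent[of x] by simp

instantiation rfmat :: (type, ring_1) ring_1
begin

lift_definition zero_rfmat :: "('a, 'b) rfmat" is "\<lambda>_ _. 0" by simp
lift_definition one_rfmat :: "('a, 'b) rfmat" is "\<lambda>i j. if i = j then 1 else 0"
  by (rule finite_subset[of _ "{x}" for x]) auto
lift_definition plus_rfmat :: "('a, 'b) rfmat \<Rightarrow> ('a, 'b) rfmat \<Rightarrow> ('a, 'b) rfmat"
  is "\<lambda>x y i j. x i j + y i j"
proof -
  fix x y :: "'a \<Rightarrow> 'a \<Rightarrow> 'b" and i
  assume "\<And>i. finite {j. x i j \<noteq> 0}" "\<And>i. finite {j. y i j \<noteq> 0}"
  then have "finite ({j. x i j \<noteq> 0} \<union> {j. y i j \<noteq> 0})" by simp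
  then show "finite {j. x i j + y i j \<noteq> 0}" by (rule rev_finite_subset) auto
qed
lift_definition uminus_rfmat :: "('a, 'b) rfmat \<Rightarrow> ('a, 'b) rfmat" is "\<lambda>x i j. - x i j" by simp
definition minus_rfmat :: "('a, 'b) rfmat \<Rightarrow> ('a, 'b) rfmat \<Rightarrow> ('a, 'b) rfmat" where
  "minus_rfmat x y = x + - y"
lift_definition times_rfmat :: "('a, 'b) rfmat \<Rightarrow> ('a, 'b) rfmat \<Rightarrow> ('a, 'b) rfmat"
  is "\<lambda>x y i j. \<Sum>k | x i k \<noteq> 0. x i k * y k j"
proof -
  fix x y :: "'a \<Rightarrow> 'a \<Rightarrow> 'b" and i
  assume "\<And>i. finite {j. x i j \<noteq> 0}" "\<And>i. finite {j. y i j \<noteq> 0}"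
  then have "finite (\<Union>k\<in>{k. x i k \<noteq> 0}. {j. y k j \<noteq> 0})" by simp
  then show "finite {j. (\<Sum>k | x i k \<noteq> 0. x i k * y k j) \<noteq> 0}"
  proof (rule rev_finite_subset, intro subsetI)
    fix j assume "j \<in> {j. (\<Sum>k | x i k \<noteq> 0. x i k * y k j) \<noteq> 0}"
    then obtain k where "x i k * y k j \<noteq> 0" by (auto dest!: sum_nonzeroD)
    then have "x i k \<noteq> 0" "y k j \<noteq> 0" by auto
    then show "j \<in> (\<Union>k\<in>{k. x i k \<noteq> 0}. {j. y k j \<noteq> 0})" by blast
  qed
qed

lemma ent_times:
  assumes "finite K" "\<And>k. ent x i k * ent y k j \<noteq> 0 \<Longrightarrow> k \<in> K"
  shows "ent (x * y) i j = (\<Sum>k\<in>K. ent x i k * ent y k j)"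
proof -
  have "ent (x * y) i j = (\<Sum>k | ent x i k \<noteq> 0. ent x i k * ent y k j)"
    by transfer simp
  also have "\<dots> = (\<Sum>k | ent x i k * ent y k j \<noteq> 0. ent x i k * ent y k j)"
    by (rule sum.mono_neutral_right) (auto intro: finite_row)
  also have "\<dots> = (\<Sum>k\<in>K. ent x i k * ent y k j)"
    by (rule sum.mono_neutral_left) (use assms in auto)
  finally show ?thesis .
qed

lemma ent_eqI: "(\<And>i j. ent x i j = ent y i j) \<Longrightarrow> x = y"
  using ent_inject by blast

instance
proof
  fix x y z :: "('a, 'b) rfmat"
  show "x + y + z = x + (y + z)" "x + y = y + x" "0 + x = x" "- x + x = 0"
    by (transfer, simp add: algebra_simps)+
  show "x - y = x + - y" by (rule minus_rfmat_def)
  show "0 \<noteq> (1 :: ('a, 'b) rfmat)" by transfer (metis zero_neq_one)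
  show "1 * x = x"
    by (rule ent_eqI, subst ent_times[of "{i}" for i]) (auto simp: one_rfmat.rep_eq split: if_splits)
  show "x * 1 = x"
    by (rule ent_eqI, subst ent_times[of "{j}" for j]) (auto simp: one_rfmat.rep_eq split: if_splits)
  show "(x + y) * z = x * z + y * z"
  proof (rule ent_eqI)
    fix i j
    let ?K = "{k. ent x i k \<noteq> 0} \<union> {k. ent y i k \<noteq> 0}"
    have K: "finite ?K" by (simp add: finite_row)
    have "ent ((x + y) * z) i j = (\<Sum>k\<in>?K. ent (x + y) i k * ent z k j)"
      by (rule ent_times[OF K]) (auto simp: plus_rfmat.rep_eq)
    moreover have "ent (x * z) i j = (\<Sum>k\<in>?K. ent x i k * ent z k j)"
      "ent (y * z) i j = (\<Sum>k\<in>?K. ent y i k * ent z k j)"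
      by (rule ent_times[OF K]; auto)+
    ultimately show "ent ((x + y) * z) i j = ent (x * z + y * z) i j"
      by (simp add: plus_rfmat.rep_eq distrib_right sum.distrib)
  qed
  show "z * (x + y) = z * x + z * y"
  proof (rule ent_eqI)
    fix i j
    let ?K = "{k. ent z i k \<noteq> 0}"
    have e: "ent (z * u) i j = (\<Sum>k\<in>?K. ent z i k * ent u k j)" for u
      by (rule ent_times) (auto simp: finite_row)
    show "ent (z * (x + y)) i j = ent (z * x + z * y) i j"
      unfolding plus_rfmat.rep_eq e by (simp add: plus_rfmat.rep_eq distrib_left sum.distrib)
  qed
  show "x * y * z = x * (y * z)"
  proof (rule ent_eqI)
    fix i j
    let ?K = "{k. ent x i k \<noteq> 0}"
    let ?L = "\<Union>k\<in>?K. {l. ent y k l \<noteq> 0}"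
    have K: "finite ?K" and L: "finite ?L" by (auto simp: finite_row)
    have e: "ent (x * u) i l = (\<Sum>k\<in>?K. ent x i k * ent u k l)" for u l
      by (rule ent_times[OF K]) auto
    have "ent (x * y * z) i j = (\<Sum>l\<in>?L. ent (x * y) i l * ent z l j)"
    proof (rule ent_times[OF L])
      fix l assume "ent (x * y) i l * ent z l j \<noteq> 0"
      then have "(\<Sum>k\<in>?K. ent x i k * ent y k l) \<noteq> 0" by (auto simp: e)
      then obtain k where "k \<in> ?K" "ent x i k * ent y k l \<noteq> 0" using sum_nonzeroD by blast
      then show "l \<in> ?L" by auto
    qed
    also have "\<dots> = (\<Sum>k\<in>?K. \<Sum>l\<in>?L. ent x i k * (ent y k l * ent z l j))"
      unfolding e sum_distrib_right mult.assoc by (rule sum.swap)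
    also have "\<dots> = (\<Sum>k\<in>?K. ent x i k * ent (y * z) k j)"
      unfolding sum_distrib_left[symmetric]
      by (intro sum.cong HOL.refl arg_cong2[of _ _ _ _ "(*)"] ent_times[OF L, symmetric]) auto
    finally show "ent (x * y * z) i j = ent (x * (y * z)) i j" unfolding e .
  qed
qed

end

lemma ent_add [simp]: "ent (x + y) i j = ent x i j + ent y i j"
  by (simp add: plus_rfmat.rep_eq)

lemma ent_zero [simp]: "ent 0 i j = 0"
  by (simp add: zero_rfmat.rep_eq)

lemma ent_one: "ent 1 i j = (if i = j then 1 else 0)"
  by (simp add: one_rfmat.rep_eq)

lemma ent_minus [simp]: "ent (x - y) i j = ent x i j - ent (y :: ('i, 'a::ring_1) rfmat) i j"
  by (simp add: minus_rfmat_def uminus_rfmat.rep_eq del: add_uminus_conv_diff)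

subsection \<open>Operators with finite support\<close>

definition agree :: "nat set \<Rightarrow> (nat \<Rightarrow> 'v) \<Rightarrow> (nat \<Rightarrow> 'v) \<Rightarrow> bool" where
  "agree A i j \<longleftrightarrow> (\<forall>k\<in>A. i k = j k)"

lemma finite_agree: "finite A \<Longrightarrow> finite {j :: nat \<Rightarrow> 'v::finite. agree (- A) i j}"
proof -
  assume A: "finite A"
  have "{j. agree (- A) i j} \<subseteq> (\<lambda>t. override_on i t A) ` idx A"
  proof
    fix j assume "j \<in> {j. agree (- A) i j}"
    then have "j = override_on i (restrict j A) A"
      by (auto simp: agree_def override_on_def)
    then show "j \<in> (\<lambda>t. override_on i t A) ` idx A"
      by (intro image_eqI[of _ _ "restrict j A"]) (auto simp: idx_def)
  qed
  moreover have "finite (idx A :: (nat \<Rightarrow> 'v) set)"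
    unfolding idx_def by (intro finite_PiE A) auto
  ultimately show ?thesis by (blast intro: finite_subset)
qed

lemma finite_idx: "finite A \<Longrightarrow> finite (idx A :: (nat \<Rightarrow> 'v::finite) set)"
  unfolding idx_def by (intro finite_PiE) auto

text \<open>The form "something on \<open>A\<close>, tensor the identity": the outer coordinates are
  unchanged, and the entry does not depend on their common values.\<close>

definition loc :: "nat set \<Rightarrow> (nat \<Rightarrow> 'v, 'a::ring_1) rfmat \<Rightarrow> bool" where
  "loc A x \<longleftrightarrow> (\<forall>i j. ent x i j \<noteq> 0 \<longrightarrow> agree (- A) i j) \<and>
     (\<forall>i j i' j'. agree A i i' \<longrightarrow> agree A j j' \<longrightarrow> agree (- A) i j \<longrightarrow> agree (- A) i' j' \<longrightarrow>
        ent x i j = ent x i' j')"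

definition cst :: "('i, 'a::ring_1) rfmat \<Rightarrow> bool" where
  "cst x \<longleftrightarrow> (\<forall>i j a. ent x i j * a = a * ent x i j)"

lemma locD: "loc A x \<Longrightarrow> \<not> agree (- A) i j \<Longrightarrow> ent x i j = 0"
  unfolding loc_def by blast

lemma loc_ent:
  "loc A x \<Longrightarrow> agree A i i' \<Longrightarrow> agree A j j' \<Longrightarrow> agree (- A) i j \<Longrightarrow> agree (- A) i' j' \<Longrightarrow>
    ent x i j = ent x i' j'"
  unfolding loc_def by blast

lemma loc_mono:
  assumes "loc A x" "A \<subseteq> B"
  shows "loc B x"
  unfolding loc_def
proof (intro conjI allI impI)
  fix i j :: "nat \<Rightarrow> 'a" assume "ent x i j \<noteq> 0"
  then show "agree (- B) i j" using assms unfolding loc_def agree_def by blast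
next
  fix i j i' j' :: "nat \<Rightarrow> 'a"
  assume a: "agree B i i'" "agree B j j'" "agree (- B) i j" "agree (- B) i' j'"
  show "ent x i j = ent x i' j'"
  proof (cases "agree (- A) i j")
    case True
    then have "agree (- A) i' j'" using a by (auto simp: agree_def) (metis Compl_iff)
    then show ?thesis using True a assms unfolding loc_def agree_def by blast
  next
    case False
    then have "\<not> agree (- A) i' j'" using a by (auto simp: agree_def)
    then show ?thesis using False locD[OF assms(1)] by simp
  qed
qed

lemma loc_UNIV: "loc UNIV x"
proof -
  have "agree UNIV i j \<longleftrightarrow> i = j" for i j :: "nat \<Rightarrow> 'a" by (auto simp: agree_def)
  then show ?thesis by (simp add: loc_def) (simp add: agree_def)
qed

lemma loc_one: "loc A 1"
  unfolding loc_def
proof (intro conjI allI impI)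
  fix i j i' j' :: "nat \<Rightarrow> 'a"
  assume a: "agree A i i'" "agree A j j'" "agree (- A) i j" "agree (- A) i' j'"
  have "i k = j k \<longleftrightarrow> i' k = j' k" for k
    using a by (cases "k \<in> A") (auto simp: agree_def)
  then show "ent 1 i j = ent 1 i' j'" by (simp add: ent_one fun_eq_iff)
qed (auto simp: agree_def ent_one split: if_splits)

lemma loc_add: "loc A x \<Longrightarrow> loc A y \<Longrightarrow> loc A (x + y)"
  unfolding loc_def
proof (intro conjI allI impI, goal_cases)
  case (1 i j)
  then have "ent x i j \<noteq> 0 \<or> ent y i j \<noteq> 0" by auto
  then show ?case using 1 by blast
next
  case (2 i j i' j')
  then have "ent x i j = ent x i' j'" "ent y i j = ent y i' j'" by blast+
  then show ?case by simp
qed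

lemma loc_mult:
  assumes x: "loc A x" and y: "loc A y"
  shows "loc A (x * y)"
  unfolding loc_def
proof (intro conjI allI impI)
  have e: "ent (x * y) i j = (\<Sum>k | ent x i k \<noteq> 0. ent x i k * ent y k j)" for i j
    by (rule ent_times) (auto simp: finite_row)
  { fix i j :: "nat \<Rightarrow> 'a" assume "ent (x * y) i j \<noteq> 0"
    then obtain k where "ent x i k * ent y k j \<noteq> 0"
      unfolding e by (auto dest!: sum_nonzeroD)
    then have "ent x i k \<noteq> 0" "ent y k j \<noteq> 0" by auto
    then have "agree (- A) i k" "agree (- A) k j" using locD[OF x] locD[OF y] by blast+
    then show "agree (- A) i j" by (auto simp: agree_def) }
  fix i j i' j' :: "nat \<Rightarrow> 'a"
  assume a: "agree A i i'" "agree A j j'" "agree (- A) i j" "agree (- A) i' j'"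
  have nz: "agree (- A) i k" if "ent x i k \<noteq> 0" for i k using that locD[OF x] by blast
  have *: "ent x p (override_on p k A) = ent x i k"
    if "agree (- A) i k" "agree A i p" for i k p
    by (rule loc_ent[OF x, symmetric])
      (use that in \<open>auto simp: agree_def override_on_def\<close>)
  have **: "override_on i (override_on i' k A) A = k" if "ent x i k \<noteq> 0" for i i' k
    using nz[OF that] by (auto simp: override_on_def fun_eq_iff agree_def)
  have sy: "agree A i' i" using a by (auto simp: agree_def)
  show "ent (x * y) i j = ent (x * y) i' j'"
    unfolding e
  \<comment> \<open>A contributing intermediate index agrees with the row index outside
    \<open>A\<close>. The bijection keeps its coordinates in \<open>A\<close> and replaces the outer
    ones by those of the other row index.\<close>
  proof (rule sum.reindex_bij_witness[of _ "\<lambda>k. override_on i k A" "\<lambda>k. override_on i' k A"])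
    fix k assume k: "k \<in> {k. ent x i k \<noteq> 0}"
    then have "agree (- A) i k" using nz by simp
    have "ent y (override_on i' k A) j' = ent y k j"
      by (rule loc_ent[OF y])
        (use a \<open>agree (- A) i k\<close> in \<open>auto simp: agree_def override_on_def\<close>)
    then show "ent x i' (override_on i' k A) * ent y (override_on i' k A) j' = ent x i k * ent y k j"
      using *[OF \<open>agree (- A) i k\<close> a(1)] by simp
    show "override_on i' k A \<in> {k. ent x i' k \<noteq> 0}"
      using *[OF \<open>agree (- A) i k\<close> a(1)] k by simp
  next
    fix k assume k: "k \<in> {k. ent x i' k \<noteq> 0}"
    then have "agree (- A) i' k" using nz by simp
    then show "override_on i k A \<in> {k. ent x i k \<noteq> 0}"
      using *[OF _ sy] k by simp
  qed (use ** in auto)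
qed

lemma cst_one: "cst 1"
  by (simp add: cst_def ent_one)

lemma cst_add: "cst x \<Longrightarrow> cst y \<Longrightarrow> cst (x + y)"
  by (simp add: cst_def algebra_simps)

lemma cst_mult:
  assumes "cst x" "cst y"
  shows "cst (x * y)"
  unfolding cst_def
proof (intro allI)
  fix i j a
  have e: "ent (x * y) i j = (\<Sum>k | ent x i k \<noteq> 0. ent x i k * ent y k j)"
    by (rule ent_times) (auto simp: finite_row)
  have "ent x i k * ent y k j * a = a * (ent x i k * ent y k j)" for k
  proof -
    have "ent x i k * ent y k j * a = ent x i k * a * ent y k j"
      using assms(2) unfolding cst_def by (simp only: mult.assoc)
    then show ?thesis using assms(1) unfolding cst_def by (simp only: mult.assoc)
  qed
  then show "ent (x * y) i j * a = a * ent (x * y) i j"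
    unfolding e sum_distrib_left sum_distrib_right by simp
qed

lemma com:
  assumes "cst x" "loc A x" "loc B y" "A \<inter> B = {}"
  shows "x * y = y * x"
proof (rule ent_eqI)
  fix i j :: "nat \<Rightarrow> 'a"
  \<comment> \<open>In either order a single intermediate index contributes: the operator on the
    left changes its own coordinates from those of \<open>i\<close> to those of \<open>j\<close>,
    the other one changes the rest.\<close>
  let ?l = "override_on i j A" and ?m = "override_on i j B"
  have 1: "ent (x * y) i j = ent x i ?l * ent y ?l j"
  proof -
    have "ent (x * y) i j = (\<Sum>k\<in>{?l}. ent x i k * ent y k j)"
    proof (rule ent_times)
      fix k assume "ent x i k * ent y k j \<noteq> 0"
      then have "agree (- A) i k" "agree (- B) k j" using locD[OF assms(2)] locD[OF assms(3)] by fastforce+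
      then have "k = ?l" using assms(4) by (auto simp: agree_def override_on_def fun_eq_iff)
      then show "k \<in> {?l}" by simp
    qed simp
    then show ?thesis by simp
  qed
  have 2: "ent (y * x) i j = ent y i ?m * ent x ?m j"
  proof -
    have "ent (y * x) i j = (\<Sum>k\<in>{?m}. ent y i k * ent x k j)"
    proof (rule ent_times)
      fix k assume "ent y i k * ent x k j \<noteq> 0"
      then have "agree (- B) i k" "agree (- A) k j" using locD[OF assms(2)] locD[OF assms(3)] by fastforce+
      then have "k = ?m" using assms(4) by (auto simp: agree_def override_on_def fun_eq_iff)
      then show "k \<in> {?m}" by simp
    qed simp
    then show ?thesis by simp
  qed
  show "ent (x * y) i j = ent (y * x) i j"
  proof (cases "agree (- (A \<union> B)) i j")
    case True
    have "ent x i ?l = ent x ?m j"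
      by (rule loc_ent[OF assms(2)])
        (use True assms(4) in \<open>auto simp: agree_def override_on_def\<close>)
    moreover have "ent y ?l j = ent y i ?m"
      by (rule loc_ent[OF assms(3)])
        (use True assms(4) in \<open>auto simp: agree_def override_on_def\<close>)
    ultimately show ?thesis using assms(1) 1 2 by (simp add: cst_def)
  next
    case False
    then have "\<not> agree (- B) ?l j" "\<not> agree (- B) i ?m \<or> \<not> agree (- A) ?m j"
      using assms(4) by (auto simp: agree_def override_on_def)
    then show ?thesis using 1 2 locD[OF assms(2)] locD[OF assms(3)] by auto
  qed
qed

lemma restrict_idx: "restrict i A \<in> idx A"
  by (simp add: idx_def)

lemma restrict_override: "t \<in> idx A \<Longrightarrow> restrict (override_on i t A) A = t"
  by (auto simp: idx_def PiE_def extensional_def override_on_def restrict_def)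

lemma sum_override:
  assumes "finite S"
  shows "(\<Sum>k\<in>(\<lambda>t. override_on i t S) ` idx S. F k) = (\<Sum>t\<in>idx S. F (override_on i t S))"
proof -
  have "inj_on (\<lambda>t. override_on i t S) (idx S)"
    by (rule inj_on_inverseI[of _ "\<lambda>k. restrict k S"]) (rule restrict_override)
  then show ?thesis by (simp add: sum.reindex)
qed

lemma agree_override: "agree (- S) i k \<Longrightarrow> k \<in> (\<lambda>t. override_on i t S) ` idx S"
  by (rule image_eqI[of _ _ "restrict k S"]) (auto simp: agree_def override_on_def fun_eq_iff restrict_idx)

lemma ent_times_loc_left:
  fixes x :: "(nat \<Rightarrow> 'v::finite, 'a::ring_1) rfmat"
  assumes "finite S" "loc S x"
  shows "ent (x * y) i j = (\<Sum>t\<in>idx S. ent x i (override_on i t S) * ent y (override_on i t S) j)"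
proof -
  have "ent (x * y) i j = (\<Sum>k\<in>(\<lambda>t. override_on i t S) ` idx S. ent x i k * ent y k j)"
  proof (rule ent_times)
    fix k assume "ent x i k * ent y k j \<noteq> 0"
    then have "ent x i k \<noteq> 0" by auto
    then have "agree (- S) i k" using locD[OF assms(2)] by blast
    then show "k \<in> (\<lambda>t. override_on i t S) ` idx S" by (rule agree_override)
  qed (simp add: finite_idx assms)
  then show ?thesis by (simp only: sum_override[OF assms(1)])
qed

lemma ent_times_loc_right:
  fixes x :: "(nat \<Rightarrow> 'v::finite, 'a::ring_1) rfmat"
  assumes "finite S" "loc S y"
  shows "ent (x * y) i j = (\<Sum>t\<in>idx S. ent x i (override_on j t S) * ent y (override_on j t S) j)"
proof -
  have "ent (x * y) i j = (\<Sum>k\<in>(\<lambda>t. override_on j t S) ` idx S. ent x i k * ent y k j)"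
  proof (rule ent_times)
    fix k assume "ent x i k * ent y k j \<noteq> 0"
    then have "ent y k j \<noteq> 0" by auto
    then have "agree (- S) k j" using locD[OF assms(2)] by blast
    then have "agree (- S) j k" by (auto simp: agree_def)
    then show "k \<in> (\<lambda>t. override_on j t S) ` idx S" by (rule agree_override)
  qed (simp add: finite_idx assms)
  then show ?thesis by (simp only: sum_override[OF assms(1)])
qed

subsection \<open>Partial traces\<close>

text \<open>The result again acts on all factors, as the identity in the traced ones, whence the
  condition \<open>agree S i j\<close>. For infinite \<open>S\<close> the value 0 is a
  default.\<close>

lift_definition ptr_aux :: "nat set \<Rightarrow> (nat \<Rightarrow> 'v::finite, 'a::ring_1) rfmat \<Rightarrow> (nat \<Rightarrow> 'v, 'a) rfmat"
  is "\<lambda>S x i j. if finite S \<and> agree S i j then \<Sum>t\<in>idx S. x (override_on i t S) (override_on j t S) else 0"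
proof -
  fix S and x :: "(nat \<Rightarrow> 'v) \<Rightarrow> (nat \<Rightarrow> 'v) \<Rightarrow> 'a" and i
  assume x: "\<And>i. finite {j. x i j \<noteq> 0}"
  show "finite {j. (if finite S \<and> agree S i j then \<Sum>t\<in>idx S. x (override_on i t S) (override_on j t S) else 0) \<noteq> 0}"
  proof (cases "finite S")
    case True
    let ?K = "\<Union>t\<in>idx S. (\<lambda>k. override_on k i S) ` {k. x (override_on i t S) k \<noteq> 0}"
    have "finite ?K" using x finite_idx[OF True] by auto
    then show ?thesis
    proof (rule rev_finite_subset, intro subsetI)
      fix j
      assume "j \<in> {j. (if finite S \<and> agree S i j then \<Sum>t\<in>idx S. x (override_on i t S) (override_on j t S) else 0) \<noteq> 0}"
      then have a: "agree S i j" "(\<Sum>t\<in>idx S. x (override_on i t S) (override_on j t S)) \<noteq> 0"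
        by (auto split: if_splits)
      then obtain t where t: "t \<in> idx S" "x (override_on i t S) (override_on j t S) \<noteq> 0"
        by (auto dest!: sum_nonzeroD)
      moreover have "j = override_on (override_on j t S) i S"
        using a by (auto simp: agree_def override_on_def fun_eq_iff)
      ultimately show "j \<in> ?K" by blast
    qed
  qed simp
qed

definition ptr :: "nat set \<Rightarrow> (nat \<Rightarrow> 'v::finite, 'a::ring_1) rfmat \<Rightarrow> (nat \<Rightarrow> 'v, 'a) rfmat" where
  "ptr = ptr_aux"

lemma ent_ptr:
  "finite S \<Longrightarrow> ent (ptr S x) i j = (if agree S i j then \<Sum>t\<in>idx S. ent x (override_on i t S) (override_on j t S) else 0)"
  by (simp add: ptr_def ptr_aux.rep_eq)

lemma ptr_add: "finite S \<Longrightarrow> ptr S (x + y) = ptr S x + ptr S y"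
  by (rule ent_eqI) (simp add: ent_ptr sum.distrib)

lemma ptr_loc:
  assumes "finite S" "loc A x"
  shows "loc (A - S) (ptr S x)"
  unfolding loc_def
proof (intro conjI allI impI)
  fix i j :: "nat \<Rightarrow> 'a" assume "ent (ptr S x) i j \<noteq> 0"
  then have a: "agree S i j" "(\<Sum>t\<in>idx S. ent x (override_on i t S) (override_on j t S)) \<noteq> 0"
    by (auto simp: ent_ptr[OF assms(1)] split: if_splits)
  then obtain t where "ent x (override_on i t S) (override_on j t S) \<noteq> 0"
    by (auto dest!: sum_nonzeroD)
  then have "agree (- A) (override_on i t S) (override_on j t S)" using assms(2) locD by blast
  then have "\<forall>k\<in>- A. override_on i t S k = override_on j t S k" by (simp only: agree_def)
  then have "i k = j k" if "k \<notin> A" "k \<notin> S" for k using that by (metis ComplI override_on_apply_notin)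
  then show "agree (- (A - S)) i j" using a(1) by (auto simp: agree_def)
next
  fix i j i' j' :: "nat \<Rightarrow> 'a"
  assume a: "agree (A - S) i i'" "agree (A - S) j j'" "agree (- (A - S)) i j" "agree (- (A - S)) i' j'"
  then have s: "agree S i j" "agree S i' j'" by (auto simp: agree_def)
  have "ent x (override_on i t S) (override_on j t S) = ent x (override_on i' t S) (override_on j' t S)" for t
    by (rule loc_ent[OF assms(2)])
      (use a in \<open>auto simp: agree_def override_on_def\<close>)
  then show "ent (ptr S x) i j = ent (ptr S x) i' j'" using s by (simp add: ent_ptr[OF assms(1)])
qed

lemma ptr_left:
  assumes S: "finite S" and a: "loc A a" "A \<inter> S = {}" "finite A"
  shows "ptr S (a * x) = a * ptr S x"
proof (rule ent_eqI)
  fix i j :: "nat \<Rightarrow> 'a"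
  let ?o = "\<lambda>u. override_on i u A"
  have o: "override_on (override_on i t S) u A = override_on (?o u) t S" for t u
    using a(2) by (auto simp: override_on_def fun_eq_iff)
  have e: "ent a (override_on i t S) (override_on (?o u) t S) = ent a i (?o u)" for t u
    by (rule loc_ent[OF a(1)]) (use a(2) in \<open>auto simp: agree_def override_on_def\<close>)
  have "agree S (?o u) j \<longleftrightarrow> agree S i j" for u
    using a(2) by (auto simp: agree_def override_on_def)
  moreover have "ent (a * ptr S x) i j = (\<Sum>u\<in>idx A. ent a i (?o u) * ent (ptr S x) (?o u) j)"
    by (rule ent_times_loc_left[OF a(3,1)])
  moreover have "(\<Sum>t\<in>idx S. ent (a * x) (override_on i t S) (override_on j t S)) =
      (\<Sum>u\<in>idx A. ent a i (?o u) * (\<Sum>t\<in>idx S. ent x (override_on (?o u) t S) (override_on j t S)))"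
    unfolding ent_times_loc_left[OF a(3,1)] o e sum_distrib_left by (rule sum.swap)
  ultimately show "ent (ptr S (a * x)) i j = ent (a * ptr S x) i j"
    by (cases "agree S i j") (simp_all add: ent_ptr[OF S])
qed

lemma ptr_right:
  assumes S: "finite S" and a: "loc A a" "A \<inter> S = {}" "finite A"
  shows "ptr S (x * a) = ptr S x * a"
proof (rule ent_eqI)
  fix i j :: "nat \<Rightarrow> 'a"
  let ?o = "\<lambda>u. override_on j u A"
  have o: "override_on (override_on j t S) u A = override_on (?o u) t S" for t u
    using a(2) by (auto simp: override_on_def fun_eq_iff)
  have e: "ent a (override_on (?o u) t S) (override_on j t S) = ent a (?o u) j" for t u
    by (rule loc_ent[OF a(1)]) (use a(2) in \<open>auto simp: agree_def override_on_def\<close>)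
  have "agree S i (?o u) \<longleftrightarrow> agree S i j" for u
    using a(2) by (auto simp: agree_def override_on_def)
  moreover have "ent (ptr S x * a) i j = (\<Sum>u\<in>idx A. ent (ptr S x) i (?o u) * ent a (?o u) j)"
    by (rule ent_times_loc_right[OF a(3,1)])
  moreover have "(\<Sum>t\<in>idx S. ent (x * a) (override_on i t S) (override_on j t S)) =
      (\<Sum>u\<in>idx A. (\<Sum>t\<in>idx S. ent x (override_on i t S) (override_on (?o u) t S)) * ent a (?o u) j)"
    unfolding ent_times_loc_right[OF a(3,1)] o e sum_distrib_right by (rule sum.swap)
  ultimately show "ent (ptr S (x * a)) i j = ent (ptr S x * a) i j"
    by (cases "agree S i j") (simp_all add: ent_ptr[OF S])
qed

lemma ptr_cyc:
  assumes S: "finite S" and a: "loc S a" "cst a"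
  shows "ptr S (a * x) = ptr S (x * a)"
proof (rule ent_eqI)
  fix i j :: "nat \<Rightarrow> 'a"
  have o: "override_on (override_on k t S) u S = override_on k u S" for k t u :: "nat \<Rightarrow> 'a"
    by (auto simp: override_on_def)
  have e: "ent a (override_on i t S) (override_on i u S) = ent a (override_on j t S) (override_on j u S)" for t u
    by (rule loc_ent[OF a(1)]) (auto simp: agree_def override_on_def)
  have "(\<Sum>t\<in>idx S. ent (a * x) (override_on i t S) (override_on j t S)) =
      (\<Sum>u\<in>idx S. \<Sum>t\<in>idx S. ent x (override_on i u S) (override_on j t S) * ent a (override_on j t S) (override_on j u S))"
    unfolding ent_times_loc_left[OF S a(1)] o e using a(2) unfolding cst_def by (subst sum.swap) simp
  then show "ent (ptr S (a * x)) i j = ent (ptr S (x * a)) i j"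
    by (simp add: ent_ptr[OF S] ent_times_loc_right[OF S a(1)] o)
qed

lemma ptr_union:
  assumes "finite S" "finite T" "S \<inter> T = {}"
  shows "ptr S (ptr T x) = ptr (S \<union> T) x"
proof (rule ent_eqI)
  fix i j :: "nat \<Rightarrow> 'a"
  have agr: "agree (S \<union> T) i j \<longleftrightarrow> agree S i j \<and> agree T i j" by (auto simp: agree_def)
  have agr2: "agree T (override_on i s S) (override_on j s S) \<longleftrightarrow> agree T i j" for s
    using assms(3) by (auto simp: agree_def override_on_def)
  let ?f = "\<lambda>(s, t). override_on s t T :: nat \<Rightarrow> 'a"
  have o: "override_on (override_on i s S) t T = override_on i (override_on s t T) (S \<union> T)" for i s t :: "nat \<Rightarrow> 'a"
    using assms(3) by (auto simp: override_on_def fun_eq_iff)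
  have bij: "bij_betw ?f (idx S \<times> idx T) (idx (S \<union> T))"
  proof (rule bij_betw_byWitness[of _ "\<lambda>u. (restrict u S, restrict u T)"])
    show "\<forall>a\<in>idx S \<times> idx T. (restrict (?f a) S, restrict (?f a) T) = a"
      using assms(3) by (auto simp: idx_def PiE_def extensional_def override_on_def fun_eq_iff)
    show "\<forall>u\<in>idx (S \<union> T). ?f (restrict u S, restrict u T) = u"
      by (auto simp: idx_def PiE_def extensional_def override_on_def fun_eq_iff)
    show "?f ` (idx S \<times> idx T) \<subseteq> idx (S \<union> T)"
      by (auto simp: idx_def PiE_def extensional_def override_on_def)
    show "(\<lambda>u. (restrict u S, restrict u T)) ` idx (S \<union> T) \<subseteq> idx S \<times> idx T"
      by (auto simp: idx_def)
  qed
  have "(\<Sum>s\<in>idx S. \<Sum>t\<in>idx T. ent x (override_on (override_on i s S) t T) (override_on (override_on j s S) t T)) =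
      (\<Sum>p\<in>idx S \<times> idx T. ent x (override_on i (?f p) (S \<union> T)) (override_on j (?f p) (S \<union> T)))"
    unfolding sum.cartesian_product o by (simp add: case_prod_beta)
  also have "\<dots> = (\<Sum>u\<in>idx (S \<union> T). ent x (override_on i u (S \<union> T)) (override_on j u (S \<union> T)))"
    by (rule sum.reindex_bij_betw[OF bij])
  finally show "ent (ptr S (ptr T x)) i j = ent (ptr (S \<union> T) x) i j"
    using assms by (auto simp: ent_ptr agr agr2)
qed

subsection \<open>Shift of the tensor factors\<close>

text \<open>Coordinates start at 0 although factors are numbered from 1; the shift puts the identity
  into factor 0.\<close>

lift_definition shift :: "(nat \<Rightarrow> 'v, 'a::ring_1) rfmat \<Rightarrow> (nat \<Rightarrow> 'v, 'a) rfmat"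
  is "\<lambda>x i j. if i 0 = j 0 then x (\<lambda>n. i (Suc n)) (\<lambda>n. j (Suc n)) else 0"
proof -
  fix x :: "(nat \<Rightarrow> 'v) \<Rightarrow> (nat \<Rightarrow> 'v) \<Rightarrow> 'a" and i :: "nat \<Rightarrow> 'v"
  assume x: "\<And>i. finite {j. x i j \<noteq> 0}"
  have "finite ((\<lambda>k. case_nat (i 0) k) ` {k. x (\<lambda>n. i (Suc n)) k \<noteq> 0})" using x by simp
  then show "finite {j. (if i 0 = j 0 then x (\<lambda>n. i (Suc n)) (\<lambda>n. j (Suc n)) else 0) \<noteq> 0}"
  proof (rule rev_finite_subset, intro subsetI)
    fix j
    assume "j \<in> {j. (if i 0 = j 0 then x (\<lambda>n. i (Suc n)) (\<lambda>n. j (Suc n)) else 0) \<noteq> 0}"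
    then have "i 0 = j 0" "x (\<lambda>n. i (Suc n)) (\<lambda>n. j (Suc n)) \<noteq> 0" by (auto split: if_splits)
    moreover have "j = case_nat (j 0) (\<lambda>n. j (Suc n))" by (auto simp: fun_eq_iff split: nat.split)
    ultimately show "j \<in> (\<lambda>k. case_nat (i 0) k) ` {k. x (\<lambda>n. i (Suc n)) k \<noteq> 0}" by auto
  qed
qed

lemma ent_shift: "ent (shift x) i j = (if i 0 = j 0 then ent x (\<lambda>n. i (Suc n)) (\<lambda>n. j (Suc n)) else 0)"
  by (simp add: shift.rep_eq)

lemma nat_fun_eq_iff: "f = g \<longleftrightarrow> f (0::nat) = g 0 \<and> (\<lambda>n. f (Suc n)) = (\<lambda>n. g (Suc n))"
  by (metis (no_types, lifting) ext not0_implies_Suc)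

lemma shift_one: "shift 1 = 1"
proof (rule ent_eqI)
  fix i j :: "nat \<Rightarrow> 'a"
  show "ent (shift 1) i j = ent (1 :: (nat \<Rightarrow> 'a, 'b) rfmat) i j"
    unfolding ent_shift ent_one nat_fun_eq_iff[of i j] by simp
qed

lemma shift_add: "shift (x + y) = shift x + shift y"
  by (rule ent_eqI) (auto simp: ent_shift)

lemma shift_mult: "shift (x * y) = shift x * shift y"
proof (rule ent_eqI)
  fix i j :: "nat \<Rightarrow> 'a"
  let ?i = "\<lambda>n. i (Suc n)" and ?j = "\<lambda>n. j (Suc n)"
  let ?K = "{k. ent x ?i k \<noteq> 0}"
  have inj: "inj_on (case_nat (i 0)) ?K"
    by (auto simp: inj_on_def fun_eq_iff split: nat.splits)
  have "ent (shift x * shift y) i j = (\<Sum>k\<in>case_nat (i 0) ` ?K. ent (shift x) i k * ent (shift y) k j)"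
  proof (rule ent_times)
    fix k assume "ent (shift x) i k * ent (shift y) k j \<noteq> 0"
    then have "ent (shift x) i k \<noteq> 0" by auto
    then have "i 0 = k 0" "ent x ?i (\<lambda>n. k (Suc n)) \<noteq> 0" by (auto simp: ent_shift split: if_splits)
    moreover have "k = case_nat (k 0) (\<lambda>n. k (Suc n))" by (auto simp: fun_eq_iff split: nat.split)
    ultimately show "k \<in> case_nat (i 0) ` ?K" by auto
  qed (simp add: finite_row)
  also have "\<dots> = (\<Sum>k\<in>?K. ent x ?i k * ent (shift y) (case_nat (i 0) k) j)"
    by (simp add: sum.reindex[OF inj] ent_shift)
  also have "\<dots> = ent (shift (x * y)) i j"
  proof -
    have "ent (x * y) ?i ?j = (\<Sum>k\<in>?K. ent x ?i k * ent y k ?j)"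
      by (rule ent_times) (auto simp: finite_row)
    then show ?thesis by (simp add: ent_shift)
  qed
  finally show "ent (shift (x * y)) i j = ent (shift x * shift y) i j" by simp
qed

lemma shift_inj: "shift x = shift y \<Longrightarrow> x = y"
proof (rule ent_eqI)
  fix i j :: "nat \<Rightarrow> 'a"
  assume "shift x = shift y"
  then have "ent (shift x) (case_nat undefined i) (case_nat undefined j) =
      ent (shift y) (case_nat undefined i) (case_nat undefined j)" by simp
  then show "ent x i j = ent y i j" by (simp add: ent_shift)
qed

lemma shift_loc:
  assumes "loc A x"
  shows "loc (Suc ` A) (shift x)"
  unfolding loc_def
proof (intro conjI allI impI)
  fix i j :: "nat \<Rightarrow> 'a" assume "ent (shift x) i j \<noteq> 0"
  then have a: "i 0 = j 0" "ent x (\<lambda>n. i (Suc n)) (\<lambda>n. j (Suc n)) \<noteq> 0"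
    by (auto simp: ent_shift split: if_splits)
  then have "agree (- A) (\<lambda>n. i (Suc n)) (\<lambda>n. j (Suc n))" using locD[OF assms] by blast
  then have "i k = j k" if "k \<notin> Suc ` A" for k
    using a(1) that by (cases k) (auto simp: agree_def)
  then show "agree (- Suc ` A) i j" by (auto simp: agree_def)
next
  fix i j i' j' :: "nat \<Rightarrow> 'a"
  assume a: "agree (Suc ` A) i i'" "agree (Suc ` A) j j'" "agree (- Suc ` A) i j" "agree (- Suc ` A) i' j'"
  then have "i 0 = j 0" "i' 0 = j' 0" by (auto simp: agree_def)
  moreover have "ent x (\<lambda>n. i (Suc n)) (\<lambda>n. j (Suc n)) = ent x (\<lambda>n. i' (Suc n)) (\<lambda>n. j' (Suc n))"
    by (rule loc_ent[OF assms])
      (use a in \<open>auto simp: agree_def\<close>)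
  ultimately show "ent (shift x) i j = ent (shift x) i' j'" by (simp add: ent_shift)
qed

lemma shift_scalar:
  assumes "loc {} x"
  shows "shift x = x"
proof (rule ent_eqI)
  fix i j :: "nat \<Rightarrow> 'a"
  show "ent (shift x) i j = ent x i j"
  proof (cases "i = j")
    case True
    have "ent x (\<lambda>n. i (Suc n)) (\<lambda>n. j (Suc n)) = ent x i j"
      by (rule loc_ent[OF assms]) (auto simp: agree_def True)
    then show ?thesis by (simp add: ent_shift True)
  next
    case False
    then have "\<not> agree (- {}) i j" by (auto simp: agree_def)
    moreover have "i 0 = j 0 \<Longrightarrow> \<not> agree (- {}) (\<lambda>n. i (Suc n)) (\<lambda>n. j (Suc n))"
      using False nat_fun_eq_iff[of i j] by (auto simp: agree_def)
    ultimately show ?thesis using locD[OF assms] by (auto simp: ent_shift)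
  qed
qed

subsection \<open>Operators given on finitely many factors\<close>

text \<open>Extends an operator on the factors in \<open>A\<close> by the identity to all factors.
  Equalities posed on \<open>idx A\<close> by \<open>op_eq\<close> become equations of these
  extensions, for different finite sets \<open>A\<close> in one common ring.\<close>

lift_definition oper_aux :: "nat set \<Rightarrow> ('v::finite, 'a::ring_1) tens_op \<Rightarrow> (nat \<Rightarrow> 'v, 'a) rfmat"
  is "\<lambda>A T i j. if finite A \<and> agree (- A) i j then T (restrict i A) (restrict j A) else 0"
proof -
  fix A and T :: "('v, 'a) tens_op" and i :: "nat \<Rightarrow> 'v"
  have "finite A \<Longrightarrow> finite {j. agree (- A) i j}" by (rule finite_agree)
  then show "finite {j. (if finite A \<and> agree (- A) i j then T (restrict i A) (restrict j A) else 0) \<noteq> 0}"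
    by (cases "finite A") (auto elim: rev_finite_subset)
qed

definition oper :: "nat set \<Rightarrow> ('v::finite, 'a::ring_1) tens_op \<Rightarrow> (nat \<Rightarrow> 'v, 'a) rfmat" where
  "oper = oper_aux"

lemma ent_oper:
  "finite A \<Longrightarrow> ent (oper A T) i j = (if agree (- A) i j then T (restrict i A) (restrict j A) else 0)"
  by (simp add: oper_def oper_aux.rep_eq)

lemma idx_agree: "i \<in> idx A \<Longrightarrow> j \<in> idx A \<Longrightarrow> agree (- A) i j"
  by (auto simp: agree_def idx_def PiE_def extensional_def)

lemma idx_restrict: "i \<in> idx A \<Longrightarrow> restrict i A = i"
  by (auto simp: idx_def)

lemma ent_oper_idx: "finite A \<Longrightarrow> i \<in> idx A \<Longrightarrow> j \<in> idx A \<Longrightarrow> ent (oper A T) i j = T i j"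
  by (simp add: ent_oper idx_agree idx_restrict)

lemma oper_eq_iff: "finite A \<Longrightarrow> op_eq A T Y \<longleftrightarrow> oper A T = oper A Y"
proof
  assume "finite A" "op_eq A T Y"
  then show "oper A T = oper A Y"
    by (intro ent_eqI) (simp add: ent_oper op_eq_def restrict_idx)
next
  assume "finite A" "oper A T = oper A Y"
  then show "op_eq A T Y" unfolding op_eq_def by (metis ent_oper_idx)
qed

lemma oper_loc: "finite A \<Longrightarrow> loc A (oper A T)"
proof -
  assume A: "finite A"
  have "restrict i A = restrict i' A" if "agree A i i'" for i i' :: "nat \<Rightarrow> 'a"
    using that by (auto simp: agree_def restrict_def)
  then show ?thesis using A by (auto simp: loc_def ent_oper)
qed

lemma oper_one: "finite A \<Longrightarrow> oper A op_one = 1"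
proof (rule ent_eqI)
  fix i j :: "nat \<Rightarrow> 'a"
  assume A: "finite A"
  have "agree (- A) i j \<and> restrict i A = restrict j A \<longleftrightarrow> i = j"
  proof
    assume a: "agree (- A) i j \<and> restrict i A = restrict j A"
    show "i = j"
    proof
      fix k
      show "i k = j k"
      proof (cases "k \<in> A")
        case True
        have "restrict i A k = restrict j A k" using a by simp
        then show ?thesis using True by simp
      qed (use a in \<open>simp add: agree_def\<close>)
    qed
  qed (auto simp: agree_def)
  then show "ent (oper A op_one) i j = ent (1 :: (nat \<Rightarrow> 'a, 'b) rfmat) i j"
    using A by (auto simp: ent_oper op_one_def ent_one)
qed

lemma oper_mult:
  assumes A: "finite A"
  shows "oper A (op_mult A T Y) = oper A T * oper A Y"
proof (rule ent_eqI)
  fix i j :: "nat \<Rightarrow> 'a"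
  have o: "ent (oper A T) i (override_on i t A) = T (restrict i A) t"
    "ent (oper A Y) (override_on i t A) j = (if agree (- A) i j then Y t (restrict j A) else 0)"
    if "t \<in> idx A" for t
    using restrict_override[OF that, of i] by (auto simp: ent_oper[OF A] agree_def)
  have "ent (oper A T * oper A Y) i j =
      (\<Sum>t\<in>idx A. T (restrict i A) t * (if agree (- A) i j then Y t (restrict j A) else 0))"
    unfolding ent_times_loc_left[OF A oper_loc[OF A]] by (intro sum.cong HOL.refl) (simp add: o)
  then show "ent (oper A (op_mult A T Y)) i j = ent (oper A T * oper A Y) i j"
    by (simp add: ent_oper[OF A] op_mult_def)
qed

lemma oper_ptrace:
  assumes A: "finite A" and S: "S \<subseteq> A"
  shows "oper (A - S) (ptrace S T) = ptr S (oper A T)"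
proof (rule ent_eqI)
  fix i j :: "nat \<Rightarrow> 'a"
  have fS: "finite S" "finite (A - S)" using A S by (auto intro: finite_subset)
  have o: "override_on (restrict i (A - S)) t S = restrict (override_on i t S) A" for i t :: "nat \<Rightarrow> 'a"
    using S by (auto simp: override_on_def fun_eq_iff)
  have a: "agree (- (A - S)) i j \<longleftrightarrow> agree S i j \<and> agree (- A) (override_on i t S) (override_on j t S)" for t
    using S by (auto simp: agree_def override_on_def)
  show "ent (oper (A - S) (ptrace S T)) i j = ent (ptr S (oper A T)) i j"
  proof (cases "agree (- (A - S)) i j")
    case True
    then have "agree S i j" "\<And>t. agree (- A) (override_on i t S) (override_on j t S)" using a by auto
    then show ?thesis using True by (simp add: ent_oper fS A ent_ptr ptrace_def o)
  next
    case False
    then have "agree S i j \<Longrightarrow> \<not> agree (- A) (override_on i t S) (override_on j t S)" for t using a by auto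
    then show ?thesis using False by (simp add: ent_oper fS A ent_ptr)
  qed
qed

definition site1 :: "nat \<Rightarrow> 'a::ring_1 ^ 'v::finite ^ 'v \<Rightarrow> (nat \<Rightarrow> 'v, 'a) rfmat" where
  "site1 m Y = oper {m} (act1 {m} m Y)"

definition site2 :: "nat \<Rightarrow> 'a::ring_1 ^ ('v::finite \<times> 'v) ^ ('v \<times> 'v) \<Rightarrow> (nat \<Rightarrow> 'v, 'a) rfmat" where
  "site2 m T = oper {m, Suc m} (act2 {m, Suc m} m (Suc m) T)"

lemma ent_site1: "ent (site1 m Y) i j = (if agree (- {m}) i j then Y $ i m $ j m else 0)"
  by (simp add: site1_def ent_oper act1_def)

lemma ent_site2:
  "ent (site2 m T) i j = (if agree (- {m, Suc m}) i j then T $ (i m, i (Suc m)) $ (j m, j (Suc m)) else 0)"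
  by (simp add: site2_def ent_oper act2_def)

lemma site1_loc: "loc {m} (site1 m Y)"
  by (simp add: site1_def oper_loc)

lemma site2_loc: "loc {m, m + 1} (site2 m T)"
  by (simp add: site2_def oper_loc)

lemma oper_act1:
  assumes "finite A" "m \<in> A"
  shows "oper A (act1 A m Y) = site1 m Y"
proof (rule ent_eqI)
  fix i j :: "nat \<Rightarrow> 'a"
  have "agree (- {m}) i j \<longleftrightarrow> agree (- A) i j \<and> (\<forall>k\<in>A - {m}. i k = j k)"
    using assms by (auto simp: agree_def)
  then show "ent (oper A (act1 A m Y)) i j = ent (site1 m Y) i j"
    using assms by (auto simp: ent_oper ent_site1 act1_def)
qed

lemma oper_act2:
  assumes "finite A" "m \<in> A" "Suc m \<in> A"
  shows "oper A (act2 A m (Suc m) T) = site2 m T"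
proof (rule ent_eqI)
  fix i j :: "nat \<Rightarrow> 'a"
  have "agree (- {m, Suc m}) i j \<longleftrightarrow> agree (- A) i j \<and> (\<forall>k\<in>A - {m, Suc m}. i k = j k)"
    using assms by (auto simp: agree_def)
  then show "ent (oper A (act2 A m (Suc m) T)) i j = ent (site2 m T) i j"
    using assms by (auto simp: ent_oper ent_site2 act2_def)
qed

section \<open>Entrywise products with operators on one or two factors\<close>

lemma sum_idx1: "(\<Sum>t\<in>idx {m}. F (t m)) = (\<Sum>a\<in>UNIV. F a)"
  by (rule sum.reindex_bij_witness[of _ "\<lambda>a. restrict (\<lambda>_. a) {m}" "\<lambda>t. t m"])
    (auto simp: restrict_idx idx_def PiE_def extensional_def restrict_def fun_eq_iff)

lemma sum_idx2: "(\<Sum>t\<in>idx {m, Suc m}. F (t m) (t (Suc m))) = (\<Sum>a\<in>UNIV. \<Sum>b\<in>UNIV. F a b)"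
proof -
  have "(\<Sum>t\<in>idx {m, Suc m}. F (t m) (t (Suc m))) = (\<Sum>p\<in>UNIV \<times> UNIV. F (fst p) (snd p))"
    by (rule sum.reindex_bij_witness[of _ "\<lambda>p. restrict (\<lambda>n. if n = m then fst p else snd p) {m, Suc m}"
          "\<lambda>t. (t m, t (Suc m))"])
      (auto simp: restrict_idx idx_def PiE_def extensional_def restrict_def fun_eq_iff)
  then show ?thesis by (simp add: sum.cartesian_product case_prod_beta)
qed

lemma override_on1: "override_on i t {m} = i(m := t m)"
  by (auto simp: override_on_def)

lemma override_on2: "override_on i t {m, Suc m} = i(m := t m, Suc m := t (Suc m))"
  by (auto simp: override_on_def)

lemma ent_site1_times: "ent (site1 m Y * x) i j = (\<Sum>a\<in>UNIV. Y $ i m $ a * ent x (i(m := a)) j)"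
proof -
  have "ent (site1 m Y * x) i j = (\<Sum>t\<in>idx {m}. Y $ i m $ t m * ent x (i(m := t m)) j)"
    unfolding ent_times_loc_left[OF _ site1_loc, simplified] override_on1
    by (intro sum.cong HOL.refl) (simp add: ent_site1 agree_def)
  then show ?thesis by (simp only: sum_idx1[of "\<lambda>a. Y $ i m $ a * ent x (i(m := a)) j" m])
qed

lemma ent_times_site1: "ent (x * site1 m Y) i j = (\<Sum>a\<in>UNIV. ent x i (j(m := a)) * Y $ a $ j m)"
proof -
  have "ent (x * site1 m Y) i j = (\<Sum>t\<in>idx {m}. ent x i (j(m := t m)) * Y $ t m $ j m)"
    unfolding ent_times_loc_right[OF _ site1_loc, simplified] override_on1
    by (intro sum.cong HOL.refl) (simp add: ent_site1 agree_def)
  then show ?thesis by (simp only: sum_idx1[of "\<lambda>a. ent x i (j(m := a)) * Y $ a $ j m" m])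
qed

lemma ent_site2_times:
  "ent (site2 m T * x) i j =
     (\<Sum>a\<in>UNIV. \<Sum>b\<in>UNIV. T $ (i m, i (Suc m)) $ (a, b) * ent x (i(m := a, Suc m := b)) j)"
proof -
  have "ent (site2 m T * x) i j =
      (\<Sum>t\<in>idx {m, Suc m}. T $ (i m, i (Suc m)) $ (t m, t (Suc m)) * ent x (i(m := t m, Suc m := t (Suc m))) j)"
    unfolding ent_times_loc_left[OF _ site2_loc, simplified] override_on2
    by (intro sum.cong HOL.refl) (simp add: ent_site2 agree_def)
  then show ?thesis
    by (simp only: sum_idx2[of "\<lambda>a b. T $ (i m, i (Suc m)) $ (a, b) * ent x (i(m := a, Suc m := b)) j" m])
qed

lemma ent_times_site2:
  "ent (x * site2 m T) i j =
     (\<Sum>a\<in>UNIV. \<Sum>b\<in>UNIV. ent x i (j(m := a, Suc m := b)) * T $ (a, b) $ (j m, j (Suc m)))"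
proof -
  have "ent (x * site2 m T) i j =
      (\<Sum>t\<in>idx {m, Suc m}. ent x i (j(m := t m, Suc m := t (Suc m))) * T $ (t m, t (Suc m)) $ (j m, j (Suc m)))"
    unfolding ent_times_loc_right[OF _ site2_loc, simplified] override_on2
    by (intro sum.cong HOL.refl) (simp add: ent_site2 agree_def)
  then show ?thesis
    by (simp only: sum_idx2[of "\<lambda>a b. ent x i (j(m := a, Suc m := b)) * T $ (a, b) $ (j m, j (Suc m))" m])
qed

lemma ent_ptr1:
  "ent (ptr {k} x) i j = (if i k = j k then \<Sum>a\<in>UNIV. ent x (i(k := a)) (j(k := a)) else 0)"
  by (simp add: ent_ptr agree_def override_on1 sum_idx1[of "\<lambda>a. ent x (i(k := a)) (j(k := a))" k])

lemma site2_one: "site2 m (mat 1) = 1"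
proof (rule ent_eqI)
  fix i j :: "nat \<Rightarrow> 'a"
  have "agree (- {m, Suc m}) i j \<and> i m = j m \<and> i (Suc m) = j (Suc m) \<longleftrightarrow> i = j"
    by (auto simp: agree_def fun_eq_iff)
  then show "ent (site2 m (mat 1)) i j = ent (1 :: (nat \<Rightarrow> 'a, 'b) rfmat) i j"
    by (auto simp: ent_site2 ent_one mat_def)
qed

lemma site2_mult: "site2 m T * site2 m Y = site2 m (T ** Y)"
proof (rule ent_eqI)
  fix i j :: "nat \<Rightarrow> 'a"
  have a: "agree (- {m, Suc m}) (i(m := a, Suc m := b)) j \<longleftrightarrow> agree (- {m, Suc m}) i j" for a b
    by (auto simp: agree_def)
  show "ent (site2 m T * site2 m Y) i j = ent (site2 m (T ** Y)) i j"
    by (simp add: ent_site2_times ent_site2 a matrix_matrix_mult_def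
        sum.cartesian_product case_prod_beta UNIV_Times_UNIV[symmetric] del: UNIV_Times_UNIV)
qed

lemma shift_site2: "shift (site2 m T) = site2 (Suc m) T"
proof (rule ent_eqI)
  fix i j :: "nat \<Rightarrow> 'a"
  have "i 0 = j 0 \<and> agree (- {m, Suc m}) (\<lambda>n. i (Suc n)) (\<lambda>n. j (Suc n)) \<longleftrightarrow>
      agree (- {Suc m, Suc (Suc m)}) i j"
    unfolding agree_def by (metis (no_types, lifting) ComplD ComplI insert_iff nat.distinct(1) nat.exhaust nat.inject singletonD)
  then show "ent (shift (site2 m T)) i j = ent (site2 (Suc m) T) i j"
    by (auto simp: ent_shift ent_site2)
qed

subsection \<open>Operators with constant entries\<close>

lemma fconst_simps:
  "fconst 0 = 0" "fconst 1 = 1" "fconst (a + b) = fconst a + fconst b" "fconst (a * b) = fconst a * fconst b"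
  "fconst a = 0 \<longleftrightarrow> a = 0" "fconst (- a) = - fconst a"
  by (simp_all add: fconst_def single_add mult_single single_uminus)
    (metis lookup_single_eq lookup_zero single_zero)

lemma fconst_sum: "fconst (sum f A) = (\<Sum>a\<in>A. fconst (f a))"
  by (induction A rule: infinite_finite_induct) (simp_all add: fconst_simps)

lemma poly_mapping_expand:
  "(\<Sum>k\<in>Poly_Mapping.keys x. Poly_Mapping.single k (Poly_Mapping.lookup x k)) = x"
  by (rule poly_mapping_eqI) (simp add: lookup_sum lookup_single when_def in_keys_iff)

lemma fconst_com: "fconst a * x = x * fconst a"
proof -
  have "fconst a * (\<Sum>k\<in>Poly_Mapping.keys x. Poly_Mapping.single k (Poly_Mapping.lookup x k)) =
      (\<Sum>k\<in>Poly_Mapping.keys x. Poly_Mapping.single k (Poly_Mapping.lookup x k)) * fconst a"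
    unfolding sum_distrib_left sum_distrib_right by (simp add: fconst_def mult_single mult.commute)
  then show ?thesis by (simp only: poly_mapping_expand)
qed

lift_definition emb :: "('i, complex) rfmat \<Rightarrow> ('i, 'g free_alg) rfmat" is "\<lambda>x i j. fconst (x i j)"
  by (simp add: fconst_simps)

lemma ent_emb: "ent (emb x) i j = fconst (ent x i j)"
  by (simp add: emb.rep_eq)

lemma emb_simps:
  "emb 0 = 0" "emb 1 = 1" "emb (x + y) = emb x + emb y"
  by (rule ent_eqI; simp add: ent_emb ent_one fconst_simps)+

lemma emb_mult: "emb (x * y) = emb x * emb y"
proof (rule ent_eqI)
  fix i j
  have "ent (x * y) i j = (\<Sum>k | ent x i k \<noteq> 0. ent x i k * ent y k j)"
    "ent (emb x * emb y :: (_, 'b free_alg) rfmat) i j = (\<Sum>k | ent x i k \<noteq> 0. ent (emb x) i k * ent (emb y) k j)"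
    by (rule ent_times; auto simp: finite_row ent_emb fconst_simps)+
  then show "ent (emb (x * y)) i j = ent (emb x * emb y :: (_, 'b free_alg) rfmat) i j"
    by (simp add: ent_emb fconst_sum fconst_simps)
qed

lemma emb_cst: "cst (emb x)"
  by (simp add: cst_def ent_emb fconst_com)

lemma emb_loc: "loc A x \<Longrightarrow> loc A (emb x)"
  by (auto simp: loc_def ent_emb fconst_simps)

lemma emb_shift: "shift (emb x) = emb (shift x)"
  by (rule ent_eqI) (simp add: ent_shift ent_emb fconst_simps)

lemma emb_ptr: "finite S \<Longrightarrow> ptr S (emb x) = emb (ptr S x)"
  by (rule ent_eqI) (simp add: ent_ptr ent_emb fconst_simps fconst_sum)

lemma oper_op_const: "finite A \<Longrightarrow> oper A (op_const T) = emb (oper A T)"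
  by (rule ent_eqI) (simp add: ent_oper ent_emb op_const_def fconst_simps)

lemma cst_complex: "cst (x :: ('i, complex) rfmat)"
  by (simp add: cst_def mult.commute)

subsection \<open>The matrix \<open>D\<close> of a skew invertible R-matrix\<close>

definition tri :: "'v \<Rightarrow> 'v \<Rightarrow> 'v \<Rightarrow> nat \<Rightarrow> 'v" where
  "tri a b c n = (if n = Suc 0 then a else if n = Suc (Suc 0) then b else
     if n = Suc (Suc (Suc 0)) then c else undefined)"

lemma tri_simps:
  "tri a b c (Suc 0) = a" "tri a b c (Suc (Suc 0)) = b" "tri a b c (Suc (Suc (Suc 0))) = c"
  "(tri a b c)(Suc 0 := x) = tri x b c" "(tri a b c)(Suc (Suc 0) := x) = tri a x c"
  "(tri a b c)(Suc (Suc (Suc 0)) := x) = tri a b x"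
  by (auto simp: tri_def)

lemma tri_eq_iff: "tri a b c = tri a' b' c' \<longleftrightarrow> a = a' \<and> b = b' \<and> c = c'"
proof
  assume h: "tri a b c = tri a' b' c'"
  have "tri a b c (Suc 0) = tri a' b' c' (Suc 0)" "tri a b c (Suc (Suc 0)) = tri a' b' c' (Suc (Suc 0))"
    "tri a b c (Suc (Suc (Suc 0))) = tri a' b' c' (Suc (Suc (Suc 0)))" by (simp_all only: h)
  then show "a = a' \<and> b = b' \<and> c = c'" by (simp add: tri_simps)
qed simp

lemma agree_tri:
  "agree (- {Suc 0, Suc (Suc 0)}) (tri a b c) (tri a' b' c') \<longleftrightarrow> c = c'"
  "agree (- {Suc (Suc 0), Suc (Suc (Suc 0))}) (tri a b c) (tri a' b' c') \<longleftrightarrow> a = a'"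
  "agree (- {Suc (Suc (Suc 0))}) (tri a b c) (tri a' b' c') \<longleftrightarrow> a = a' \<and> b = b'"
  "agree (- {Suc 0, 3}) (tri a b c) (tri a' b' c') \<longleftrightarrow> b = b'"
  by (auto simp: agree_def tri_def)

lemma oper_123:
  "op_eq {1, 2, 3} T Y \<longleftrightarrow> oper {1, 2, 3} T = oper {1, 2, 3} Y"
  "oper {1, 2, 3} (op_mult {1, 2, 3} T Y) = oper {1, 2, 3} T * oper {1, 2, 3} Y"
  by (simp_all only: oper_eq_iff oper_mult finite.intros)

lemma oper_act2_123:
  "oper {1, 2, 3} (act2 {1, 2, 3} 1 2 T) = site2 (Suc 0) T"
  "oper {1, 2, 3} (act2 {1, 2, 3} 2 3 T) = site2 (Suc (Suc 0)) T"
  using oper_act2[of "{1, 2, 3}" "Suc 0" T] oper_act2[of "{1, 2, 3}" "Suc (Suc 0)" T]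
  by (simp_all add: numeral_2_eq_2 numeral_3_eq_3)

lemma sum_swap3: "(\<Sum>c\<in>C. \<Sum>a\<in>A. \<Sum>x\<in>B. h c a x) = (\<Sum>x\<in>B. \<Sum>c\<in>C. \<Sum>a\<in>A. h c a x)"
proof -
  have "(\<Sum>c\<in>C. \<Sum>a\<in>A. \<Sum>x\<in>B. h c a x) = (\<Sum>c\<in>C. \<Sum>x\<in>B. \<Sum>a\<in>A. h c a x)"
    by (rule sum.cong[OF HOL.refl]) (rule sum.swap)
  also have "\<dots> = (\<Sum>x\<in>B. \<Sum>c\<in>C. \<Sum>a\<in>A. h c a x)" by (rule sum.swap)
  finally show ?thesis .
qed

lemma sum_swap4: "(\<Sum>c\<in>C. \<Sum>a\<in>A. \<Sum>x\<in>B. \<Sum>y\<in>E. h c a x y) = (\<Sum>x\<in>B. \<Sum>y\<in>E. \<Sum>c\<in>C. \<Sum>a\<in>A. h c a x y)"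
  by (subst sum_swap3, intro sum.cong HOL.refl, rule sum_swap3)

lemma sum_if_const: "(\<Sum>x\<in>A. if P then h x else 0) = (if P then \<Sum>x\<in>A. h x else 0)"
  by simp

lemma mult_if_zero:
  "(if P then x else 0) * y = (if P then x * y else (0 :: 'a::mult_zero))"
  "y * (if P then x else 0) = (if P then y * x else (0 :: 'a::mult_zero))"
  by simp_all

lemma ptr_site2:
  "ptr {Suc (Suc k)} (site2 k T * x) = site2 k T * ptr {Suc (Suc k)} x"
  "ptr {Suc (Suc k)} (x * site2 k T) = ptr {Suc (Suc k)} x * site2 k T"
  by (rule ptr_left[OF _ site2_loc]; simp) (rule ptr_right[OF _ site2_loc]; simp)

lemma skew_inverse_entries:
  fixes T \<Psi> :: "complex ^ ('v::finite \<times> 'v) ^ ('v \<times> 'v)"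
  assumes "is_skew_inverse T \<Psi>"
  shows "(\<Sum>t\<in>UNIV. \<Sum>k\<in>UNIV. T $ (a, t) $ (c, k) * \<Psi> $ (k, b) $ (t, d)) = (if a = d \<and> b = c then 1 else 0)"
    "(\<Sum>t\<in>UNIV. \<Sum>k\<in>UNIV. \<Psi> $ (a, t) $ (c, k) * T $ (k, b) $ (t, d)) = (if a = d \<and> b = c then 1 else 0)"
proof -
  have *: "(\<Sum>t\<in>UNIV. \<Sum>k\<in>UNIV. K $ (a, t) $ (c, k) * L $ (k, b) $ (t, d)) = (if a = d \<and> b = c then 1 else 0)"
    if "op_eq {1, 3} (ptrace {2} (op_mult {1, 2, 3} (act2 {1, 2, 3} 1 2 K) (act2 {1, 2, 3} 2 3 L)))
      (act2 {1, 3} 1 3 flip)" for K L :: "complex ^ ('v \<times> 'v) ^ ('v \<times> 'v)"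
  proof -
    have A: "{1, 3} = {1, 2, 3} - {2::nat}" by auto
    have "ptr {2} (site2 (Suc 0) K * site2 (Suc (Suc 0)) L) = oper {1, 3} (act2 {1, 3} 1 3 flip)"
    proof -
      have "oper {1, 3} (ptrace {2} (op_mult {1, 2, 3} (act2 {1, 2, 3} 1 2 K) (act2 {1, 2, 3} 2 3 L))) =
          ptr {2} (oper {1, 2, 3} (op_mult {1, 2, 3} (act2 {1, 2, 3} 1 2 K) (act2 {1, 2, 3} 2 3 L)))"
        unfolding A by (rule oper_ptrace) auto
      moreover have "oper {1, 3} (ptrace {2} (op_mult {1, 2, 3} (act2 {1, 2, 3} 1 2 K) (act2 {1, 2, 3} 2 3 L))) =
          oper {1, 3} (act2 {1, 3} 1 3 flip)"
        using that by (subst (asm) oper_eq_iff) simp_all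
      ultimately show ?thesis by (simp only: oper_123 oper_act2_123)
    qed
    \<comment> \<open>Factor 2 is traced, so its coordinate only has to be the same on both sides;
      \<open>b\<close> is an arbitrary choice for it.\<close>
    then have "ent (ptr {2} (site2 (Suc 0) K * site2 (Suc (Suc 0)) L)) (tri a b b) (tri c b d) =
        ent (oper {1, 3} (act2 {1, 3} 1 3 flip)) (tri a b b) (tri c b d)" by simp
    moreover have "ent (oper {1, 3} (act2 {1, 3} 1 3 flip)) (tri a b b) (tri c b d) = 
       (if a = d \<and> b = c then 1 else 0)"
      by (simp add: ent_oper act2_def flip_def agree_tri tri_simps numeral_3_eq_3)
         (auto simp: agree_def tri_def)
    ultimately have "ent (ptr {2} (site2 (Suc 0) K * site2 (Suc (Suc 0)) L)) (tri a b b) (tri c b d) =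
        (if a = d \<and> b = c then 1 else 0)" by (simp only:)
    then show ?thesis
      by (simp add: ent_ptr1 ent_site2_times ent_site2 tri_simps numeral_2_eq_2 agree_tri mult_if_zero
          sum_if_const cong: if_cong)
  qed
  show "(\<Sum>t\<in>UNIV. \<Sum>k\<in>UNIV. T $ (a, t) $ (c, k) * \<Psi> $ (k, b) $ (t, d)) = (if a = d \<and> b = c then 1 else 0)"
    "(\<Sum>t\<in>UNIV. \<Sum>k\<in>UNIV. \<Psi> $ (a, t) $ (c, k) * T $ (k, b) $ (t, d)) = (if a = d \<and> b = c then 1 else 0)"
    by (rule *[OF conjunct1[OF assms[unfolded is_skew_inverse_def Let_def]]])
      (rule *[OF conjunct2[OF assms[unfolded is_skew_inverse_def Let_def]]])
qed

text \<open>The relations are given in the factors 1, 2, 3. Injectivity of the shift carries them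
  down to the factors 0, 1, 2, which exist here too; from there they are shifted up to any
  \<open>k\<close>.\<close>

lemma shift_site2_3:
  assumes "site2 (Suc d1) A1 * (site2 (Suc d2) A2 * site2 (Suc d3) A3) =
    site2 (Suc e1) B1 * (site2 (Suc e2) B2 * site2 (Suc e3) B3)"
  shows "site2 (k + d1) A1 * (site2 (k + d2) A2 * site2 (k + d3) A3) =
    site2 (k + e1) B1 * (site2 (k + e2) B2 * site2 (k + e3) B3)"
proof (induction k)
  case 0
  show ?case by (rule shift_inj) (simp add: shift_mult shift_site2 assms)
next
  case (Suc k)
  show ?case using arg_cong[OF Suc, of shift] by (simp only: shift_mult shift_site2 add_Suc)
qed

lemma R_matrix_braid:
  assumes "R_matrix R"
  shows "site2 k R * (site2 (Suc k) R * site2 k R) = site2 (Suc k) R * (site2 k R * site2 (Suc k) R)"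
proof -
  have "site2 (Suc 0) R * (site2 (Suc 1) R * site2 (Suc 0) R) =
      site2 (Suc 1) R * (site2 (Suc 0) R * site2 (Suc 1) R)"
    using assms unfolding R_matrix_def Let_def oper_123 oper_act2_123 by simp
  from shift_site2_3[OF this, of k] show ?thesis by simp
qed

lemma compatible_pair_relations:
  assumes "compatible_pair R F"
  shows "site2 k R * (site2 (Suc k) F * site2 k F) = site2 (Suc k) F * (site2 k F * site2 (Suc k) R)"
    "site2 (Suc k) R * (site2 k F * site2 (Suc k) F) = site2 k F * (site2 (Suc k) F * site2 k R)"
proof -
  have "site2 (Suc 0) R * (site2 (Suc 1) F * site2 (Suc 0) F) =
      site2 (Suc 1) F * (site2 (Suc 0) F * site2 (Suc 1) R)"
    "site2 (Suc 1) R * (site2 (Suc 0) F * site2 (Suc 1) F) =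
      site2 (Suc 0) F * (site2 (Suc 1) F * site2 (Suc 0) R)"
    using assms unfolding compatible_pair_def Let_def oper_123 oper_act2_123 by simp_all
  from this[THEN shift_site2_3, of k]
  show "site2 k R * (site2 (Suc k) F * site2 k F) = site2 (Suc k) F * (site2 k F * site2 (Suc k) R)"
    "site2 (Suc k) R * (site2 k F * site2 (Suc k) F) = site2 k F * (site2 (Suc k) F * site2 k R)"
    by simp_all
qed

lemma site2_inverse:
  fixes R :: "complex ^ ('v::finite \<times> 'v) ^ ('v \<times> 'v)"
  assumes "R_matrix R"
  shows "site2 k R * site2 k (matrix_inv R) = 1" "site2 k (matrix_inv R) * site2 k R = 1"
proof -
  have "invertible R" using assms by (simp add: R_matrix_def)
  then have "R ** matrix_inv R = mat 1 \<and> matrix_inv R ** R = mat 1"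
    unfolding invertible_def matrix_inv_def by (rule someI_ex)
  then show "site2 k R * site2 k (matrix_inv R) = 1" "site2 k (matrix_inv R) * site2 k R = 1"
    by (simp_all add: site2_mult site2_one)
qed

context
  fixes R :: "complex ^ ('v::finite \<times> 'v) ^ ('v \<times> 'v)"
  assumes R: "R_matrix R" and skew: "skew_invertible R"
begin

private abbreviation "\<Psi> \<equiv> skew_inv R"
private abbreviation "D \<equiv> D_mat R"

section \<open>Consequences of the equations for the skew inverse\<close>

private lemma S: "is_skew_inverse R \<Psi>"
  using skew unfolding skew_invertible_def skew_inv_def by (rule someI_ex)

private lemma S1: "(\<Sum>t\<in>UNIV. \<Sum>k\<in>UNIV. R $ (a, t) $ (c, k) * \<Psi> $ (k, b) $ (t, d)) = (if a = d \<and> b = c then 1 else 0)"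
  by (rule skew_inverse_entries(1)[OF S])

private lemma S2: "(\<Sum>t\<in>UNIV. \<Sum>k\<in>UNIV. \<Psi> $ (a, t) $ (c, k) * R $ (k, b) $ (t, d)) = (if a = d \<and> b = c then 1 else 0)"
  by (rule skew_inverse_entries(2)[OF S])

text \<open>\<open>D\<close> is \<Psi> traced over its second factor, so the sum over
  \<open>b = d\<close> of the first equation \<open>S1\<close> gives the claim.\<close>

lemma R_D_entries: "(\<Sum>t\<in>UNIV. \<Sum>k\<in>UNIV. R $ (a, t) $ (c, k) * D $ k $ t) = (if a = c then 1 else 0)"
proof -
  have "(\<Sum>t\<in>UNIV. \<Sum>k\<in>UNIV. R $ (a, t) $ (c, k) * D $ k $ t) =
      (\<Sum>t\<in>UNIV. \<Sum>k\<in>UNIV. \<Sum>b\<in>UNIV. R $ (a, t) $ (c, k) * \<Psi> $ (k, b) $ (t, b))"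
    by (simp add: D_mat_def sum_distrib_left)
  also have "\<dots> = (\<Sum>t\<in>UNIV. \<Sum>b\<in>UNIV. \<Sum>k\<in>UNIV. R $ (a, t) $ (c, k) * \<Psi> $ (k, b) $ (t, b))"
    by (rule sum.cong[OF HOL.refl]) (rule sum.swap)
  also have "\<dots> = (\<Sum>b\<in>UNIV. \<Sum>t\<in>UNIV. \<Sum>k\<in>UNIV. R $ (a, t) $ (c, k) * \<Psi> $ (k, b) $ (t, b))"
    by (rule sum.swap)
  also have "\<dots> = (\<Sum>b\<in>UNIV. if b = a \<and> a = c then 1 else 0)"
    unfolding S1 by (intro sum.cong) auto
  also have "\<dots> = (if a = c then 1 else 0)" by (cases "a = c") simp_all
  finally show ?thesis .
qed

lemma ptr_R_D: "ptr {Suc k} (site2 k R * site1 (Suc k) D) = 1"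
proof (rule ent_eqI)
  fix i j :: "nat \<Rightarrow> 'v"
  have "ent (ptr {Suc k} (site2 k R * site1 (Suc k) D)) i j =
      (if i (Suc k) = j (Suc k) then \<Sum>t\<in>UNIV. \<Sum>a\<in>UNIV.
        (if agree (- {k, Suc k}) i j then R $ (i k, t) $ (j k, a) else 0) * D $ a $ t else 0)"
  proof -
    have "agree (- {k, Suc k}) (i(Suc k := a)) (j(Suc k := b)) \<longleftrightarrow> agree (- {k, Suc k}) i j" for a b
      by (auto simp: agree_def)
    then show ?thesis by (simp add: ent_ptr1 ent_times_site1 ent_site2 cong: if_cong)
  qed
  also have "\<dots> = (if i (Suc k) = j (Suc k) \<and> agree (- {k, Suc k}) i j \<and> i k = j k then 1 else 0)"
    by (cases "agree (- {k, Suc k}) i j") (simp_all add: R_D_entries)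
  also have "(i (Suc k) = j (Suc k) \<and> agree (- {k, Suc k}) i j \<and> i k = j k) \<longleftrightarrow> i = j"
    by (auto simp: agree_def fun_eq_iff)
  finally show "ent (ptr {Suc k} (site2 k R * site1 (Suc k) D)) i j = ent 1 i j"
    by (simp add: ent_one)
qed

lemma ptr_D_R: "ptr {Suc k} (site1 (Suc k) D * site2 k R) = 1"
  using ptr_R_D ptr_cyc[OF _ site1_loc cst_complex, of "Suc k" D "site2 k R"] by simp

text \<open>Contracting the first factor with \<open>\<Psi>\<close> turns an identity for \<open>R\<close> into one for an arbitrary
  matrix, because the second tensor components of \<open>R\<close> span all of \<open>End(V)\<close>.\<close>

lemma contract_entries:
  fixes K L :: "complex ^ ('v \<times> 'v) ^ ('v \<times> 'v)"
  assumes "ptr {Suc (Suc (Suc 0))} (site2 (Suc (Suc 0)) K * (site2 (Suc 0) R * site2 (Suc (Suc 0)) L)) = 1"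
  shows "(\<Sum>t\<in>UNIV. \<Sum>g\<in>UNIV. K $ (b, t) $ (q, g) * L $ (p, g) $ (d, t)) = (if b = d then D $ p $ q else 0)"
proof -
  have e: "(\<Sum>t\<in>UNIV. \<Sum>e\<in>UNIV. \<Sum>g\<in>UNIV. \<Sum>e'\<in>UNIV. K $ (b, t) $ (e, g) * (R $ (a, e) $ (c, e') * L $ (e', g) $ (d, t))) =
      (if a = c \<and> b = d then 1 else 0)" for a c
  proof -
    have "ent (site2 (Suc (Suc 0)) K * (site2 (Suc 0) R * site2 (Suc (Suc 0)) L)) (tri a b t) (tri c d t) =
        (\<Sum>e\<in>UNIV. \<Sum>g\<in>UNIV. K $ (b, t) $ (e, g) * (\<Sum>e'\<in>UNIV. R $ (a, e) $ (c, e') * L $ (e', g) $ (d, t)))" for t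
      by (simp add: ent_site2_times ent_site2 tri_simps agree_tri mult_if_zero sum_if_const)
    then have "ent (ptr {Suc (Suc (Suc 0))} (site2 (Suc (Suc 0)) K * (site2 (Suc 0) R * site2 (Suc (Suc 0)) L)))
        (tri a b b) (tri c d b) = (\<Sum>t\<in>UNIV. \<Sum>e\<in>UNIV. \<Sum>g\<in>UNIV. \<Sum>e'\<in>UNIV.
          K $ (b, t) $ (e, g) * (R $ (a, e) $ (c, e') * L $ (e', g) $ (d, t)))"
      by (simp add: ent_ptr1 tri_simps sum_distrib_left)
    moreover have "ent 1 (tri a b b) (tri c d b) = (if a = c \<and> b = d then 1 else (0::complex))"
      by (simp add: ent_one tri_eq_iff)
    ultimately show ?thesis using assms by (simp only:)
  qed
  \<comment> \<open>The coefficients are chosen for \<open>S2\<close>: the sums over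
    \<open>c\<close> and \<open>a\<close> turn \<Psi> R into Kronecker deltas that fix e = q and e'
    = p.\<close>
  have "(\<Sum>c\<in>UNIV. \<Sum>a\<in>UNIV. \<Psi> $ (p, c) $ (q, a) * (\<Sum>t\<in>UNIV. \<Sum>e\<in>UNIV. \<Sum>g\<in>UNIV. \<Sum>e'\<in>UNIV.
        K $ (b, t) $ (e, g) * (R $ (a, e) $ (c, e') * L $ (e', g) $ (d, t)))) =
      (\<Sum>t\<in>UNIV. \<Sum>e\<in>UNIV. \<Sum>g\<in>UNIV. \<Sum>e'\<in>UNIV. \<Sum>c\<in>UNIV. \<Sum>a\<in>UNIV. \<Psi> $ (p, c) $ (q, a) *
        (K $ (b, t) $ (e, g) * (R $ (a, e) $ (c, e') * L $ (e', g) $ (d, t))))"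
  proof -
    show ?thesis unfolding sum_distrib_left 
      by (rule HOL.trans[OF sum_swap4], rule sum.cong[OF HOL.refl], rule sum.cong[OF HOL.refl], rule sum_swap4)
  qed
  also have "\<dots> = (\<Sum>t\<in>UNIV. \<Sum>e\<in>UNIV. \<Sum>g\<in>UNIV. \<Sum>e'\<in>UNIV.
      (\<Sum>c\<in>UNIV. \<Sum>a\<in>UNIV. \<Psi> $ (p, c) $ (q, a) * R $ (a, e) $ (c, e')) * (K $ (b, t) $ (e, g) * L $ (e', g) $ (d, t)))"
    unfolding sum_distrib_right by (intro sum.cong HOL.refl) (simp add: ac_simps)
  also have "\<dots> = (\<Sum>t\<in>UNIV. \<Sum>e\<in>UNIV. \<Sum>g\<in>UNIV. \<Sum>e'\<in>UNIV.
      if e' = p then if e = q then K $ (b, t) $ (e, g) * L $ (e', g) $ (d, t) else 0 else 0)"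
    unfolding S2 by (intro sum.cong HOL.refl) auto
  also have "\<dots> = (\<Sum>t\<in>UNIV. \<Sum>e\<in>UNIV. if e = q then \<Sum>g\<in>UNIV. K $ (b, t) $ (e, g) * L $ (p, g) $ (d, t) else 0)"
    by (intro sum.cong HOL.refl) (simp add: sum.delta)
  also have "\<dots> = (\<Sum>t\<in>UNIV. \<Sum>g\<in>UNIV. K $ (b, t) $ (q, g) * L $ (p, g) $ (d, t))"
    by (simp add: sum.delta)
  finally have "(\<Sum>t\<in>UNIV. \<Sum>g\<in>UNIV. K $ (b, t) $ (q, g) * L $ (p, g) $ (d, t)) =
      (\<Sum>c\<in>UNIV. \<Sum>a\<in>UNIV. \<Psi> $ (p, c) $ (q, a) * (if a = c \<and> b = d then 1 else 0))"
    unfolding e by simp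
  also have "\<dots> = (if b = d then \<Sum>c\<in>UNIV. \<Psi> $ (p, c) $ (q, c) else 0)"
    by (simp add: mult_if_zero cong: if_cong)
  finally show ?thesis by (simp add: D_mat_def)
qed

text \<open>The product of F^(-1) with D in the second factor, on the right; \<open>D_inv\<close>
  has D on the left.\<close>

definition inv_D :: "complex ^ ('v \<times> 'v) ^ ('v \<times> 'v) \<Rightarrow> complex ^ ('v \<times> 'v) ^ ('v \<times> 'v)" where
  "inv_D F = (\<chi> p q. \<Sum>u\<in>UNIV. matrix_inv F $ p $ (fst q, u) * D $ u $ snd q)"

definition D_inv :: "complex ^ ('v \<times> 'v) ^ ('v \<times> 'v) \<Rightarrow> complex ^ ('v \<times> 'v) ^ ('v \<times> 'v)" where
  "D_inv F = (\<chi> p q. \<Sum>u\<in>UNIV. D $ snd p $ u * matrix_inv F $ (fst p, u) $ q)"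

lemma site2_inv_D: "site2 k (inv_D F) = site2 k (matrix_inv F) * site1 (Suc k) D"
proof (rule ent_eqI)
  fix i j :: "nat \<Rightarrow> 'v"
  have "agree (- {k, Suc k}) i (j(Suc k := a)) \<longleftrightarrow> agree (- {k, Suc k}) i j" for a
    by (auto simp: agree_def)
  then show "ent (site2 k (inv_D F)) i j = ent (site2 k (matrix_inv F) * site1 (Suc k) D) i j"
    by (simp add: ent_times_site1 ent_site2 inv_D_def)
qed

lemma site2_D_inv: "site2 k (D_inv F) = site1 (Suc k) D * site2 k (matrix_inv F)"
proof (rule ent_eqI)
  fix i j :: "nat \<Rightarrow> 'v"
  have "agree (- {k, Suc k}) (i(Suc k := a)) j \<longleftrightarrow> agree (- {k, Suc k}) i j" for a
    by (auto simp: agree_def)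
  then show "ent (site2 k (D_inv F)) i j = ent (site1 (Suc k) D * site2 k (matrix_inv F)) i j"
    by (simp add: ent_site1_times ent_site2 D_inv_def)
qed

text \<open>Compatibility gives F_2 R_1 F_2^(-1) = F_1^(-1) R_2 F_1. The R-trace over factor 3
  replaces R_2 by 1, so the right side becomes 1, and \<open>contract_entries\<close> applies. In
  entries this is the invariance Tr_R(2) (F X_1 F^(-1)) = Tr_R X.\<close>

lemma F_inv_D_entries:
  assumes F: "R_matrix F" and up: "\<And>k. site2 (Suc k) R * (site2 k F * site2 (Suc k) F) = site2 k F * (site2 (Suc k) F * site2 k R)"
  shows "(\<Sum>t\<in>UNIV. \<Sum>g\<in>UNIV. F $ (b, t) $ (q, g) * inv_D F $ (p, g) $ (d, t)) = (if b = d then D $ p $ q else 0)"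
proof (rule contract_entries)
  let ?k = "Suc 0" and ?l = "Suc (Suc 0)" and ?m = "Suc (Suc (Suc 0))"
  let ?f = "\<lambda>k. site2 k F" and ?fi = "\<lambda>k. site2 k (matrix_inv F)" and ?r = "\<lambda>k. site2 k R" and ?d = "site1 ?m D"
  note inv = site2_inverse[OF F]
  have inv': "?fi k * (?f k * x) = x" for k x by (simp add: inv mult.assoc[symmetric])
  have "?fi ?k * (?r ?l * (?f ?k * ?f ?l)) = ?f ?l * ?r ?k"
    unfolding up inv' ..
  then have "?f ?l * (?r ?k * ?fi ?l) = (?fi ?k * (?r ?l * (?f ?k * ?f ?l))) * ?fi ?l"
    by (simp only: mult.assoc)
  also have "\<dots> = ?fi ?k * (?r ?l * ?f ?k)"
    by (simp only: mult.assoc inv mult_1_right)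
  finally have e: "?f ?l * (?r ?k * ?fi ?l) = ?fi ?k * (?r ?l * ?f ?k)" .
  have c: "?f ?k * ?d = ?d * ?f ?k"
    by (rule com[OF cst_complex site2_loc site1_loc]) simp
  have "?f ?l * (?r ?k * site2 ?l (inv_D F)) = (?f ?l * (?r ?k * ?fi ?l)) * ?d"
    by (simp only: site2_inv_D mult.assoc)
  also have "\<dots> = ?fi ?k * ((?r ?l * ?d) * ?f ?k)"
    unfolding e by (simp only: mult.assoc c)
  finally have "ptr {?m} (?f ?l * (?r ?k * site2 ?l (inv_D F))) = ?fi ?k * (ptr {?m} (?r ?l * ?d) * ?f ?k)"
    by (simp only: ptr_site2)
  then show "ptr {?m} (?f ?l * (?r ?k * site2 ?l (inv_D F))) = 1"
    using ptr_R_D[of ?l] inv by simp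
qed

text \<open>The mirror image, from R_2^(-1) R_1 R_2 = R_1 R_2 R_1^(-1), with D on the left of the
  inverse.\<close>

lemma D_inv_R_entries:
  "(\<Sum>t\<in>UNIV. \<Sum>g\<in>UNIV. D_inv R $ (b, t) $ (q, g) * R $ (p, g) $ (d, t)) = (if b = d then D $ p $ q else 0)"
proof (rule contract_entries)
  let ?k = "Suc 0" and ?l = "Suc (Suc 0)" and ?m = "Suc (Suc (Suc 0))"
  let ?r = "\<lambda>k. site2 k R" and ?ri = "\<lambda>k. site2 k (matrix_inv R)" and ?d = "site1 ?m D"
  note inv = site2_inverse[OF R]
  have inv': "?ri k * (?r k * x) = x" for k x by (simp add: inv mult.assoc[symmetric])
  have "?ri ?l * (?r ?k * ?r ?l) = ?ri ?l * ((?r ?k * (?r ?l * ?r ?k)) * ?ri ?k)"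
    by (simp only: mult.assoc inv mult_1_right)
  also have "\<dots> = ?r ?k * (?r ?l * ?ri ?k)"
    unfolding R_matrix_braid[OF R] by (simp only: mult.assoc inv')
  finally have e: "?ri ?l * (?r ?k * ?r ?l) = ?r ?k * (?r ?l * ?ri ?k)" .
  have c: "?d * ?r ?k = ?r ?k * ?d"
    by (rule com[OF cst_complex site1_loc site2_loc]) simp
  have "site2 ?l (D_inv R) * (?r ?k * ?r ?l) = ?d * (?ri ?l * (?r ?k * ?r ?l))"
    by (simp only: site2_D_inv mult.assoc)
  also have "\<dots> = (?d * ?r ?k) * (?r ?l * ?ri ?k)"
    unfolding e by (simp only: mult.assoc)
  also have "\<dots> = ?r ?k * ((?d * ?r ?l) * ?ri ?k)"
    unfolding c by (simp only: mult.assoc)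
  finally have "ptr {?m} (site2 ?l (D_inv R) * (?r ?k * ?r ?l)) = ?r ?k * (ptr {?m} (?d * ?r ?l) * ?ri ?k)"
    by (simp only: ptr_site2)
  then show "ptr {?m} (site2 ?l (D_inv R) * (?r ?k * ?r ?l)) = 1"
    using ptr_D_R[of ?l] inv by simp
qed

text \<open>A second contraction with \<Psi> removes the R that precedes the inverse in
  \<open>F_inv_D_entries\<close>, taken for F = R. It expresses R^(-1) D_2 through \<Psi> and D;
  \<open>D_inv_Psi\<close> does the same for D_2 R^(-1).\<close>

lemma inv_D_Psi: "inv_D R $ (p, x) $ (d, y) = (\<Sum>q\<in>UNIV. \<Psi> $ (x, q) $ (y, d) * D $ p $ q)"
proof -
  have "(\<Sum>q\<in>UNIV. \<Sum>b\<in>UNIV. \<Psi> $ (x, q) $ (y, b) *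
      (\<Sum>t\<in>UNIV. \<Sum>g\<in>UNIV. R $ (b, t) $ (q, g) * inv_D R $ (p, g) $ (d, t))) =
    (\<Sum>t\<in>UNIV. \<Sum>g\<in>UNIV. (\<Sum>q\<in>UNIV. \<Sum>b\<in>UNIV. \<Psi> $ (x, q) $ (y, b) * R $ (b, t) $ (q, g)) * inv_D R $ (p, g) $ (d, t))"
  proof -
    show ?thesis unfolding sum_distrib_left sum_distrib_right mult.assoc by (rule sum_swap4)
  qed
  also have "\<dots> = (\<Sum>t\<in>UNIV. \<Sum>g\<in>UNIV. if g = x then if t = y then inv_D R $ (p, g) $ (d, t) else 0 else 0)"
    unfolding S2 by (intro sum.cong HOL.refl) auto
  also have "\<dots> = inv_D R $ (p, x) $ (d, y)" by (simp add: sum.delta)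
  finally show ?thesis
    unfolding F_inv_D_entries[OF R R_matrix_braid[OF R, symmetric]]
    by (simp add: mult_if_zero cong: if_cong)
qed

lemma D_inv_Psi: "D_inv R $ (b, x) $ (q, y) = (\<Sum>p\<in>UNIV. \<Psi> $ (x, b) $ (y, p) * D $ p $ q)"
proof -
  have "(\<Sum>d\<in>UNIV. \<Sum>p\<in>UNIV. \<Psi> $ (x, d) $ (y, p) *
      (\<Sum>t\<in>UNIV. \<Sum>g\<in>UNIV. D_inv R $ (b, t) $ (q, g) * R $ (p, g) $ (d, t))) =
    (\<Sum>t\<in>UNIV. \<Sum>g\<in>UNIV. (\<Sum>d\<in>UNIV. \<Sum>p\<in>UNIV. \<Psi> $ (x, d) $ (y, p) * R $ (p, g) $ (d, t)) * D_inv R $ (b, t) $ (q, g))"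
  proof -
    show ?thesis unfolding sum_distrib_left sum_distrib_right
      by (rule HOL.trans[OF sum_swap4], intro sum.cong HOL.refl) (simp add: ac_simps)
  qed
  also have "\<dots> = (\<Sum>t\<in>UNIV. \<Sum>g\<in>UNIV. if g = y then if t = x then D_inv R $ (b, t) $ (q, g) else 0 else 0)"
    unfolding S2 by (intro sum.cong HOL.refl) auto
  also have "\<dots> = D_inv R $ (b, x) $ (q, y)" by (simp add: sum.delta)
  finally show ?thesis
    unfolding D_inv_R_entries by (simp add: mult_if_zero sum_if_const cong: if_cong)
qed

text \<open>With D_1 multiplied from the outer side, R^(-1) D_2 D_1 and D_1 D_2 R^(-1) both become
  the double sum of \<Psi> with two entries of D. Multiplying by R on both sides gives the
  claim.\<close>

lemma D_D_R: "site1 k D * site1 (Suc k) D * site2 k R = site2 k R * (site1 k D * site1 (Suc k) D)"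
proof -
  let ?ri = "site2 k (matrix_inv R)" and ?r = "site2 k R" and ?d = "site1 k D" and ?e = "site1 (Suc k) D"
  note inv = site2_inverse[OF R]
  have de: "?d * ?e = ?e * ?d" by (rule com[OF cst_complex site1_loc site1_loc]) simp
  have "?ri * ?e * ?d = ?d * (?e * ?ri)"
  proof (rule ent_eqI)
    fix i j :: "nat \<Rightarrow> 'v"
    have a: "agree (- {k, Suc k}) i (j(k := a)) \<longleftrightarrow> agree (- {k, Suc k}) i j"
      "agree (- {k, Suc k}) (i(k := a)) j \<longleftrightarrow> agree (- {k, Suc k}) i j" for a
      by (auto simp: agree_def)
    have "(\<Sum>v\<in>UNIV. inv_D R $ (i k, i (Suc k)) $ (v, j (Suc k)) * D $ v $ j k) =
        (\<Sum>v\<in>UNIV. D $ i k $ v * D_inv R $ (v, i (Suc k)) $ (j k, j (Suc k)))"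
      unfolding inv_D_Psi D_inv_Psi sum_distrib_left sum_distrib_right
      by (subst sum.swap) (simp add: ac_simps)
    then show "ent (?ri * ?e * ?d) i j = ent (?d * (?e * ?ri)) i j"
      unfolding site2_inv_D[symmetric] site2_D_inv[symmetric]
      by (cases "agree (- {k, Suc k}) i j") (simp_all add: ent_times_site1 ent_site1_times ent_site2 a)
  qed
  then have "?r * (?ri * (?d * ?e)) * ?r = ?r * (?d * (?e * ?ri)) * ?r"
    unfolding de by (simp only: mult.assoc)
  then have "(?r * ?ri) * (?d * ?e * ?r) = ?r * (?d * ?e) * (?ri * ?r)"
    by (simp only: mult.assoc)
  then show ?thesis by (simp only: inv mult_1_left mult_1_right)
qed

end

subsection \<open>Braid words and the group algebra\<close>

lemma braid_eq_bwords: "braid_eq n u v \<Longrightarrow> u \<in> bwords n \<and> v \<in> bwords n"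
  by (induction rule: braid_eq.induct) (auto simp: bwords_def)

lemma braid_rel_iff: "(u, v) \<in> braid_rel n \<longleftrightarrow> braid_eq n u v"
  by (simp add: braid_rel_def)

lemma mem_braid_class: "v \<in> braid_class n w \<longleftrightarrow> braid_eq n w v"
  by (simp add: braid_class_def braid_rel_iff)

lemma carrier_braid_group: "carrier (braid_group n) = braid_class n ` bwords n"
  by (auto simp: braid_group_def quotient_def braid_class_def)

lemma bwords_append: "u \<in> bwords n \<Longrightarrow> v \<in> bwords n \<Longrightarrow> u @ v \<in> bwords n"
  by (auto simp: bwords_def)

lemma braid_group_mult:
  assumes "u \<in> bwords n" "v \<in> bwords n"
  shows "braid_class n u \<otimes>\<^bsub>braid_group n\<^esub> braid_class n v = braid_class n (u @ v)"
proof -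
  have "braid_rel n `` {u' @ v' | u' v'. u' \<in> braid_class n u \<and> v' \<in> braid_class n v} = braid_class n (u @ v)"
  proof (intro Set.set_eqI iffI)
    fix x
    assume "x \<in> braid_rel n `` {u' @ v' | u' v'. u' \<in> braid_class n u \<and> v' \<in> braid_class n v}"
    then obtain u' v' where "braid_eq n u u'" "braid_eq n v v'" "braid_eq n (u' @ v') x"
      by (auto simp: mem_braid_class braid_rel_iff)
    then show "x \<in> braid_class n (u @ v)"
      by (auto simp: mem_braid_class intro: braid_eq.trans braid_eq.cong)
  next
    fix x assume "x \<in> braid_class n (u @ v)"
    moreover have "u \<in> braid_class n u" "v \<in> braid_class n v"
      using assms by (auto simp: mem_braid_class intro: braid_eq.refl)
    ultimately show "x \<in> braid_rel n `` {u' @ v' | u' v'. u' \<in> braid_class n u \<and> v' \<in> braid_class n v}"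
      by (intro ImageI[of "u @ v"]) (auto simp: mem_braid_class braid_rel_iff)
  qed
  then show ?thesis by (simp add: braid_group_def)
qed

abbreviation shift_word :: "nat \<Rightarrow> bword \<Rightarrow> bword" where
  "shift_word k \<equiv> map (map_prod (\<lambda>j. j + k) id)"

lemma shift_word_bwords: "w \<in> bwords n \<Longrightarrow> n + k \<le> m \<Longrightarrow> shift_word k w \<in> bwords m"
  by (fastforce simp: bwords_def)

lemma braid_eq_shift:
  assumes "braid_eq n u v" "n + k \<le> m"
  shows "braid_eq m (shift_word k u) (shift_word k v)"
  using assms
proof (induction rule: braid_eq.induct)
  case (refl w)
  then show ?case by (intro braid_eq.refl shift_word_bwords)
next
  case (cancel i e)
  then show ?case using braid_eq.cancel[of "i + k" m e] by simp
next
  case (braid i)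
  then show ?case using braid_eq.braid[of "i + k" m] by simp
next
  case (far i j)
  then show ?case using braid_eq.far[of "i + k" m "j + k"] by simp
next
  case (sym u v)
  then show ?case by (blast intro: braid_eq.sym)
next
  case (trans u v w)
  then show ?case by (blast intro: braid_eq.trans)
next
  case (cong u u' v v')
  then show ?case unfolding map_append by (blast intro: braid_eq.cong)
qed

lemma braid_embed_class:
  assumes "w \<in> bwords n" "n + k \<le> m"
  shows "braid_embed k m (braid_class n w) = braid_class m (shift_word k w)"
proof (intro Set.set_eqI iffI)
  fix x assume "x \<in> braid_embed k m (braid_class n w)"
  then obtain w' where "braid_eq n w w'" "braid_eq m (shift_word k w') x"
    by (auto simp: braid_embed_def mem_braid_class braid_rel_iff)
  then show "x \<in> braid_class m (shift_word k w)"
    using braid_eq_shift[OF _ assms(2)] by (auto simp: mem_braid_class intro: braid_eq.trans)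
next
  fix x assume "x \<in> braid_class m (shift_word k w)"
  moreover have "w \<in> braid_class n w" using assms by (auto simp: mem_braid_class intro: braid_eq.refl)
  ultimately show "x \<in> braid_embed k m (braid_class n w)"
    by (auto simp: braid_embed_def mem_braid_class braid_rel_iff)
qed

text \<open>The recursion of \<open>s\<close>: one more conjugation, by the next generator.\<close>

lemma star_word_Suc: "star_word (Suc (Suc n)) = (n + 2, True) # star_word (Suc n) @ [(n + 2, False)]"
  by (simp add: star_word_def)

lemma star_word_bwords: "1 \<le> n \<Longrightarrow> 1 \<le> i \<Longrightarrow> star_word n \<in> bwords (n + i)"
  by (auto simp: star_word_def bwords_def)

lemma braid_algebra_single: "a \<in> carrier (braid_group n) \<Longrightarrow> Poly_Mapping.single a x \<in> braid_algebra n"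
  by (simp add: braid_algebra_def)

lemma braid_algebra_sum: "(\<And>a. a \<in> A \<Longrightarrow> h a \<in> braid_algebra n) \<Longrightarrow> sum h A \<in> braid_algebra n"
  unfolding braid_algebra_def using keys_sum[of h A] by (simp, blast)

lemma galg_mult_closed: "\<alpha> \<in> braid_algebra n \<Longrightarrow> \<beta> \<in> braid_algebra n \<Longrightarrow> galg_mult n \<alpha> \<beta> \<in> braid_algebra n"
  unfolding galg_mult_def
  by (intro braid_algebra_sum braid_algebra_single)
    (auto simp: braid_algebra_def carrier_braid_group braid_group_mult dest!: subsetD intro: bwords_append)

lemma galg_embed_closed: "\<alpha> \<in> braid_algebra n \<Longrightarrow> n + k \<le> m \<Longrightarrow> galg_embed k m \<alpha> \<in> braid_algebra m"
  unfolding galg_embed_def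
  by (intro braid_algebra_sum braid_algebra_single)
    (auto simp: braid_algebra_def carrier_braid_group braid_embed_class dest!: subsetD intro: shift_word_bwords)

lemma star_class_closed:
  "1 \<le> n \<Longrightarrow> 1 \<le> i \<Longrightarrow> Poly_Mapping.single (braid_class (n + i) (star_word n)) x \<in> braid_algebra (n + i)"
  by (intro braid_algebra_single) (auto simp: carrier_braid_group star_word_bwords)

subsection \<open>The representation of the braid groups by operators\<close>

definition scal :: "'a::ring_1 \<Rightarrow> (nat \<Rightarrow> 'v::finite, 'a) rfmat" where
  "scal c = oper {} (\<lambda>_ _. c)"

lemma ent_scal: "ent (scal c) i j = (if i = j then c else 0)"
  by (auto simp: scal_def ent_oper agree_def fun_eq_iff)

lemma scal_loc: "loc {} (scal c)"
  by (simp add: scal_def oper_loc)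

lemma ent_scal_times: "ent (scal c * x) i j = c * ent x i j"
  by (subst ent_times[of "{i}"]) (auto simp: ent_scal split: if_splits)

lemma ent_times_scal: "ent (x * scal c) i j = ent x i j * c"
  by (subst ent_times[of "{j}"]) (auto simp: ent_scal split: if_splits)

lemma scal_simps: "scal 0 = 0" "scal 1 = 1" "scal (a + b) = scal a + scal b" "scal (a * b) = scal a * scal b"
  by (rule ent_eqI; simp add: ent_scal ent_one ent_scal_times)+

lemma shift_scal: "shift (scal c) = scal c"
  by (rule shift_scalar) (rule scal_loc)

lemma scal_com_complex: "x * scal c = scal c * (x :: (nat \<Rightarrow> 'v::finite, complex) rfmat)"
  by (rule ent_eqI) (simp add: ent_scal_times ent_times_scal)

lemma ent_sum: "ent (sum h A) i j = (\<Sum>a\<in>A. ent (h a) i j)"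
  by (induction A rule: infinite_finite_induct) simp_all

lemma shift_zero: "shift 0 = 0"
  by (rule ent_eqI) (simp add: ent_shift)

lemma shiftn_simps:
  "(shift ^^ k) (x * y) = (shift ^^ k) x * (shift ^^ k) y" "(shift ^^ k) 1 = 1"
  "(shift ^^ k) (x + y) = (shift ^^ k) x + (shift ^^ k) y" "(shift ^^ k) (scal c) = scal c"
  "(shift ^^ k) 0 = 0" "(shift ^^ k) (site2 m T) = site2 (m + k) T"
  by (induction k) (simp_all add: shift_mult shift_one shift_add shift_scal shift_zero shift_site2)

lemma shiftn_sum: "(shift ^^ k) (sum h A) = (\<Sum>a\<in>A. (shift ^^ k) (h a))"
  by (induction A rule: infinite_finite_induct) (simp_all add: shiftn_simps)

lemma shiftn_emb: "(shift ^^ k) (emb x) = emb ((shift ^^ k) x)"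
  by (induction k) (simp_all add: emb_shift)

lemma emb_scal: "emb (scal c) = scal (fconst c)"
  by (rule ent_eqI) (simp add: ent_emb ent_scal fconst_simps)

context
  fixes R :: "complex ^ ('v::finite \<times> 'v) ^ ('v \<times> 'v)"
begin

definition letter_op :: "nat \<times> bool \<Rightarrow> (nat \<Rightarrow> 'v, complex) rfmat" where
  "letter_op l = site2 (fst l) (if snd l then R else matrix_inv R)"

definition word_op :: "bword \<Rightarrow> (nat \<Rightarrow> 'v, complex) rfmat" where
  "word_op w = prod_list (map letter_op w)"

definition rep_op :: "galg \<Rightarrow> (nat \<Rightarrow> 'v, complex) rfmat" where
  "rep_op \<alpha> = (\<Sum>a\<in>Poly_Mapping.keys \<alpha>. scal (Poly_Mapping.lookup \<alpha> a) * word_op (SOME w. w \<in> a))"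

lemma word_op_simps:
  "word_op [] = 1" "word_op (l # w) = letter_op l * word_op w" "word_op (u @ v) = word_op u * word_op v"
  by (simp_all add: word_op_def)

lemma word_op_shift: "word_op (shift_word k w) = (shift ^^ k) (word_op w)"
  by (induction w) (auto simp: word_op_simps shiftn_simps letter_op_def)

lemma oper_rho_word:
  assumes "w \<in> bwords n"
  shows "oper {1..n} (rho_word n R w) = word_op w"
  using assms
proof (induction w)
  case Nil
  then show ?case by (simp add: rho_word_def word_op_simps oper_one)
next
  case (Cons l w)
  then have w: "w \<in> bwords n" and l: "fst l \<in> {1..<n}" by (auto simp: bwords_def)
  have "oper {1..n} (rho_letter n R l) = letter_op l"
    unfolding rho_letter_def letter_op_def using l oper_act2[of "{1..n}" "fst l"] by auto
  then show ?case using Cons.IH[OF w] by (simp add: rho_word_def word_op_simps oper_mult)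
qed

context
  assumes R: "R_matrix R"
begin

lemma word_op_braid_eq: "braid_eq n u v \<Longrightarrow> word_op u = word_op v"
proof (induction rule: braid_eq.induct)
  case (cancel i e)
  show ?case using site2_inverse[OF R] by (cases e) (auto simp: word_op_simps letter_op_def)
next
  case (braid i)
  show ?case using R_matrix_braid[OF R, of i] by (simp add: word_op_simps letter_op_def)
next
  case (far i j)
  have "site2 i R * site2 j R = site2 j R * site2 i R"
    by (rule com[OF cst_complex site2_loc site2_loc]) (use far in auto)
  then show ?case by (simp add: word_op_simps letter_op_def)
qed (auto simp: word_op_simps)

text \<open>\<open>rho\<close> reads a braid through a word chosen by \<open>SOME\<close>; by
  \<open>word_op_braid_eq\<close> every representative gives the same operator.\<close>

lemma word_op_some:
  assumes "w \<in> bwords n"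
  shows "word_op (SOME v. v \<in> braid_class n w) = word_op w"
proof -
  have "w \<in> braid_class n w" using assms by (auto simp: mem_braid_class intro: braid_eq.refl)
  then have "(SOME v. v \<in> braid_class n w) \<in> braid_class n w" by (rule someI)
  then show ?thesis using word_op_braid_eq by (simp add: mem_braid_class)
qed

lemma oper_rho:
  assumes "\<alpha> \<in> braid_algebra n"
  shows "oper {1..n} (rho n R \<alpha>) = rep_op \<alpha>"
proof (rule ent_eqI)
  fix i j :: "nat \<Rightarrow> 'v"
  have w: "oper {1..n} (rho_word n R (SOME w. w \<in> a)) = word_op (SOME w. w \<in> a)"
    if "a \<in> Poly_Mapping.keys \<alpha>" for a
  proof -
    have "a \<in> carrier (braid_group n)" using assms that by (auto simp: braid_algebra_def)
    then obtain w where "w \<in> bwords n" "a = braid_class n w" by (auto simp: carrier_braid_group)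
    then have "w \<in> a" by (auto simp: mem_braid_class intro: braid_eq.refl)
    then have "(SOME w. w \<in> a) \<in> a" by (rule someI)
    then have "(SOME w. w \<in> a) \<in> bwords n"
      using \<open>a = braid_class n w\<close> by (auto simp: mem_braid_class dest: braid_eq_bwords)
    then show ?thesis by (rule oper_rho_word)
  qed
  have "ent (rep_op \<alpha>) i j =
      (\<Sum>a\<in>Poly_Mapping.keys \<alpha>. Poly_Mapping.lookup \<alpha> a * ent (oper {1..n} (rho_word n R (SOME w. w \<in> a))) i j)"
    unfolding rep_op_def ent_sum ent_scal_times by (intro sum.cong HOL.refl) (simp only: w)
  then show "ent (oper {1..n} (rho n R \<alpha>)) i j = ent (rep_op \<alpha>) i j"
    by (simp add: ent_oper rho_def)
qed

text \<open>Sums over a common index set allow elements to be added whose coefficients may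
  cancel.\<close>

lemma rep_op_superset:
  assumes "finite K" "Poly_Mapping.keys \<alpha> \<subseteq> K"
  shows "rep_op \<alpha> = (\<Sum>a\<in>K. scal (Poly_Mapping.lookup \<alpha> a) * word_op (SOME w. w \<in> a))"
  unfolding rep_op_def using assms
  by (intro sum.mono_neutral_left) (auto simp: in_keys_iff scal_simps)

lemma rep_op_add: "rep_op (\<alpha> + \<beta>) = rep_op \<alpha> + rep_op \<beta>"
proof -
  let ?K = "Poly_Mapping.keys \<alpha> \<union> Poly_Mapping.keys \<beta>"
  have "Poly_Mapping.keys (\<alpha> + \<beta>) \<subseteq> ?K" by (rule Poly_Mapping.keys_add)
  then show ?thesis
    using rep_op_superset[of ?K \<alpha>] rep_op_superset[of ?K \<beta>] rep_op_superset[of ?K "\<alpha> + \<beta>"]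
    by (simp add: lookup_add scal_simps distrib_right sum.distrib)
qed

lemma rep_op_sum: "rep_op (sum h A) = (\<Sum>a\<in>A. rep_op (h a))"
proof (induction A rule: infinite_finite_induct)
  case empty
  show ?case by (simp add: rep_op_def)
next
  case (infinite A)
  then show ?case by (simp add: rep_op_def)
qed (simp add: rep_op_add)

lemma rep_op_single: "rep_op (Poly_Mapping.single a x) = scal x * word_op (SOME w. w \<in> a)"
  using rep_op_superset[of "{a}" "Poly_Mapping.single a x"] by simp

lemma rep_op_class: "w \<in> bwords n \<Longrightarrow> rep_op (Poly_Mapping.single (braid_class n w) x) = scal x * word_op w"
  by (simp add: rep_op_single word_op_some)

lemma rep_op_mult:
  assumes "\<alpha> \<in> braid_algebra n" "\<beta> \<in> braid_algebra n"
  shows "rep_op (galg_mult n \<alpha> \<beta>) = rep_op \<alpha> * rep_op \<beta>"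
proof -
  have w: "word_op (SOME w. w \<in> a \<otimes>\<^bsub>braid_group n\<^esub> b) = word_op (SOME w. w \<in> a) * word_op (SOME w. w \<in> b)"
    if ab: "a \<in> Poly_Mapping.keys \<alpha>" "b \<in> Poly_Mapping.keys \<beta>" for a b
  proof -
    have "a \<in> carrier (braid_group n)" "b \<in> carrier (braid_group n)"
      using assms ab by (auto simp: braid_algebra_def)
    then obtain u v where "u \<in> bwords n" "v \<in> bwords n" "a = braid_class n u" "b = braid_class n v"
      by (auto simp: carrier_braid_group)
    then show ?thesis by (simp add: braid_group_mult bwords_append word_op_some word_op_simps)
  qed
  have "rep_op (galg_mult n \<alpha> \<beta>) = (\<Sum>a\<in>Poly_Mapping.keys \<alpha>. \<Sum>b\<in>Poly_Mapping.keys \<beta>.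
      (scal (Poly_Mapping.lookup \<alpha> a) * word_op (SOME w. w \<in> a)) *
      (scal (Poly_Mapping.lookup \<beta> b) * word_op (SOME w. w \<in> b)))"
    unfolding galg_mult_def rep_op_sum rep_op_single
  proof (intro sum.cong HOL.refl)
    fix a b assume ab: "a \<in> Poly_Mapping.keys \<alpha>" "b \<in> Poly_Mapping.keys \<beta>"
    let ?x = "scal (Poly_Mapping.lookup \<alpha> a)" and ?y = "scal (Poly_Mapping.lookup \<beta> b)"
    let ?u = "word_op (SOME w. w \<in> a)" and ?v = "word_op (SOME w. w \<in> b)"
    have "?x * ?u * (?y * ?v) = ?x * ((?u * ?y) * ?v)" by (simp only: mult.assoc)
    also have "\<dots> = ?x * ?y * (?u * ?v)" by (simp only: scal_com_complex[of ?u] mult.assoc)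
    finally show "scal (Poly_Mapping.lookup \<alpha> a * Poly_Mapping.lookup \<beta> b) *
        word_op (SOME w. w \<in> a \<otimes>\<^bsub>braid_group n\<^esub> b) = ?x * ?u * (?y * ?v)"
      by (simp only: w[OF ab] scal_simps)
  qed
  also have "\<dots> = rep_op \<alpha> * rep_op \<beta>"
    by (simp only: rep_op_def sum_distrib_left sum_distrib_right) (rule sum.swap)
  finally show ?thesis .
qed

lemma rep_op_embed:
  assumes "\<alpha> \<in> braid_algebra n" "n + k \<le> m"
  shows "rep_op (galg_embed k m \<alpha>) = (shift ^^ k) (rep_op \<alpha>)"
proof -
  have w: "word_op (SOME w. w \<in> braid_embed k m a) = (shift ^^ k) (word_op (SOME w. w \<in> a))"
    if a: "a \<in> Poly_Mapping.keys \<alpha>" for a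
  proof -
    have "a \<in> carrier (braid_group n)" using assms a by (auto simp: braid_algebra_def)
    then obtain w where "w \<in> bwords n" "a = braid_class n w" by (auto simp: carrier_braid_group)
    then show ?thesis
      using assms(2) by (simp add: braid_embed_class word_op_some shift_word_bwords word_op_shift)
  qed
  show ?thesis
    unfolding galg_embed_def rep_op_sum rep_op_single
    unfolding rep_op_def shiftn_sum shiftn_simps by (intro sum.cong HOL.refl) (simp add: w)
qed

lemma rep_op_star:
  assumes "\<alpha> \<in> braid_algebra n" "\<beta> \<in> braid_algebra i" "1 \<le> n" "1 \<le> i"
  shows "galg_star n i \<alpha> \<beta> \<in> braid_algebra (n + i)"
    "rep_op (galg_star n i \<alpha> \<beta>) = rep_op \<alpha> * ((shift ^^ n) (rep_op \<beta>) * word_op (star_word n))"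
proof -
  have c: "galg_embed 0 (n + i) \<alpha> \<in> braid_algebra (n + i)" "galg_embed n (n + i) \<beta> \<in> braid_algebra (n + i)"
    "Poly_Mapping.single (braid_class (n + i) (star_word n)) 1 \<in> braid_algebra (n + i)"
    using assms by (auto intro: galg_embed_closed star_class_closed)
  then show "galg_star n i \<alpha> \<beta> \<in> braid_algebra (n + i)"
    by (auto simp: galg_star_def intro!: galg_mult_closed)
  have "rep_op (galg_embed 0 (n + i) \<alpha>) = rep_op \<alpha>" using rep_op_embed[OF assms(1), of 0 "n + i"] by simp
  moreover have "rep_op (galg_embed n (n + i) \<beta>) = (shift ^^ n) (rep_op \<beta>)"
    using rep_op_embed[OF assms(2), of n "n + i"] by simp
  ultimately show "rep_op (galg_star n i \<alpha> \<beta>) = rep_op \<alpha> * ((shift ^^ n) (rep_op \<beta>) * word_op (star_word n))"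
    using c by (simp add: galg_star_def rep_op_mult galg_mult_closed rep_op_class[OF star_word_bwords[OF assms(3,4)]]
        scal_simps mult.assoc)
qed

lemma rep_op_shift_product:
  assumes "\<alpha> \<in> braid_algebra n" "\<beta> \<in> braid_algebra i"
  shows "\<exists>\<gamma>\<in>braid_algebra (n + i). rep_op \<gamma> = rep_op \<alpha> * (shift ^^ n) (rep_op \<beta>)"
proof -
  have c: "galg_embed 0 (n + i) \<alpha> \<in> braid_algebra (n + i)" "galg_embed n (n + i) \<beta> \<in> braid_algebra (n + i)"
    using assms by (auto intro: galg_embed_closed)
  have "rep_op (galg_embed 0 (n + i) \<alpha>) = rep_op \<alpha>" using rep_op_embed[OF assms(1), of 0 "n + i"] by simp
  moreover have "rep_op (galg_embed n (n + i) \<beta>) = (shift ^^ n) (rep_op \<beta>)"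
    using rep_op_embed[OF assms(2), of n "n + i"] by simp
  ultimately show ?thesis using c galg_mult_closed[OF c] rep_op_mult[OF c] by metis
qed

end

end

subsection \<open>The defining ideal and the quotient\<close>

lemma ring_of_type_algebra_simps:
  "carrier ring_of_type_algebra = UNIV" "\<zero>\<^bsub>ring_of_type_algebra\<^esub> = 0" "\<one>\<^bsub>ring_of_type_algebra\<^esub> = 1"
  "x \<oplus>\<^bsub>ring_of_type_algebra\<^esub> y = x + y" "x \<otimes>\<^bsub>ring_of_type_algebra\<^esub> y = x * y"
  by (simp_all add: ring_of_type_algebra_def)

lemma ring_ring_of_type_algebra: "ring (ring_of_type_algebra :: 'a::ring_1 ring)"
proof (rule ringI)
  show "abelian_group (ring_of_type_algebra :: 'a ring)"
  proof (rule abelian_groupI)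
    fix x :: 'a
    have "- x + x = 0" by simp
    then show "\<exists>y\<in>carrier ring_of_type_algebra. y \<oplus>\<^bsub>ring_of_type_algebra\<^esub> x = \<zero>\<^bsub>ring_of_type_algebra\<^esub>"
      unfolding ring_of_type_algebra_simps by blast
  qed (simp_all add: ring_of_type_algebra_simps algebra_simps)
  show "monoid (ring_of_type_algebra :: 'a ring)"
    by (rule monoidI) (simp_all add: ring_of_type_algebra_simps mult.assoc)
qed (simp_all add: ring_of_type_algebra_simps algebra_simps)

lemma ideal_qma: "ideal (qma_ideal R F) ring_of_type_algebra"
  unfolding qma_ideal_def
  by (rule ring.genideal_ideal[OF ring_ring_of_type_algebra]) (simp add: ring_of_type_algebra_simps)

lemma qma_relations_ideal: "x \<in> qma_relations R F \<Longrightarrow> x \<in> qma_ideal R F"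
  unfolding qma_ideal_def
  using ring.genideal_self[OF ring_ring_of_type_algebra, of "qma_relations R F"]
  by (auto simp: ring_of_type_algebra_simps)

lemma qma_ideal_mult: "x \<in> qma_ideal R F \<Longrightarrow> y * x \<in> qma_ideal R F" "x \<in> qma_ideal R F \<Longrightarrow> x * y \<in> qma_ideal R F"
  using ideal.I_l_closed[OF ideal_qma, of x R F y] ideal.I_r_closed[OF ideal_qma, of x R F y]
  by (simp_all add: ring_of_type_algebra_simps)

lemma qma_ideal_add: "x \<in> qma_ideal R F \<Longrightarrow> y \<in> qma_ideal R F \<Longrightarrow> x + y \<in> qma_ideal R F"
  using additive_subgroup.a_closed[OF ideal.axioms(1)[OF ideal_qma], of x R F y]
  by (simp add: ring_of_type_algebra_simps)

lemma qma_ideal_zero: "0 \<in> qma_ideal R F"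
  using additive_subgroup.zero_closed[OF ideal.axioms(1)[OF ideal_qma], of R F]
  by (simp add: ring_of_type_algebra_simps)

lemma qma_ideal_minus: "x \<in> qma_ideal R F \<Longrightarrow> - x \<in> qma_ideal R F"
  using qma_ideal_mult(1)[of x R F "- 1"] by simp

lemma qma_ideal_sum: "(\<And>a. a \<in> A \<Longrightarrow> h a \<in> qma_ideal R F) \<Longrightarrow> sum h A \<in> qma_ideal R F"
  by (induction A rule: infinite_finite_induct) (auto intro: qma_ideal_zero qma_ideal_add)

lemma mem_qproj: "y \<in> qproj R F x \<longleftrightarrow> y - x \<in> qma_ideal R F"
proof -
  have "y \<in> qproj R F x \<longleftrightarrow> (\<exists>h\<in>qma_ideal R F. y = h + x)"
    by (auto simp: qproj_def a_r_coset_def' ring_of_type_algebra_simps)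
  then show ?thesis by (metis add_diff_cancel diff_add_cancel)
qed

lemma qproj_eq_iff: "qproj R F x = qproj R F y \<longleftrightarrow> x - y \<in> qma_ideal R F"
proof
  assume "qproj R F x = qproj R F y"
  then have "x \<in> qproj R F y" using mem_qproj[of x R F x] qma_ideal_zero by simp
  then show "x - y \<in> qma_ideal R F" by (simp add: mem_qproj)
next
  assume h: "x - y \<in> qma_ideal R F"
  show "qproj R F x = qproj R F y"
  proof (rule Set.set_eqI)
    fix z
    show "z \<in> qproj R F x \<longleftrightarrow> z \<in> qproj R F y"
      using qma_ideal_add[OF _ h, of "z - x"] qma_ideal_add[OF _ qma_ideal_minus[OF h], of "z - y"]
      by (auto simp: mem_qproj)
  qed
qed

subsection \<open>The operator model of the quantum matrix algebra\<close>

lemma emb_site1: "emb (site1 m Y) = site1 m (\<chi> a b. fconst (Y $ a $ b))"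
  by (rule ent_eqI) (simp add: ent_emb ent_site1 fconst_simps)

lemma emb_site2: "emb (site2 m T) = site2 m (\<chi> a b. fconst (T $ a $ b))"
  by (rule ent_eqI) (simp add: ent_emb ent_site2 fconst_simps)

lemma loc_upd:
  assumes "loc A x" "n \<notin> A" "i n = j n"
  shows "ent x (i(n := a)) (j(n := b)) = (if a = b then ent x i j else 0)"
proof (cases "a = b")
  case True
  show ?thesis
  proof (cases "agree (- A) i j")
    case T: True
    have "ent x (i(n := a)) (j(n := b)) = ent x i j"
      by (rule loc_ent[OF assms(1)])
        (use T True assms in \<open>auto simp: agree_def\<close>)
    then show ?thesis using True by simp
  next
    case False
    then have "\<not> agree (- A) (i(n := a)) (j(n := b))" using assms by (auto simp: agree_def split: if_splits)
    then show ?thesis using False locD[OF assms(1)] by simp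
  qed
next
  case False
  then have "\<not> agree (- A) (i(n := a)) (j(n := b))" using assms(2) by (auto simp: agree_def)
  then show ?thesis using False locD[OF assms(1)] by simp
qed

text \<open>Centrality would not do as the notion of a constant operator: for \<open>N = 1\<close> the free algebra is
  commutative.\<close>

type_synonym 'v qop = "(nat \<Rightarrow> 'v, ('v \<times> 'v) free_alg) rfmat"

definition konst :: "('i, 'g free_alg) rfmat \<Rightarrow> bool" where
  "konst x \<longleftrightarrow> x \<in> range emb"

lemma konst_emb: "konst (emb x)"
  by (simp add: konst_def)

lemma konst_cst: "konst x \<Longrightarrow> cst x"
  by (auto simp: konst_def emb_cst)

lemma konst_simps:
  "konst 1" "konst x \<Longrightarrow> konst y \<Longrightarrow> konst (x * y)" "konst x \<Longrightarrow> konst y \<Longrightarrow> konst (x + y)"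
  "konst z \<Longrightarrow> konst (shift z)"
  unfolding konst_def by (auto simp: emb_simps(2)[symmetric] emb_mult[symmetric] emb_simps(3)[symmetric] emb_shift)

definition gen_op :: "'v::finite qop" where
  "gen_op = site1 1 gen_mat"

definition op_ideal :: "'v::finite mat2 \<Rightarrow> 'v mat2 \<Rightarrow> 'v qop set" where
  "op_ideal R F = {x. \<forall>i j. ent x i j \<in> qma_ideal R F}"

definition rtr :: "'v::finite mat2 \<Rightarrow> nat \<Rightarrow> (nat \<Rightarrow> 'v, 'g free_alg) rfmat \<Rightarrow> (nat \<Rightarrow> 'v, 'g free_alg) rfmat" where
  "rtr R k x = ptr {k} (emb (site1 k (D_mat R)) * x)"

definition rep_set :: "'v::finite mat2 \<Rightarrow> nat \<Rightarrow> (nat \<Rightarrow> 'v, 'g free_alg) rfmat set" where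
  "rep_set R n = (\<lambda>\<alpha>. emb (rep_op R \<alpha>)) ` braid_algebra n"

text \<open>Cyclicity of the ordinary trace brings D to the right of F^(-1), so that
  \<open>F_inv_D_entries\<close> can be summed against the entries of \<open>x\<close>. These need
  not commute with each other, but the entries of F and D are scalars and can be collected on one
  side.\<close>

lemma rtr_conj:
  fixes x :: "(nat \<Rightarrow> 'v::finite, 'g free_alg) rfmat"
  assumes R: "R_matrix R" "skew_invertible R" and F: "R_matrix F" and RF: "compatible_pair R F"
    and x: "loc A x" "Suc k \<notin> A"
  shows "rtr R (Suc k) (emb (site2 k F) * (x * emb (site2 k (matrix_inv F)))) = rtr R k x"
proof (rule ent_eqI)
  fix i j :: "nat \<Rightarrow> 'v"
  let ?D = "D_mat R" and ?Q = "inv_D R F" and ?k = "Suc k"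
  have "rtr R ?k (emb (site2 k F) * (x * emb (site2 k (matrix_inv F)))) =
      ptr {?k} (emb (site2 k F) * (x * emb (site2 k (matrix_inv F))) * emb (site1 ?k ?D))"
    unfolding rtr_def by (rule ptr_cyc) (simp_all add: emb_loc site1_loc emb_cst)
  also have "\<dots> = ptr {?k} (emb (site2 k F) * (x * emb (site2 k ?Q)))"
    by (simp only: site2_inv_D[OF R] emb_mult mult.assoc)
  finally have l: "rtr R ?k (emb (site2 k F) * (x * emb (site2 k (matrix_inv F)))) =
      ptr {?k} (emb (site2 k F) * (x * emb (site2 k ?Q)))" .
  \<comment> \<open>The part of \<open>x\<close> that matters: a matrix in factor \<open>k\<close>,
    all other coordinates being fixed by \<open>i\<close> and \<open>j\<close>.\<close>
  define xx where "xx e e' = ent x (i(k := e)) (j(k := e'))" for e e'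
  have r: "ent (rtr R k x) i j =
      (if i k = j k then \<Sum>a\<in>UNIV. \<Sum>b\<in>UNIV. fconst (?D $ a $ b) * xx b a else 0)"
    by (simp add: rtr_def ent_ptr1 emb_site1 ent_site1_times xx_def)
  show "ent (rtr R ?k (emb (site2 k F) * (x * emb (site2 k (matrix_inv F))))) i j = ent (rtr R k x) i j"
  proof (cases "i ?k = j ?k")
    case True
    have u: "i(?k := t, k := e, ?k := g) = i(k := e, ?k := g)" for i :: "nat \<Rightarrow> 'v" and t e g
      by auto
    have xx: "ent x (i(k := e, ?k := g)) (j(k := e', ?k := g')) = (if g = g' then xx e e' else 0)" for e g e' g'
      unfolding xx_def by (rule loc_upd[OF x]) (use True in simp)
    have "ent (emb (site2 k F) * (x * emb (site2 k ?Q))) (i(?k := t)) (j(?k := t)) =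
        (\<Sum>e\<in>UNIV. \<Sum>g\<in>UNIV. fconst (F $ (i k, t) $ (e, g)) * (\<Sum>e'\<in>UNIV. xx e e' * fconst (?Q $ (e', g) $ (j k, t))))" for t
      by (simp add: emb_site2 ent_site2_times ent_times_site2 u xx mult_if_zero)
    then have "ent (ptr {?k} (emb (site2 k F) * (x * emb (site2 k ?Q)))) i j =
        (\<Sum>t\<in>UNIV. \<Sum>e\<in>UNIV. \<Sum>g\<in>UNIV. \<Sum>e'\<in>UNIV. fconst (F $ (i k, t) $ (e, g)) * (xx e e' * fconst (?Q $ (e', g) $ (j k, t))))"
      using True by (simp add: ent_ptr1 sum_distrib_left)
    also have "\<dots> = (\<Sum>e\<in>UNIV. \<Sum>t\<in>UNIV. \<Sum>g\<in>UNIV. \<Sum>e'\<in>UNIV. xx e e' * fconst (F $ (i k, t) $ (e, g) * ?Q $ (e', g) $ (j k, t)))"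
    proof -
      have "fconst a * (y * fconst b) = y * fconst (a * b)" for a b and y :: "'g free_alg"
        using fconst_com[of a "y * fconst b"] by (simp add: fconst_simps mult.assoc fconst_com[of b])
      then show ?thesis by (subst sum.swap) simp
    qed
    also have "\<dots> = (\<Sum>e\<in>UNIV. \<Sum>e'\<in>UNIV. \<Sum>t\<in>UNIV. \<Sum>g\<in>UNIV. xx e e' * fconst (F $ (i k, t) $ (e, g) * ?Q $ (e', g) $ (j k, t)))"
      by (rule sum.cong[OF HOL.refl]) (rule sum_swap3)
    also have "\<dots> = (\<Sum>e\<in>UNIV. \<Sum>e'\<in>UNIV. xx e e' * fconst (if i k = j k then ?D $ e' $ e else 0))"
      unfolding sum_distrib_left[symmetric] fconst_sum[symmetric]
        F_inv_D_entries[OF R F compatible_pair_relations(2)[OF RF]] ..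
    also have "\<dots> = ent (rtr R k x) i j"
      unfolding r by (simp add: fconst_simps fconst_com) (rule impI, rule sum.swap)
    finally show ?thesis unfolding l .
  next
    case False
    have "xx b a = 0" for a b
    proof -
      have "\<not> agree (- A) (i(k := b)) (j(k := a))" using False x(2) by (auto simp: agree_def intro!: bexI[of _ "Suc k"])
      then show ?thesis unfolding xx_def by (rule locD[OF x(1)])
    qed
    then show ?thesis unfolding l r using False by (simp add: ent_ptr1)
  qed
qed

lemma oper_Mbar:
  assumes "k < n"
  shows "oper {1..n} (Mbar F {1..n} (Suc k)) =
    rec_nat (site1 1 gen_mat) (\<lambda>j y. emb (site2 (Suc j) F) * (y * emb (site2 (Suc j) (matrix_inv F)))) k"
  using assms
proof (induction k)
  case 0
  then show ?case using oper_act1[of "{1..n}" 1 gen_mat] by simp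
next
  case (Suc k)
  have "oper {1..n} (act2 {1..n} (Suc k) (Suc (Suc k)) T) = site2 (Suc k) T" for T :: "'a mat2"
    using oper_act2[of "{1..n}" "Suc k"] Suc.prems by simp
  then show ?case using Suc by (simp add: oper_mult oper_op_const)
qed

locale strict_pair =
  fixes R F :: "complex ^ ('v::finite \<times> 'v) ^ ('v \<times> 'v)"
  assumes R: "R_matrix R" "skew_invertible R" and F: "R_matrix F" and RF: "compatible_pair R F"
begin

sublocale local_operators loc konst "rtr R" "shift :: 'v qop \<Rightarrow> _"
proof
  fix A and x y a :: "'v qop" and k
  let ?D = "emb (site1 k (D_mat R)) :: 'v qop"
  have D: "loc {k} ?D" "cst ?D" by (simp_all add: emb_loc site1_loc emb_cst)
  show "rtr R k (x + y) = rtr R k x + rtr R k y"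
    by (simp add: rtr_def distrib_left ptr_add)
  { assume "loc A x"
    then have "loc (insert k A) (?D * x)" using loc_mono D(1) by (intro loc_mult) blast+
    then have "loc (insert k A - {k}) (rtr R k x)" unfolding rtr_def by (intro ptr_loc) simp_all
    then show "loc (A - {k}) (rtr R k x)" by simp }
  { assume a: "loc A a" "k \<notin> A" "finite A"
    have "?D * a = a * ?D" using D a by (intro com) auto
    then have "?D * (a * x) = a * (?D * x)" by (rule assoc_eq)
    then show "rtr R k (a * x) = a * rtr R k x"
      using ptr_left[of "{k}" A a] a by (simp add: rtr_def)
    show "rtr R k (x * a) = rtr R k x * a"
      using ptr_right[of "{k}" A a "?D * x"] a by (simp add: rtr_def mult.assoc) }
qed (auto intro: loc_UNIV loc_one loc_mult loc_add konst_simps com[OF konst_cst] shift_loc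
    shift_scalar simp: shift_one shift_mult shift_add elim: loc_mono)

text \<open>Cyclicity is where \<open>D_D_R\<close> enters: two R-traces are one ordinary trace over
  the factors \<open>k\<close>, \<open>k + 1\<close> with D_k D_(k+1) inserted. R moves past this
  product, and the ordinary trace is cyclic for constant operators on the traced factors.\<close>

sublocale braided_operators loc konst "rtr R" "shift :: 'v qop \<Rightarrow> _"
  "\<lambda>k. emb (site2 k R)" "\<lambda>k. emb (site2 k (matrix_inv R))"
proof
  fix k and x :: "'v qop"
  show "rtr R (Suc k) (emb (site2 k R)) = (1 :: 'v qop)"
    using ptr_D_R[OF R, of k] by (simp add: rtr_def emb_mult[symmetric] emb_ptr emb_simps)
  let ?d = "\<lambda>k. emb (site1 k (D_mat R)) :: 'v qop"
  let ?r = "emb (site2 k R) :: 'v qop"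
  have t: "rtr R k (rtr R (Suc k) y) = ptr {k, Suc k} (?d k * ?d (Suc k) * y)" for y
  proof -
    have "?d k * ptr {Suc k} (?d (Suc k) * y) = ptr {Suc k} (?d k * (?d (Suc k) * y))"
      by (rule ptr_left[symmetric, of _ "{k}"]) (auto simp: emb_loc site1_loc)
    then show ?thesis by (simp add: rtr_def ptr_union mult.assoc insert_is_Un[of k "{Suc k}"])
  qed
  have d: "?d k * ?d (Suc k) * ?r = ?r * (?d k * ?d (Suc k))"
    using D_D_R[OF R, of k] by (simp only: emb_mult[symmetric])
  have "ptr {k, Suc k} (?d k * ?d (Suc k) * (?r * x)) = ptr {k, Suc k} (?r * (?d k * ?d (Suc k) * x))"
    using d by (simp only: mult.assoc[symmetric])
  also have "\<dots> = ptr {k, Suc k} (?d k * ?d (Suc k) * x * ?r)"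
    using site2_loc[of k R] by (intro ptr_cyc) (auto intro: emb_loc emb_cst)
  finally show "rtr R k (rtr R (Suc k) (?r * x)) = rtr R k (rtr R (Suc k) (x * ?r))"
    unfolding t by (simp only: mult.assoc)
qed (simp_all add: emb_mult[symmetric] site2_inverse[OF R(1)] emb_simps emb_loc site2_loc[simplified] konst_emb
    R_matrix_braid[OF R(1)] emb_shift shift_site2)

sublocale quantum_matrix_operators loc konst "rtr R" "shift :: 'v qop \<Rightarrow> _"
  "\<lambda>k. emb (site2 k R)" "\<lambda>k. emb (site2 k (matrix_inv R))"
  "\<lambda>k. emb (site2 k F)" "\<lambda>k. emb (site2 k (matrix_inv F))" gen_op "op_ideal R F"
proof
  fix k and A and x y :: "'v qop"
  show "loc A x \<Longrightarrow> Suc k \<notin> A \<Longrightarrow>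
      rtr R (Suc k) (emb (site2 k F) * (x * emb (site2 k (matrix_inv F)))) = rtr R k x"
    by (rule rtr_conj[OF R F RF])
  show "loc {1} (gen_op :: 'v qop)" unfolding gen_op_def by (rule site1_loc)
  show "0 \<in> op_ideal R F" by (simp add: op_ideal_def qma_ideal_zero)
  show "x \<in> op_ideal R F \<Longrightarrow> y \<in> op_ideal R F \<Longrightarrow> x + y \<in> op_ideal R F"
    by (simp add: op_ideal_def qma_ideal_add)
  have e: "ent (x * y) i j = (\<Sum>k | ent x i k \<noteq> 0. ent x i k * ent y k j)"
    for x y :: "'v qop" and i j
    by (rule ent_times) (auto simp: finite_row)
  show l: "x \<in> op_ideal R F \<Longrightarrow> y * x \<in> op_ideal R F" for x y
    unfolding op_ideal_def by (auto simp: e intro!: qma_ideal_sum qma_ideal_mult(1))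
  show "x \<in> op_ideal R F \<Longrightarrow> x * y \<in> op_ideal R F"
    unfolding op_ideal_def by (auto simp: e intro!: qma_ideal_sum qma_ideal_mult(2))
  show "x \<in> op_ideal R F \<Longrightarrow> rtr R k x \<in> op_ideal R F"
    using l[of x "emb (site1 k (D_mat R))"]
    by (auto simp: rtr_def op_ideal_def ent_ptr1 qma_ideal_zero intro!: qma_ideal_sum)
  let ?r = "emb (site2 1 R) :: 'v qop"
  let ?mm = "gen_op * (emb (site2 1 F) * (gen_op * emb (site2 1 (matrix_inv F))))"
  let ?MM = "Mbar_prod F 2" and ?R1 = "op_const (act2 {1..2} 1 2 R)"
  have MM: "oper {1..2} ?MM = ?mm"
  proof -
    have up: "[1..<2 + 1] = [1, Suc 1]" by (simp add: upt_rec)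
    have "oper {1..2} (Mbar F {1..2} 1) = gen_op"
      "oper {1..2} (Mbar F {1..2} (Suc 1)) = emb (site2 1 F) * (gen_op * emb (site2 1 (matrix_inv F)))"
      using oper_Mbar[of 0 2 F] oper_Mbar[of 1 2 F] by (simp_all add: gen_op_def del: Mbar.simps)
    then show ?thesis unfolding Mbar_prod_def up by (simp add: oper_mult oper_one del: Mbar.simps)
  qed
  have R1: "oper {1..2} ?R1 = ?r"
    using oper_act2[of "{1..2}" 1 R] by (simp add: oper_op_const numeral_2_eq_2)
  \<comment> \<open>On \<open>idx {1..2}\<close> the entries of this difference are by definition
    the generators of the ideal; all its other entries repeat these or vanish.\<close>
  have "?r * ?mm - ?mm * ?r = oper {1..2} (op_mult {1..2} ?R1 ?MM) - oper {1..2} (op_mult {1..2} ?MM ?R1)"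
    by (simp only: oper_mult finite_atLeastAtMost MM R1)
  moreover have "\<dots> \<in> op_ideal R F"
  proof -
    have "op_mult {1..2} ?R1 ?MM i j - op_mult {1..2} ?MM ?R1 i j \<in> qma_ideal R F"
      if "i \<in> idx {1..2}" "j \<in> idx {1..2}" for i j
      by (rule qma_relations_ideal) (use that in \<open>auto simp: qma_relations_def Let_def\<close>)
    then show ?thesis
      unfolding op_ideal_def by (simp add: ent_oper restrict_idx qma_ideal_zero del: One_nat_def)
  qed
  ultimately show "?r * ?mm - ?mm * ?r \<in> op_ideal R F" by simp
qed (simp_all add: emb_mult[symmetric] site2_inverse[OF F] emb_simps emb_loc site2_loc[simplified] konst_emb
    R_matrix_braid[OF F] compatible_pair_relations[OF RF])

lemma s_word: "s n = emb (word_op R (star_word (Suc n)))"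
proof (induction n)
  case 0
  show ?case by (simp add: star_word_def word_op_simps letter_op_def)
next
  case (Suc n)
  then show ?case by (simp add: star_word_Suc word_op_simps letter_op_def emb_mult)
qed

lemma word_op_gen: "w \<in> bwords n \<Longrightarrow> emb (word_op R w) \<in> gen 1 n"
proof (induction w)
  case Nil
  show ?case by (simp add: word_op_simps emb_simps gen_one)
next
  case (Cons l w)
  then have "w \<in> bwords n" "1 \<le> fst l" "fst l < n" by (auto simp: bwords_def)
  then show ?case using Cons.IH
    by (auto simp: word_op_simps letter_op_def emb_mult intro!: gen.mult gen.pos[simplified] gen.neg[simplified])
qed

lemma scal_scalars: "scal (fconst z) \<in> scalars"
  using konst_emb[of "scal z"] by (simp add: scalars_def scal_loc emb_scal)

lemma emb_sum: "emb (sum h A) = (\<Sum>a\<in>A. emb (h a))"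
  by (induction A rule: infinite_finite_induct) (simp_all add: emb_simps)

lemma gen_sum: "(\<And>a. a \<in> A \<Longrightarrow> h a \<in> gen p q) \<Longrightarrow> sum h A \<in> gen p q"
proof (induction A rule: infinite_finite_induct)
  case (insert x A)
  then show ?case by (simp add: gen.add)
qed (use gen.scalar[OF scal_scalars[of 0]] in \<open>auto simp: fconst_simps scal_simps\<close>)

lemma rep_set_gen: "a \<in> rep_set R n \<Longrightarrow> a \<in> gen 1 n"
proof -
  assume "a \<in> rep_set R n"
  then obtain \<alpha> where \<alpha>: "\<alpha> \<in> braid_algebra n" "a = emb (rep_op R \<alpha>)" by (auto simp: rep_set_def)
  have "emb (scal c * word_op R (SOME w. w \<in> b)) \<in> gen 1 n" if b: "b \<in> Poly_Mapping.keys \<alpha>" for b c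
  proof -
    have "b \<in> carrier (braid_group n)" using \<alpha> b by (auto simp: braid_algebra_def)
    then obtain w where "w \<in> bwords n" "b = braid_class n w" by (auto simp: carrier_braid_group)
    then show ?thesis
      by (simp add: word_op_some[OF R(1)] emb_mult emb_scal del: One_nat_def)
        (intro gen.mult gen.scalar scal_scalars word_op_gen)
  qed
  then show ?thesis unfolding \<alpha>(2) rep_op_def emb_sum by (intro gen_sum) blast
qed

sublocale star_operators loc konst "rtr R" "shift :: 'v qop \<Rightarrow> _"
  "\<lambda>k. emb (site2 k R)" "\<lambda>k. emb (site2 k (matrix_inv R))"
  "\<lambda>k. emb (site2 k F)" "\<lambda>k. emb (site2 k (matrix_inv F))" gen_op "op_ideal R F" "rep_set R"
proof
  show "a \<in> rep_set R n \<Longrightarrow> a \<in> gen 1 n" for a n by (rule rep_set_gen)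
  show "a * (shift ^^ n) b \<in> rep_set R (n + i)" if "a \<in> rep_set R n" "b \<in> rep_set R i"
    for n i and a b :: "'v qop"
  proof -
    obtain \<alpha> \<beta> where *: "\<alpha> \<in> braid_algebra n" "a = emb (rep_op R \<alpha>)" "\<beta> \<in> braid_algebra i" "b = emb (rep_op R \<beta>)"
      using \<open>a \<in> rep_set R n\<close> \<open>b \<in> rep_set R i\<close> by (auto simp: rep_set_def)
    from rep_op_shift_product[OF R(1) *(1,3)] obtain \<gamma> where
      "\<gamma> \<in> braid_algebra (n + i)" "rep_op R \<gamma> = rep_op R \<alpha> * (shift ^^ n) (rep_op R \<beta>)" by blast
    then show ?thesis
      by (auto simp: rep_set_def * shiftn_emb emb_mult[symmetric] intro!: image_eqI[of _ _ \<gamma>])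
  qed
  show "stp p a b \<in> rep_set R (Suc (Suc p + q))" if "a \<in> rep_set R (Suc p)" "b \<in> rep_set R (Suc q)"
    for p q and a b :: "'v qop"
  proof -
    obtain \<alpha> \<beta> where *: "\<alpha> \<in> braid_algebra (Suc p)" "a = emb (rep_op R \<alpha>)"
      "\<beta> \<in> braid_algebra (Suc q)" "b = emb (rep_op R \<beta>)"
      using \<open>a \<in> rep_set R (Suc p)\<close> \<open>b \<in> rep_set R (Suc q)\<close> by (auto simp: rep_set_def)
    from rep_op_star[OF R(1) *(1,3)] show ?thesis
      by (auto simp: rep_set_def stp_def s_word * shiftn_emb emb_mult[symmetric] simp del: funpow.simps
          intro!: image_eqI[of _ _ "galg_star (Suc p) (Suc q) \<alpha> \<beta>"])
  qed
qed

end

subsection \<open>Modules and algebras presented as images\<close>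

text \<open>The structure of \<open>B\<close> is carried over from \<open>S\<close> along a map
  \<open>h\<close> that need not be injective. This covers the quantum matrix algebra, the matrices
  over it, and the two algebras of the theorem.\<close>

locale module_image =
  fixes sc :: "complex \<Rightarrow> 'o::ring_1" and h :: "'o \<Rightarrow> 'b" and S :: "'o set" and B :: "(complex, 'b) module"
  assumes sc: "sc 1 = 1" "sc (a + b) = sc a + sc b" "sc (a * b) = sc a * sc b"
    and S: "0 \<in> S" "x \<in> S \<Longrightarrow> y \<in> S \<Longrightarrow> x + y \<in> S" "x \<in> S \<Longrightarrow> sc c * x \<in> S"
    and B: "carrier B = h ` S" "\<zero>\<^bsub>B\<^esub> = h 0" "x \<in> S \<Longrightarrow> y \<in> S \<Longrightarrow> h x \<oplus>\<^bsub>B\<^esub> h y = h (x + y)"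
      "x \<in> S \<Longrightarrow> c \<odot>\<^bsub>B\<^esub> h x = h (sc c * x)"
begin

lemma sc_minus: "sc (- 1) * x = - x"
proof -
  have "sc 0 = 0" using sc(2)[of 0 0] by simp
  then have "sc (- 1) + 1 = 0" using sc(2)[of "- 1" 1] sc(1) by simp
  then have "sc (- 1) = - 1" by (simp add: add_eq_0_iff2)
  then show ?thesis by simp
qed

lemma cring_cplx: "cring cplx"
proof (rule cringI)
  show "comm_monoid cplx"
    by (rule comm_monoidI) (auto simp: ring_of_type_algebra_simps)
  show "abelian_group cplx" by (rule ring.is_abelian_group[OF ring_ring_of_type_algebra])
qed (simp_all add: ring_of_type_algebra_simps algebra_simps)

lemma module_B: "Module.module cplx B"
proof (rule moduleI[OF cring_cplx])
  show "abelian_group B"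
  proof (rule abelian_groupI)
    fix x assume "x \<in> carrier B"
    then obtain u where u: "u \<in> S" "x = h u" by (auto simp: B)
    have "sc (- 1) * u \<in> S" using u S by blast
    moreover from this have "h (sc (- 1) * u) \<oplus>\<^bsub>B\<^esub> x = \<zero>\<^bsub>B\<^esub>"
      using u by (simp add: B) (simp add: sc_minus)
    ultimately show "\<exists>y\<in>carrier B. y \<oplus>\<^bsub>B\<^esub> x = \<zero>\<^bsub>B\<^esub>" by (auto simp: B(1))
  qed (auto simp: B S ac_simps)
qed (auto simp: B S sc ring_of_type_algebra_simps algebra_simps)

lemma uminus_B: "x \<in> S \<Longrightarrow> \<ominus>\<^bsub>B\<^esub> h x = h (- x)"
proof -
  assume x: "x \<in> S"
  then have m: "- x \<in> S" using S(3)[of x "- 1"] by (simp add: sc_minus)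
  interpret M: Module.module cplx B by (rule module_B)
  show ?thesis
    by (rule M.minus_equality) (use x m in \<open>auto simp: B\<close>)
qed

lemma submodule_image:
  assumes "T \<subseteq> S" "0 \<in> T" "\<And>x y. x \<in> T \<Longrightarrow> y \<in> T \<Longrightarrow> x + y \<in> T" "\<And>c x. x \<in> T \<Longrightarrow> sc c * x \<in> T"
  shows "submodule (h ` T) cplx B"
proof (rule module.submoduleI[OF module_B])
  show "h ` T \<subseteq> carrier B" using assms by (auto simp: B)
  show "\<zero>\<^bsub>B\<^esub> \<in> h ` T" using assms by (auto simp: B)
next
  fix a assume "a \<in> h ` T"
  then obtain x where x: "x \<in> T" "a = h x" by blast
  have "- x \<in> T" using assms(4)[OF x(1), of "- 1"] by (simp add: sc_minus)
  moreover have "x \<in> S" using x assms(1) by blast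
  ultimately show "\<ominus>\<^bsub>B\<^esub> a \<in> h ` T" by (simp add: x uminus_B)
qed (use assms in \<open>auto simp: B subset_iff\<close>)

lemma lin_span_image:
  assumes "T \<subseteq> S" "0 \<in> T" "\<And>x y. x \<in> T \<Longrightarrow> y \<in> T \<Longrightarrow> x + y \<in> T" "\<And>c x. x \<in> T \<Longrightarrow> sc c * x \<in> T"
    and "E \<subseteq> h ` T" and "\<And>H. submodule H cplx B \<Longrightarrow> E \<subseteq> H \<Longrightarrow> h ` T \<subseteq> H"
  shows "lin_span B E = h ` T"
proof
  show "lin_span B E \<subseteq> h ` T"
    unfolding lin_span_def using submodule_image[OF assms(1-4)] assms(5) by blast
  show "h ` T \<subseteq> lin_span B E"
    unfolding lin_span_def using assms(6) by blast
qed

lemma submodule_h: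
  assumes "submodule H cplx B"
  shows "x \<in> S \<Longrightarrow> y \<in> S \<Longrightarrow> h x \<in> H \<Longrightarrow> h y \<in> H \<Longrightarrow> h (x + y) \<in> H"
    and "x \<in> S \<Longrightarrow> h x \<in> H \<Longrightarrow> h (sc c * x) \<in> H"
  using module.submoduleE(5)[OF module_B assms, of "h x" "h y"] submodule.smult_closed[OF assms, of c "h x"]
  by (simp_all add: B ring_of_type_algebra_simps)

end

lemma complex_algebraI:
  assumes "Module.module cplx B"
    and "\<one>\<^bsub>B\<^esub> \<in> carrier B"
    and "\<And>x y. x \<in> carrier B \<Longrightarrow> y \<in> carrier B \<Longrightarrow> x \<otimes>\<^bsub>B\<^esub> y \<in> carrier B"
    and "\<And>x y z. x \<in> carrier B \<Longrightarrow> y \<in> carrier B \<Longrightarrow> z \<in> carrier B \<Longrightarrow> x \<otimes>\<^bsub>B\<^esub> y \<otimes>\<^bsub>B\<^esub> z = x \<otimes>\<^bsub>B\<^esub> (y \<otimes>\<^bsub>B\<^esub> z)"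
    and "\<And>x. x \<in> carrier B \<Longrightarrow> \<one>\<^bsub>B\<^esub> \<otimes>\<^bsub>B\<^esub> x = x" "\<And>x. x \<in> carrier B \<Longrightarrow> x \<otimes>\<^bsub>B\<^esub> \<one>\<^bsub>B\<^esub> = x"
    and "\<And>x y z. x \<in> carrier B \<Longrightarrow> y \<in> carrier B \<Longrightarrow> z \<in> carrier B \<Longrightarrow>
      (x \<oplus>\<^bsub>B\<^esub> y) \<otimes>\<^bsub>B\<^esub> z = x \<otimes>\<^bsub>B\<^esub> z \<oplus>\<^bsub>B\<^esub> y \<otimes>\<^bsub>B\<^esub> z"
    and "\<And>x y z. x \<in> carrier B \<Longrightarrow> y \<in> carrier B \<Longrightarrow> z \<in> carrier B \<Longrightarrow>
      z \<otimes>\<^bsub>B\<^esub> (x \<oplus>\<^bsub>B\<^esub> y) = z \<otimes>\<^bsub>B\<^esub> x \<oplus>\<^bsub>B\<^esub> z \<otimes>\<^bsub>B\<^esub> y"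
    and "\<And>c x y. x \<in> carrier B \<Longrightarrow> y \<in> carrier B \<Longrightarrow> (c \<odot>\<^bsub>B\<^esub> x) \<otimes>\<^bsub>B\<^esub> y = c \<odot>\<^bsub>B\<^esub> (x \<otimes>\<^bsub>B\<^esub> y)"
    and "\<And>c x y. x \<in> carrier B \<Longrightarrow> y \<in> carrier B \<Longrightarrow> x \<otimes>\<^bsub>B\<^esub> (c \<odot>\<^bsub>B\<^esub> y) = c \<odot>\<^bsub>B\<^esub> (x \<otimes>\<^bsub>B\<^esub> y)"
  shows "complex_algebra B"
  unfolding complex_algebra_def
proof (intro conjI allI ballI)
  show "ring B"
    by (rule ringI) (use assms module.axioms(2)[OF assms(1)] in \<open>auto intro: monoidI\<close>)
qed (use assms in auto)

section \<open>Operations in the quotient by the ideal of relations\<close>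

lemma qma_simps:
  "carrier (qma R F) = range (qproj R F)"
  "\<zero>\<^bsub>qma R F\<^esub> = qproj R F 0" "\<one>\<^bsub>qma R F\<^esub> = qproj R F 1"
  "qproj R F x \<oplus>\<^bsub>qma R F\<^esub> qproj R F y = qproj R F (x + y)"
  "qproj R F x \<otimes>\<^bsub>qma R F\<^esub> qproj R F y = qproj R F (x * y)"
  "c \<odot>\<^bsub>qma R F\<^esub> qproj R F x = qproj R F (fconst c * x)"
proof -
  let ?Q = "ring_of_type_algebra Quot qma_ideal R F"
  have hom: "qproj R F \<in> ring_hom ring_of_type_algebra ?Q"
    using ideal.rcos_ring_hom[OF ideal_qma, of R F] unfolding qproj_def .
  have Q: "carrier (qma R F) = carrier ?Q" "\<zero>\<^bsub>qma R F\<^esub> = \<zero>\<^bsub>?Q\<^esub>" "\<one>\<^bsub>qma R F\<^esub> = \<one>\<^bsub>?Q\<^esub>"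
    "x \<oplus>\<^bsub>qma R F\<^esub> y = x \<oplus>\<^bsub>?Q\<^esub> y" "x \<otimes>\<^bsub>qma R F\<^esub> y = x \<otimes>\<^bsub>?Q\<^esub> y"
    "c \<odot>\<^bsub>qma R F\<^esub> x = qproj R F (fconst c) \<otimes>\<^bsub>?Q\<^esub> x" for x y c
    by (simp_all add: qma_def Let_def)
  show "carrier (qma R F) = range (qproj R F)"
    unfolding Q by (auto simp: FactRing_def A_RCOSETS_def' qproj_def a_r_coset_def ring_of_type_algebra_simps)
  have "qproj R F 0 = qma_ideal R F" by (auto simp: mem_qproj)
  then show "\<zero>\<^bsub>qma R F\<^esub> = qproj R F 0" unfolding Q by (simp add: FactRing_def)
  show "\<one>\<^bsub>qma R F\<^esub> = qproj R F 1"
    unfolding Q using ring_hom_one[OF hom] by (simp add: ring_of_type_algebra_simps)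
  show "qproj R F x \<oplus>\<^bsub>qma R F\<^esub> qproj R F y = qproj R F (x + y)"
    unfolding Q using ring_hom_add[OF hom, of x y] by (simp add: ring_of_type_algebra_simps)
  show m: "qproj R F x \<otimes>\<^bsub>qma R F\<^esub> qproj R F y = qproj R F (x * y)" for x y
    unfolding Q using ring_hom_mult[OF hom, of x y] by (simp add: ring_of_type_algebra_simps)
  show "c \<odot>\<^bsub>qma R F\<^esub> qproj R F x = qproj R F (fconst c * x)"
    unfolding Q(6) Q(5)[symmetric] by (rule m)
qed

definition D_op :: "'v::finite mat2 \<Rightarrow> nat list \<Rightarrow> (nat \<Rightarrow> 'v, complex) rfmat" where
  "D_op R xs = prod_list (map (\<lambda>k. site1 k (D_mat R)) xs)"

lemma D_op_loc: "loc (set xs) (D_op R xs)"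
proof (induction xs)
  case (Cons k xs)
  have "loc (set (k # xs)) (site1 k (D_mat R))" "loc (set (k # xs)) (D_op R xs)"
    by (rule loc_mono[OF site1_loc], simp) (rule loc_mono[OF Cons], auto)
  then show ?case by (simp add: D_op_def loc_mult)
qed (simp add: D_op_def loc_one)

context strict_pair
begin

section \<open>Characteristic elements and matrix powers as classes of operators\<close>

lemma oper_Mbar_nb: "k < n \<Longrightarrow> oper {1..n} (Mbar F {1..n} (Suc k)) = nb k (gen_op)"
proof -
  have "rec_nat (gen_op) (\<lambda>j y. emb (site2 (Suc j) F) * (y * emb (site2 (Suc j) (matrix_inv F)))) k =
    nb k (gen_op)" by (induction k) simp_all
  then show "k < n \<Longrightarrow> ?thesis" using oper_Mbar[of k n F] by (simp add: gen_op_def)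
qed

lemma oper_Mbar_prod: "oper {1..n} (Mbar_prod F n) = Mp n"
proof -
  have *: "oper {1..n} (foldr (\<lambda>k T. op_mult {1..n} (Mbar F {1..n} k) T) xs op_one) =
      prod_list (map (\<lambda>k. nb (k - 1) (gen_op)) xs)" if "set xs \<subseteq> {1..n}" for xs
    using that
  proof (induction xs)
    case (Cons k xs)
    then obtain k' where "k = Suc k'" "k' < n" by (cases k) auto
    then show ?case using Cons oper_Mbar_nb[of k' n] by (simp add: oper_mult del: Mbar.simps)
  qed (simp add: oper_one)
  have "Mp n = prod_list (map (\<lambda>k. nb (k - 1) gen_op) [1..<n + 1])"
    by (induction n) simp_all
  then show ?thesis unfolding Mbar_prod_def by (subst *) auto
qed

lemma oper_D_prod: "set xs \<subseteq> {1..n} \<Longrightarrow> oper {1..n} (D_prod R {1..n} xs) = D_op R xs"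
proof (induction xs)
  case (Cons k xs)
  have "oper {1..n} (act1 {1..n} k (D_mat R)) = site1 k (D_mat R)"
    by (rule oper_act1) (use Cons.prems in auto)
  then show ?case using Cons by (simp add: D_prod_def D_op_def oper_mult)
qed (simp add: D_prod_def D_op_def oper_one)

text \<open>The matrix D of each lower factor passes through the traces over the higher ones, so the
  iterated R-trace is a single trace with the product of all the D, as in
  \<open>Rtrace\<close>.\<close>

lemma trs_ptr: "trs k n x = ptr {k + 1..k + n} (emb (D_op R [k + 1..<k + n + 1]) * x)"
proof (induction n arbitrary: x)
  case 0
  have "(idx {} :: (nat \<Rightarrow> 'v) set) = {\<lambda>_. undefined}" by (simp add: idx_def)
  then have "ptr {} y = y" for y :: "'v qop"
    by (intro ent_eqI) (simp add: ent_ptr agree_def)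
  then show ?case by (simp add: D_op_def emb_simps)
next
  case (Suc n)
  let ?S = "{k + 1..k + n}" and ?P = "emb (D_op R [k + 1..<k + n + 1]) :: 'v qop" and ?j = "k + n + 1"
  have P: "loc ?S ?P" by (rule loc_mono[OF emb_loc[OF D_op_loc]]) auto
  have "trs k (Suc n) x = ptr ?S (?P * rtr R ?j x)"
    by (simp only: trs.simps Suc)
  also have "\<dots> = ptr ?S (?P * ptr {?j} (emb (site1 ?j (D_mat R)) * x))"
    unfolding rtr_def ..
  also have "?P * ptr {?j} (emb (site1 ?j (D_mat R)) * x) = ptr {?j} (?P * (emb (site1 ?j (D_mat R)) * x))"
    by (rule ptr_left[symmetric, OF _ P]) auto
  also have "?P * (emb (site1 ?j (D_mat R)) * x) = emb (D_op R [k + 1..<k + Suc n + 1]) * x"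
    by (simp add: D_op_def emb_mult mult.assoc)
  also have "ptr ?S (ptr {?j} (emb (D_op R [k + 1..<k + Suc n + 1]) * x)) =
      ptr (?S \<union> {?j}) (emb (D_op R [k + 1..<k + Suc n + 1]) * x)"
    by (rule ptr_union) auto
  also have "?S \<union> {?j} = {k + 1..k + Suc n}" by auto
  finally show ?case .
qed

text \<open>Used with \<open>k = 0\<close> for \<open>ch\<close> and with \<open>k = 1\<close> for
  \<open>Mpow\<close>.\<close>

lemma oper_Rtrace:
  assumes "\<alpha> \<in> braid_algebra n" "k \<le> n"
  shows "oper {1..k} (Rtrace R {1..n} [k + 1..<n + 1] (op_mult {1..n} (Mbar_prod F n) (op_const (rho n R \<alpha>)))) =
    trs k (n - k) (Mp n * emb (rep_op R \<alpha>))"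
proof -
  let ?xs = "[k + 1..<n + 1]" and ?T = "op_mult {1..n} (Mbar_prod F n) (op_const (rho n R \<alpha>))"
  have e: "{1..k} = {1..n} - set ?xs" using assms by auto
  have sub: "set ?xs \<subseteq> {1..n}" by auto
  have "oper {1..k} (Rtrace R {1..n} ?xs ?T) =
      ptr (set ?xs) (oper {1..n} (op_mult {1..n} (op_const (D_prod R {1..n} ?xs)) ?T))"
    unfolding Rtrace_def e by (rule oper_ptrace[OF finite_atLeastAtMost sub])
  also have "\<dots> = ptr (set ?xs) (emb (D_op R ?xs) * (Mp n * emb (rep_op R \<alpha>)))"
    by (simp only: oper_mult[OF finite_atLeastAtMost] oper_op_const[OF finite_atLeastAtMost]
        oper_Mbar_prod oper_D_prod[OF sub] oper_rho[OF R(1) assms(1)])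
  also have "\<dots> = trs k (n - k) (Mp n * emb (rep_op R \<alpha>))"
  proof -
    have "set ?xs = {k + 1..k + (n - k)}" "k + (n - k) + 1 = n + 1" using assms by auto
    then show ?thesis unfolding trs_ptr by (simp only:)
  qed
  finally show ?thesis .
qed

abbreviation (input) u0 :: "nat \<Rightarrow> 'v" where "u0 \<equiv> \<lambda>_. undefined"

abbreviation (input) u1 :: "'v \<Rightarrow> nat \<Rightarrow> 'v" where "u1 a \<equiv> \<lambda>k\<in>{Suc 0}. a"

text \<open>An operator acting in no factor is a multiple of the identity, so any diagonal entry
  determines it.\<close>

definition qo :: "'v qop \<Rightarrow> ('v \<times> 'v) free_alg set" where
  "qo x = qproj R F (ent x u0 u0)"

definition qm :: "'v qop \<Rightarrow> ('v \<times> 'v) free_alg set ^ 'v ^ 'v" where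
  "qm x = (\<chi> a b. qproj R F (ent x (u1 a) (u1 b)))"

lemma ch_chr:
  assumes "\<alpha> \<in> braid_algebra n"
  shows "ch R F n \<alpha> = qo (chr n (emb (rep_op R \<alpha>)))"
proof -
  note o = oper_Rtrace[OF assms le0, unfolded add_0 diff_zero]
  \<comment> \<open>The only index of the empty set of factors, at which \<open>ch\<close> evaluates
    the full trace.\<close>
  have "u0 \<in> idx {1..0}" by (simp add: idx_def)
  from ent_oper_idx[OF finite_atLeastAtMost this this]
  have "Rtrace R {1..n} [1..<n + 1] (op_mult {1..n} (Mbar_prod F n) (op_const (rho n R \<alpha>))) u0 u0 =
      ent (trs 0 n (Mp n * emb (rep_op R \<alpha>))) u0 u0"
    unfolding o[symmetric] by (rule HOL.sym)
  then show ?thesis by (simp only: ch_def qo_def chr_def)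
qed

lemma Mpow_pw:
  assumes "\<alpha> \<in> braid_algebra (Suc p)"
  shows "Mpow R F (Suc p) \<alpha> = qm (pw p (emb (rep_op R \<alpha>)))"
proof -
  have "Rtrace R {1..Suc p} [2..<Suc p + 1] (op_mult {1..Suc p} (Mbar_prod F (Suc p)) (op_const (rho (Suc p) R \<alpha>))) (u1 a) (u1 b) =
      ent (trs 1 p (Mp (Suc p) * emb (rep_op R \<alpha>))) (u1 a) (u1 b)" for a b
  proof -
    have "u1 a \<in> idx {1..1}" "u1 b \<in> idx {1..1}" by (auto simp: idx_def PiE_def extensional_def)
    note o = oper_Rtrace[OF assms, of 1, unfolded one_add_one diff_Suc_1]
    have "1 \<le> Suc p" by simp
    from ent_oper_idx[OF finite_atLeastAtMost \<open>u1 a \<in> idx {1..1}\<close> \<open>u1 b \<in> idx {1..1}\<close>]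
    show ?thesis unfolding o[OF \<open>1 \<le> Suc p\<close>, symmetric] by (rule HOL.sym)
  qed
  then show ?thesis by (simp only: Mpow_def qm_def pw_def One_nat_def)
qed

lemma eqv_qm: "eqv x y \<Longrightarrow> qm x = qm y"
  unfolding eqv_def unfolding op_ideal_def
  by (simp add: qm_def vec_eq_iff qproj_eq_iff)

text \<open>An operator on the first factor has, up to repetition, only the entries read by
  \<open>qm\<close>. So on such operators \<open>qm\<close> forgets exactly what lies in
  \<open>op_ideal\<close>.\<close>

lemma qm_eqv:
  assumes "loc {1} x" "loc {1} y" "qm x = qm y"
  shows "eqv x y"
  unfolding eqv_def unfolding op_ideal_def
proof (intro CollectI allI)
  fix i j :: "nat \<Rightarrow> 'v"
  show "ent (x - y) i j \<in> qma_ideal R F"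
  proof (cases "agree (- {1}) i j")
    case True
    have "ent z i j = ent z (u1 (i 1)) (u1 (j 1))" if "loc {1} z" for z :: "'v qop"
      by (rule loc_ent[OF that]) (use True in \<open>auto simp: agree_def\<close>)
    moreover have "ent x (u1 (i 1)) (u1 (j 1)) - ent y (u1 (i 1)) (u1 (j 1)) \<in> qma_ideal R F"
      using assms(3) by (simp add: qm_def vec_eq_iff qproj_eq_iff)
    ultimately show ?thesis using assms by simp
  next
    case False
    then show ?thesis using locD[OF assms(1)] locD[OF assms(2)] by (simp add: qma_ideal_zero)
  qed
qed

lemma ent_scalar:
  assumes "loc {} c"
  shows "ent c i j = (if i = j then ent c u0 u0 else 0)"
proof (cases "i = j")
  case True
  have "ent c i i = ent c u0 u0"
    by (rule loc_ent[OF assms]) (auto simp: agree_def)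
  then show ?thesis using True by simp
next
  case False
  then have "\<not> agree (- {}) i j" by (auto simp: agree_def)
  then show ?thesis using False locD[OF assms] by simp
qed

lemma ent_times_scalar:
  assumes "loc {} c"
  shows "ent (x * c) i j = ent x i j * ent c u0 u0"
proof -
  have "ent (x * c) i j = (\<Sum>k\<in>{j}. ent x i k * ent c k j)"
  proof (rule ent_times)
    fix k assume "ent x i k * ent c k j \<noteq> 0"
    then have "ent c k j \<noteq> 0" by auto
    then show "k \<in> {j}" by (subst (asm) ent_scalar[OF assms]) (simp split: if_splits)
  qed simp
  then show ?thesis using ent_scalar[OF assms, of j j] by simp
qed

lemma qo_mult: "loc {} c \<Longrightarrow> qo (x * c) = qo x \<otimes>\<^bsub>qma R F\<^esub> qo c"
  by (simp add: qo_def qma_simps ent_times_scalar)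

lemma qm_mult_scalar: "loc {} c \<Longrightarrow> qm (x * c) = mat_rmult (qma R F) (qm x) (qo c)"
  by (simp add: qo_def qm_def mat_rmult_def qma_simps ent_times_scalar vec_eq_iff)

lemma u1_eq_iff: "u1 a = u1 b \<longleftrightarrow> a = b"
proof
  assume "u1 a = u1 b"
  then have "u1 a (Suc 0) = u1 b (Suc 0)" by (simp only:)
  then show "a = b" by simp
qed simp

lemma qm_scalar: "loc {} c \<Longrightarrow> qm c = scalar_mat (qma R F) (qo c)"
  using ent_scalar[of c "u1 _" "u1 _"] unfolding u1_eq_iff
  by (simp add: qo_def qm_def scalar_mat_def qma_simps vec_eq_iff)

sublocale M: module_image "\<lambda>c. scal (fconst c)" qm "{x. loc {1} x}" "mat_algebra (qma R F)"
proof
  show "carrier (mat_algebra (qma R F)) = qm ` {x. loc {1} x}"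
  proof (intro Set.equalityI subsetI)
    fix T :: "('v \<times> 'v) free_alg set ^ 'v ^ 'v"
    assume "T \<in> carrier (mat_algebra (qma R F))"
    then have "T $ a $ b \<in> range (qproj R F)" for a b by (simp add: mat_algebra_def qma_simps)
    then have "\<forall>a b. \<exists>x. T $ a $ b = qproj R F x" by blast
    then obtain Y where Y: "\<And>a b. T $ a $ b = qproj R F (Y a b)" by metis
    have "T = qm (site1 1 (\<chi> a b. Y a b))"
      using Y by (simp add: qm_def ent_site1 agree_def vec_eq_iff)
    then show "T \<in> qm ` {x. loc {1} x}" using site1_loc by blast
  qed (auto simp: mat_algebra_def qm_def qma_simps)
  show "scal (fconst c) * x \<in> {x. loc {1} x}" if "x \<in> {x. loc {1} x}"
    for c and x :: "'v qop"
    using that loc_mono[OF scal_loc, of "{1}" "fconst c"] by (simp add: loc_mult)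
  show "0 \<in> {x :: 'v qop. loc {1} x}" by (simp add: loc_def)
  show "\<zero>\<^bsub>mat_algebra (qma R F)\<^esub> = qm 0"
    by (simp add: mat_algebra_def scalar_mat_def qm_def qma_simps vec_eq_iff)
qed (auto simp: fconst_simps scal_simps loc_add mat_algebra_def qm_def qma_simps vec_eq_iff ent_scal_times)

sublocale A: module_image "\<lambda>c. scal (fconst c)" qo "{x. loc {} x}" "qma R F"
proof
  show "carrier (qma R F) = qo ` {x. loc {} x}"
  proof (intro Set.equalityI subsetI)
    fix T :: "('v \<times> 'v) free_alg set"
    assume "T \<in> carrier (qma R F)"
    then obtain y where "T = qproj R F y" by (auto simp: qma_simps)
    then have "T = qo (scal y)" by (simp add: qo_def ent_scal)
    then show "T \<in> qo ` {x. loc {} x}" using scal_loc by blast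
  qed (auto simp: qo_def qma_simps)
  show "0 \<in> {x :: 'v qop. loc {} x}" by (simp add: loc_def)
qed (auto simp: fconst_simps scal_simps loc_add loc_mult scal_loc qo_def qma_simps ent_scal_times)

lemma scalars_eq: "z \<in> scalars \<Longrightarrow> \<exists>c. z = scal (fconst c)"
proof -
  assume "z \<in> scalars"
  then obtain y where y: "z = emb y" "loc {} z" by (auto simp: scalars_def konst_def)
  have "z = scal (ent z u0 u0)"
    by (rule ent_eqI, subst ent_scalar[OF y(2)]) (simp add: ent_scal)
  then show ?thesis unfolding y(1) ent_emb by blast
qed

lemma zero_csp: "0 \<in> csp"
  using csp.scal[OF scal_scalars[of 0] csp.one] by (simp add: fconst_simps scal_simps)

lemma char_gens_qo: "char_gens R F = insert (qo 1) {qo (chr n a) | n a. 1 \<le> n \<and> a \<in> rep_set R n}"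
proof -
  have "{ch R F n \<alpha> | n \<alpha>. n \<ge> 1 \<and> \<alpha> \<in> braid_algebra n} = {qo (chr n a) | n a. 1 \<le> n \<and> a \<in> rep_set R n}"
  proof (intro Set.equalityI subsetI)
    fix x assume "x \<in> {ch R F n \<alpha> | n \<alpha>. n \<ge> 1 \<and> \<alpha> \<in> braid_algebra n}"
    then obtain n \<alpha> where "n \<ge> 1" "\<alpha> \<in> braid_algebra n" "x = qo (chr n (emb (rep_op R \<alpha>)))"
      using ch_chr by blast
    then show "x \<in> {qo (chr n a) | n a. 1 \<le> n \<and> a \<in> rep_set R n}" unfolding rep_set_def by blast
  next
    fix x assume "x \<in> {qo (chr n a) | n a. 1 \<le> n \<and> a \<in> rep_set R n}"
    then obtain n \<alpha> where "n \<ge> 1" "\<alpha> \<in> braid_algebra n" "x = qo (chr n (emb (rep_op R \<alpha>)))"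
      unfolding rep_set_def by blast
    then show "x \<in> {ch R F n \<alpha> | n \<alpha>. n \<ge> 1 \<and> \<alpha> \<in> braid_algebra n}" using ch_chr by blast
  qed
  then show ?thesis by (simp add: char_gens_def qma_simps qo_def ent_one)
qed

lemma char_gens_csp: "char_gens R F \<subseteq> qo ` csp"
  unfolding char_gens_qo by (auto simp del: One_nat_def intro!: imageI csp.one csp.chr)

lemma char_space_csp: "char_space R F = qo ` csp"
  unfolding char_space_def
proof (rule A.lin_span_image)
  show "csp \<subseteq> {x. loc {} x}" using csp_loc by blast
  show "char_gens R F \<subseteq> qo ` csp" by (rule char_gens_csp)
  fix H assume H: "submodule H cplx (qma R F)" "char_gens R F \<subseteq> H"
  have "qo x \<in> H" if "x \<in> csp" for x
    using that
  proof (induction rule: csp.induct)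
    case (add x y)
    then show ?case using A.submodule_h(1)[OF H(1), of x y] csp_loc by simp
  next
    case (scal z x)
    then show ?case using A.submodule_h(2)[OF H(1), of x] csp_loc scalars_eq by auto
  qed (use H(2) char_gens_qo in blast)+
  then show "qo ` csp \<subseteq> H" by blast
qed (auto intro: csp.add csp.scal scal_scalars zero_csp)

lemma power_space_psp: "power_space R F = qm ` psp"
  unfolding power_space_def
proof (rule M.lin_span_image)
  let ?E = "{scalar_mat (qma R F) c | c. c \<in> char_space R F} \<union> {Mpow R F n \<alpha> | n \<alpha>. n \<ge> 1 \<and> \<alpha> \<in> braid_algebra n}"
  have E: "?E = qm ` csp \<union> {qm (pw p a) | p a. a \<in> rep_set R (Suc p)}"
  proof -
    have "{scalar_mat (qma R F) c | c. c \<in> char_space R F} = qm ` csp"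
    proof -
      have "qm ` csp = (\<lambda>c. scalar_mat (qma R F) (qo c)) ` csp"
        by (intro image_cong HOL.refl qm_scalar csp_loc)
      then show ?thesis by (auto simp: char_space_csp)
    qed
    moreover have "{Mpow R F n \<alpha> | n \<alpha>. n \<ge> 1 \<and> \<alpha> \<in> braid_algebra n} = {qm (pw p a) | p a. a \<in> rep_set R (Suc p)}"
      (is "?L = ?R")
    proof (intro Set.equalityI subsetI)
      fix T assume "T \<in> ?L"
      then obtain n \<alpha> where "n \<ge> 1" "\<alpha> \<in> braid_algebra n" "T = Mpow R F n \<alpha>" by blast
      then show "T \<in> ?R" using Mpow_pw[of \<alpha> "n - 1"] by (auto simp: rep_set_def intro!: exI[of _ "n - 1"])
    next
      fix T assume "T \<in> ?R"
      then obtain p \<alpha> where "\<alpha> \<in> braid_algebra (Suc p)" "T = qm (pw p (emb (rep_op R \<alpha>)))" by (auto simp: rep_set_def)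
      then show "T \<in> ?L" using Mpow_pw[of \<alpha> p] by (auto intro!: exI[of _ "Suc p"] exI[of _ \<alpha>])
    qed
    ultimately show ?thesis by simp
  qed
  show "psp \<subseteq> {x. loc {1} x}" using psp_loc by blast
  show "?E \<subseteq> qm ` psp" unfolding E by (auto intro: psp.pw psp.csp)
  fix H assume H: "submodule H cplx (mat_algebra (qma R F))" "?E \<subseteq> H"
  have H2: "qm ` csp \<union> {qm (pw p a) | p a. a \<in> rep_set R (Suc p)} \<subseteq> H" using H(2) unfolding E .
  have "qm x \<in> H" if "x \<in> psp" for x
    using that
  proof (induction rule: psp.induct)
    case (add x y)
    then show ?case using M.submodule_h(1)[OF H(1), of x y] psp_loc by simp
  next
    case (scal z x)
    then show ?case using M.submodule_h(2)[OF H(1), of x] psp_loc scalars_eq by auto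
  qed (use H2 in blast)+
  then show "qm ` psp \<subseteq> H" by blast
qed (auto intro: psp.add psp.scal scal_scalars psp.csp zero_csp)

subsection \<open>The star product on the quotient\<close>

text \<open>A choice of representatives carries \<open>star\<close> over to matrices. By
  \<open>qm_eqv\<close> two representatives differ by an element of the ideal, so
  \<open>sm_qm\<close> can show that the choice does not matter.\<close>

definition pre :: "('v \<times> 'v) free_alg set ^ 'v ^ 'v \<Rightarrow> 'v qop" where
  "pre T = (SOME x. x \<in> psp \<and> qm x = T)"

definition sm :: "('v \<times> 'v) free_alg set ^ 'v ^ 'v \<Rightarrow> ('v \<times> 'v) free_alg set ^ 'v ^ 'v \<Rightarrow>
    ('v \<times> 'v) free_alg set ^ 'v ^ 'v" where
  "sm T Y = qm (star (pre T) (pre Y))"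

lemma pre_qm: "x \<in> psp \<Longrightarrow> pre (qm x) \<in> psp \<and> qm (pre (qm x)) = qm x"
  unfolding pre_def by (rule someI[of _ x]) simp

lemma sm_qm:
  assumes "x \<in> psp" "y \<in> psp"
  shows "sm (qm x) (qm y) = qm (star x y)"
proof -
  note p = pre_qm[OF assms(1)] and q = pre_qm[OF assms(2)]
  have "eqv (pre (qm x)) x" "eqv (pre (qm y)) y"
    using p q assms by (auto intro!: qm_eqv psp_loc)
  then have "eqv (star (pre (qm x)) (pre (qm y))) (star x (pre (qm y)))"
    "eqv (star x (pre (qm y))) (star x y)"
    using p q assms star_eqv_left star_eqv_right by blast+
  then show ?thesis unfolding sm_def using eqv_qm by metis
qed

lemma sm_closed:
  assumes "x \<in> psp" "y \<in> psp"
  shows "\<exists>z\<in>psp. sm (qm x) (qm y) = qm z \<and> eqv (star x y) z"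
  using star_closed[OF assms] sm_qm[OF assms] eqv_qm by metis

section \<open>Properties of the product of matrices\<close>

lemma qm_add: "qm x \<oplus>\<^bsub>mat_algebra (qma R F)\<^esub> qm y = qm (x + y)"
  by (simp add: mat_algebra_def qm_def qma_simps vec_eq_iff)

lemma qm_scal: "c \<odot>\<^bsub>mat_algebra (qma R F)\<^esub> qm x = qm (scal (fconst c) * x)"
  by (simp add: mat_algebra_def qm_def qma_simps vec_eq_iff ent_scal_times)

lemma qo_scal: "c \<odot>\<^bsub>qma R F\<^esub> qo x = qo (scal (fconst c) * x)"
  by (simp add: qo_def qma_simps ent_scal_times)

lemma sm_add_left:
  "x \<in> psp \<Longrightarrow> y \<in> psp \<Longrightarrow> z \<in> psp \<Longrightarrow> sm (qm (x + y)) (qm z) = qm (star x z + star y z)"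
  by (simp add: sm_qm psp.add eqv_qm[OF star_add_left])

lemma sm_add_right:
  "x \<in> psp \<Longrightarrow> y \<in> psp \<Longrightarrow> z \<in> psp \<Longrightarrow> sm (qm z) (qm (x + y)) = qm (star z x + star z y)"
  by (simp add: sm_qm psp.add star_add_right)

lemma sm_scal_left:
  "x \<in> psp \<Longrightarrow> y \<in> psp \<Longrightarrow> sm (qm (scal (fconst c) * x)) (qm y) = qm (scal (fconst c) * star x y)"
  by (simp add: sm_qm psp.scal scal_scalars eqv_qm[OF star_scal_left])

lemma sm_scal_right:
  "x \<in> psp \<Longrightarrow> y \<in> psp \<Longrightarrow> sm (qm x) (qm (scal (fconst c) * y)) = qm (scal (fconst c) * star x y)"
  by (simp add: sm_qm psp.scal scal_scalars eqv_qm[OF star_scal_right])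

lemma sm_pw_pw:
  "a \<in> rep_set R (Suc p) \<Longrightarrow> b \<in> rep_set R (Suc q) \<Longrightarrow>
    sm (qm (pw p a)) (qm (pw q b)) = qm (pw (Suc p + q) (stp p a b))"
  by (simp add: sm_qm psp.pw eqv_qm[OF star_pw_pw])

lemma sm_csp_left: "d \<in> csp \<Longrightarrow> x \<in> psp \<Longrightarrow> sm (qm d) (qm x) = mat_rmult (qma R F) (qm x) (qo d)"
  by (simp add: sm_qm psp.csp eqv_qm[OF star_csp_left] qm_mult_scalar csp_loc)

lemma sm_csp_right: "d \<in> csp \<Longrightarrow> x \<in> psp \<Longrightarrow> sm (qm x) (qm d) = mat_rmult (qma R F) (qm x) (qo d)"
  by (simp add: sm_qm psp.csp eqv_qm[OF star_csp_right] qm_mult_scalar csp_loc)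

lemma sm_csp_csp:
  assumes "c \<in> csp" "d \<in> csp"
  shows "sm (qm c) (qm d) = scalar_mat (qma R F) (qo c \<otimes>\<^bsub>qma R F\<^esub> qo d)"
proof -
  have "sm (qm c) (qm d) = qm (c * d)"
    using assms by (simp add: sm_qm psp.csp eqv_qm[OF star_csp_right])
  then show ?thesis
    using qm_scalar[OF csp_loc[OF csp_mult[OF assms]]] qo_mult[OF csp_loc[OF assms(2)]] by simp
qed

lemma sm_assoc:
  assumes "x \<in> psp" "y \<in> psp" "z \<in> psp"
  shows "sm (sm (qm x) (qm y)) (qm z) = sm (qm x) (sm (qm y) (qm z))"
proof -
  obtain v where v: "v \<in> psp" "sm (qm x) (qm y) = qm v" "eqv (star x y) v" using sm_closed assms by blast
  obtain w where w: "w \<in> psp" "sm (qm y) (qm z) = qm w" "eqv (star y z) w" using sm_closed assms by blast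
  have "eqv (star v z) (star x (star y z))"
    by (rule star_assoc[OF assms v(1) eqv_sym[OF v(3)]])
  then have "qm (star v z) = qm (star x w)"
    using eqv_qm star_eqv_right[OF assms(1) w(3)] by metis
  then show ?thesis using v w assms by (simp add: sm_qm)
qed

lemma bilinear_sm: "bilinear_mult (mat_algebra (qma R F)) (power_space R F) sm"
proof -
  have "sm (qm x) (qm y) \<in> qm ` psp" if "x \<in> psp" "y \<in> psp" for x y
    using sm_closed[OF that] by (auto simp: image_iff)
  then show ?thesis
    unfolding bilinear_mult_def power_space_psp
    by (auto simp: qm_add qm_scal sm_add_left sm_add_right sm_scal_left sm_scal_right sm_qm)
qed

lemma Mpow_star:
  assumes "\<alpha> \<in> braid_algebra (Suc p)" "\<beta> \<in> braid_algebra (Suc q)"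
  shows "Mpow R F (Suc p + Suc q) (galg_star (Suc p) (Suc q) \<alpha> \<beta>) =
    qm (pw (Suc p + q) (stp p (emb (rep_op R \<alpha>)) (emb (rep_op R \<beta>))))"
proof -
  have "emb (rep_op R (galg_star (Suc p) (Suc q) \<alpha> \<beta>)) = stp p (emb (rep_op R \<alpha>)) (emb (rep_op R \<beta>))"
    unfolding stp_def s_word shiftn_emb emb_mult[symmetric]
    using rep_op_star(2)[OF R(1) assms] by simp
  moreover have "galg_star (Suc p) (Suc q) \<alpha> \<beta> \<in> braid_algebra (Suc (Suc p + q))"
    using rep_op_star(1)[OF R(1) assms] by simp
  ultimately show ?thesis using Mpow_pw[of "galg_star (Suc p) (Suc q) \<alpha> \<beta>" "Suc p + q"] by simp
qed

lemma star_formulas_iff: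
  "star_formulas R F S \<longleftrightarrow>
    (\<forall>p q. \<forall>a\<in>rep_set R (Suc p). \<forall>b\<in>rep_set R (Suc q).
      S (qm (pw p a)) (qm (pw q b)) = qm (pw (Suc p + q) (stp p a b))) \<and>
    (\<forall>p. \<forall>a\<in>rep_set R (Suc p). \<forall>c\<in>char_gens R F.
      S (scalar_mat (qma R F) c) (qm (pw p a)) = mat_rmult (qma R F) (qm (pw p a)) c \<and>
      S (qm (pw p a)) (scalar_mat (qma R F) c) = mat_rmult (qma R F) (qm (pw p a)) c) \<and>
    (\<forall>c\<in>char_gens R F. \<forall>d\<in>char_gens R F.
      S (scalar_mat (qma R F) c) (scalar_mat (qma R F) d) = scalar_mat (qma R F) (c \<otimes>\<^bsub>qma R F\<^esub> d))"
proof -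
  have n: "(\<forall>n\<ge>1. P n) \<longleftrightarrow> (\<forall>p. P (Suc p))" for P :: "nat \<Rightarrow> bool"
    by (metis One_nat_def Suc_le_D Suc_le_mono le0)
  show ?thesis
    unfolding star_formulas_def n rep_set_def
    by (auto simp: Mpow_pw Mpow_star simp del: add_Suc add_Suc_right)
qed

lemma star_formulas_sm: "star_formulas R F sm"
  unfolding star_formulas_iff
proof (intro conjI allI ballI)
  fix p c and a :: "'v qop"
  assume a: "a \<in> rep_set R (Suc p)" and c: "c \<in> char_gens R F"
  obtain d where d: "d \<in> csp" "c = qo d" using c char_gens_csp by blast
  then have e: "scalar_mat (qma R F) c = qm d" by (simp add: qm_scalar csp_loc)
  show "sm (scalar_mat (qma R F) c) (qm (pw p a)) = mat_rmult (qma R F) (qm (pw p a)) c"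
    "sm (qm (pw p a)) (scalar_mat (qma R F) c) = mat_rmult (qma R F) (qm (pw p a)) c"
    unfolding e using d a by (simp_all add: sm_csp_left sm_csp_right psp.pw)
next
  fix c c' assume "c \<in> char_gens R F" "c' \<in> char_gens R F"
  then obtain d d' where "d \<in> csp" "c = qo d" "d' \<in> csp" "c' = qo d'" using char_gens_csp by blast
  then show "sm (scalar_mat (qma R F) c) (scalar_mat (qma R F) c') = scalar_mat (qma R F) (c \<otimes>\<^bsub>qma R F\<^esub> c')"
    using sm_csp_csp[of d d'] by (simp add: qm_scalar[symmetric] csp_loc)
qed (rule sm_pw_pw)

text \<open>The formulas prescribe products with I c only for \<open>c\<close> in
  \<open>char_gens\<close>. Uniqueness therefore needs an induction that goes down to these
  generators, whereas \<open>psp.induct\<close> treats all of \<open>csp\<close> as one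
  case.\<close>

lemma psp_gen_induct [consumes 1, case_names pw gen add scal]:
  assumes "x \<in> psp"
    and pw: "\<And>p a. a \<in> rep_set R (Suc p) \<Longrightarrow> P (pw p a)"
    and gen: "\<And>c. c \<in> csp \<Longrightarrow> qo c \<in> char_gens R F \<Longrightarrow> P c"
    and add: "\<And>x y. x \<in> psp \<Longrightarrow> y \<in> psp \<Longrightarrow> P x \<Longrightarrow> P y \<Longrightarrow> P (x + y)"
    and scal: "\<And>c x. x \<in> psp \<Longrightarrow> P x \<Longrightarrow> P (scal (fconst c) * x)"
  shows "P x"
  using assms(1)
proof (induction rule: psp.induct)
  case (csp x)
  then show ?case
  proof (induction rule: csp.induct)
    case one
    show ?case by (rule gen) (auto simp: char_gens_qo intro: csp.one)
  next
    case (chr n a)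
    then show ?case by (intro gen csp.chr) (auto simp: char_gens_qo)
  next
    case (add x y)
    then show ?case by (intro assms(4)) (auto intro: psp.csp)
  next
    case (scal z x)
    then show ?case using scalars_eq[of z] assms(5)[of x] psp.csp by auto
  qed
next
  case (scal z x)
  then show ?case using scalars_eq[of z] assms(5)[of x] by auto
qed (use assms in auto)

text \<open>The formulas fix the product of any two generators. Linearity in the right argument
  extends this for a generator on the left, and linearity in the left argument does the
  rest.\<close>

lemma sm_unique:
  assumes S: "bilinear_mult (mat_algebra (qma R F)) (power_space R F) S" "star_formulas R F S"
    and "x \<in> psp" "y \<in> psp"
  shows "S (qm x) (qm y) = sm (qm x) (qm y)"
proof -
  have lin: "f (qm (x + y)) (qm z) = f (qm x) (qm z) \<oplus>\<^bsub>mat_algebra (qma R F)\<^esub> f (qm y) (qm z)"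
      "f (qm z) (qm (x + y)) = f (qm z) (qm x) \<oplus>\<^bsub>mat_algebra (qma R F)\<^esub> f (qm z) (qm y)"
      "f (qm (scal (fconst c) * x)) (qm y) = c \<odot>\<^bsub>mat_algebra (qma R F)\<^esub> f (qm x) (qm y)"
      "f (qm x) (qm (scal (fconst c) * y)) = c \<odot>\<^bsub>mat_algebra (qma R F)\<^esub> f (qm x) (qm y)"
    if "bilinear_mult (mat_algebra (qma R F)) (power_space R F) f" "x \<in> psp" "y \<in> psp" "z \<in> psp" for f x y z c
    using that unfolding bilinear_mult_def power_space_psp qm_add[symmetric] qm_scal[symmetric] by simp_all
  note lin_s = lin[OF S(1)] and lin_sm = lin[OF bilinear_sm]
  have gen: "scalar_mat (qma R F) (qo c) = qm c" if "c \<in> csp" for c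
    using that by (simp add: qm_scalar csp_loc)
  note f = S(2)[unfolded star_formulas_iff] and g = star_formulas_sm[unfolded star_formulas_iff]
  have pw: "S (qm (pw p a)) (qm y) = sm (qm (pw p a)) (qm y)"
    if a: "a \<in> rep_set R (Suc p)" and "y \<in> psp" for p a y
    using that(2)
  proof (induction rule: psp_gen_induct)
    case (pw q b)
    then show ?case using f g a by simp
  next
    case (gen c)
    then show ?case using f g a \<open>\<And>c. c \<in> csp \<Longrightarrow> scalar_mat (qma R F) (qo c) = qm c\<close>[of c] by metis
  next
    case (add x y)
    then show ?case using psp.pw[OF a] by (simp add: lin_s lin_sm)
  next
    case (scal c x)
    then show ?case using psp.pw[OF a] by (simp add: lin_s lin_sm)
  qed
  have ch: "S (qm d) (qm y) = sm (qm d) (qm y)"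
    if d: "d \<in> csp" "qo d \<in> char_gens R F" and "y \<in> psp" for d y
    using that(3)
  proof (induction rule: psp_gen_induct)
    case (pw q b)
    then show ?case using f g d gen[of d] by metis
  next
    case (gen c)
    then show ?case using f g d \<open>\<And>c. c \<in> csp \<Longrightarrow> scalar_mat (qma R F) (qo c) = qm c\<close> by metis
  next
    case (add x y)
    then show ?case using psp.csp[OF d(1)] by (simp add: lin_s lin_sm)
  next
    case (scal c x)
    then show ?case using psp.csp[OF d(1)] by (simp add: lin_s lin_sm)
  qed
  from assms(3) show ?thesis
  proof (induction rule: psp_gen_induct)
    case (add x x')
    then show ?case using assms(4) by (simp add: lin_s lin_sm)
  next
    case (scal c x)
    then show ?case using assms(4) by (simp add: lin_s lin_sm)
  qed (use pw ch assms(4) in auto)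
qed

section \<open>The two algebras and the embedding between them\<close>

lemma power_algebra_simps:
  "carrier (power_algebra R F S) = power_space R F"
  "\<one>\<^bsub>power_algebra R F S\<^esub> = scalar_mat (qma R F) \<one>\<^bsub>qma R F\<^esub>"
  "\<zero>\<^bsub>power_algebra R F S\<^esub> = \<zero>\<^bsub>mat_algebra (qma R F)\<^esub>"
  "x \<otimes>\<^bsub>power_algebra R F S\<^esub> y = S x y"
  "x \<oplus>\<^bsub>power_algebra R F S\<^esub> y = x \<oplus>\<^bsub>mat_algebra (qma R F)\<^esub> y"
  "c \<odot>\<^bsub>power_algebra R F S\<^esub> x = c \<odot>\<^bsub>mat_algebra (qma R F)\<^esub> x"
  by (simp_all add: power_algebra_def mat_algebra_def)

lemma char_subalgebra_simps:
  "carrier (char_subalgebra R F) = char_space R F"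
  "\<one>\<^bsub>char_subalgebra R F\<^esub> = \<one>\<^bsub>qma R F\<^esub>"
  "\<zero>\<^bsub>char_subalgebra R F\<^esub> = \<zero>\<^bsub>qma R F\<^esub>"
  "x \<otimes>\<^bsub>char_subalgebra R F\<^esub> y = x \<otimes>\<^bsub>qma R F\<^esub> y"
  "x \<oplus>\<^bsub>char_subalgebra R F\<^esub> y = x \<oplus>\<^bsub>qma R F\<^esub> y"
  "c \<odot>\<^bsub>char_subalgebra R F\<^esub> x = c \<odot>\<^bsub>qma R F\<^esub> x"
  by (simp_all add: char_subalgebra_def)

lemma one_qm: "scalar_mat (qma R F) \<one>\<^bsub>qma R F\<^esub> = qm 1"
  using qm_scalar[OF loc_one] by (simp add: qma_simps qo_def ent_one)

lemma one_qo: "\<one>\<^bsub>qma R F\<^esub> = qo 1"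
  by (simp add: qma_simps qo_def ent_one)

lemma qo_add: "qo x \<oplus>\<^bsub>qma R F\<^esub> qo y = qo (x + y)"
  by (simp add: qo_def qma_simps)

lemma complex_algebra_power: "complex_algebra (power_algebra R F sm)"
proof (rule complex_algebraI)
  interpret P: module_image "\<lambda>c. scal (fconst c)" qm psp "power_algebra R F sm"
    by standard (auto simp: power_algebra_simps power_space_psp qm_add qm_scal M.B(2)
        fconst_simps scal_simps intro: psp.csp zero_csp psp.add psp.scal scal_scalars)
  show "Module.module cplx (power_algebra R F sm)" by (rule P.module_B)
  have one: "1 \<in> psp" by (intro psp.csp csp.one)
  then show "\<one>\<^bsub>power_algebra R F sm\<^esub> \<in> carrier (power_algebra R F sm)"
    by (simp add: power_algebra_simps power_space_psp one_qm)
  fix x assume "x \<in> carrier (power_algebra R F sm)"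
  then obtain u where u: "u \<in> psp" "x = qm u" by (auto simp: power_algebra_simps power_space_psp)
  show "\<one>\<^bsub>power_algebra R F sm\<^esub> \<otimes>\<^bsub>power_algebra R F sm\<^esub> x = x"
    "x \<otimes>\<^bsub>power_algebra R F sm\<^esub> \<one>\<^bsub>power_algebra R F sm\<^esub> = x"
    using u one csp.one by (simp_all add: power_algebra_simps one_qm sm_qm eqv_qm[OF star_csp_left] eqv_qm[OF star_csp_right])
next
  fix x y z
  assume "x \<in> carrier (power_algebra R F sm)" "y \<in> carrier (power_algebra R F sm)" "z \<in> carrier (power_algebra R F sm)"
  then show "x \<otimes>\<^bsub>power_algebra R F sm\<^esub> y \<otimes>\<^bsub>power_algebra R F sm\<^esub> z =
      x \<otimes>\<^bsub>power_algebra R F sm\<^esub> (y \<otimes>\<^bsub>power_algebra R F sm\<^esub> z)"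
    unfolding power_algebra_simps power_space_psp using sm_assoc by blast
qed (use bilinear_sm in \<open>auto simp: bilinear_mult_def power_algebra_simps\<close>)

lemma mult_scal:
  fixes x y :: "'v qop"
  shows "x * (scal (fconst c) * y) = scal (fconst c) * (x * y)"
  by (simp only: mult.assoc[symmetric] scalar_com[OF scal_scalars, of c x])

lemma complex_algebra_char: "complex_algebra (char_subalgebra R F)"
proof (rule complex_algebraI)
  interpret P: module_image "\<lambda>c. scal (fconst c)" qo csp "char_subalgebra R F"
    by standard (auto simp: char_subalgebra_simps char_space_csp qo_add qo_scal A.B(2)
        fconst_simps scal_simps intro: zero_csp csp.add csp.scal scal_scalars)
  show "Module.module cplx (char_subalgebra R F)" by (rule P.module_B)
qed (auto simp: char_subalgebra_simps char_space_csp one_qo qo_add qo_scal qo_mult[symmetric] csp_loc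
    csp_mult csp.one csp.add csp.scal scal_scalars mult_scal mult.assoc distrib_left distrib_right)

lemma char_mono: "algebra_mono (char_subalgebra R F) (power_algebra R F sm) (scalar_mat (qma R F))"
  unfolding algebra_mono_def
proof (intro conjI complex_algebra_char complex_algebra_power allI ballI)
  have e: "scalar_mat (qma R F) (qo c) = qm c" if "c \<in> csp" for c
    using that by (simp add: qm_scalar csp_loc)
  show "scalar_mat (qma R F) \<in> ring_hom (char_subalgebra R F) (power_algebra R F sm)"
  proof (rule ring_hom_memI)
    fix x y assume "x \<in> carrier (char_subalgebra R F)" "y \<in> carrier (char_subalgebra R F)"
    then obtain c d where cd: "c \<in> csp" "d \<in> csp" "x = qo c" "y = qo d"
      by (auto simp: char_subalgebra_simps char_space_csp)
    show "scalar_mat (qma R F) x \<in> carrier (power_algebra R F sm)"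
      using cd e by (auto simp: power_algebra_simps power_space_psp intro: psp.csp)
    show "scalar_mat (qma R F) (x \<otimes>\<^bsub>char_subalgebra R F\<^esub> y) =
        scalar_mat (qma R F) x \<otimes>\<^bsub>power_algebra R F sm\<^esub> scalar_mat (qma R F) y"
      using sm_csp_csp[OF cd(1,2)] cd e by (simp add: power_algebra_simps char_subalgebra_simps)
    show "scalar_mat (qma R F) (x \<oplus>\<^bsub>char_subalgebra R F\<^esub> y) =
        scalar_mat (qma R F) x \<oplus>\<^bsub>power_algebra R F sm\<^esub> scalar_mat (qma R F) y"
      using cd e[of "c + d"] e by (simp add: power_algebra_simps char_subalgebra_simps qo_add qm_add csp.add)
  qed (simp add: power_algebra_simps char_subalgebra_simps)
  fix c x assume "x \<in> carrier (char_subalgebra R F)"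
  then obtain d where d: "d \<in> csp" "x = qo d" by (auto simp: char_subalgebra_simps char_space_csp)
  show "scalar_mat (qma R F) (c \<odot>\<^bsub>char_subalgebra R F\<^esub> x) = c \<odot>\<^bsub>power_algebra R F sm\<^esub> scalar_mat (qma R F) x"
    using d e[of "scal (fconst c) * d"] e
    by (simp add: power_algebra_simps char_subalgebra_simps qo_scal qm_scal csp.scal scal_scalars)
next
  show "inj_on (scalar_mat (qma R F) :: _ \<Rightarrow> ('v \<times> 'v) free_alg set ^ 'v ^ 'v) (carrier (char_subalgebra R F))"
  proof (rule inj_onI)
    fix x y :: "('v \<times> 'v) free_alg set"
    assume "(scalar_mat (qma R F) x :: _ ^ 'v ^ 'v) = scalar_mat (qma R F) y"
    \<comment> \<open>Any diagonal entry recovers the scalar, and there is one since the index type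
      is inhabited.\<close>
    from arg_cong[OF this, of "\<lambda>m. m $ undefined $ undefined"] show "x = y" by (simp add: scalar_mat_def)
  qed
qed

end

theorem mainTheorem12:
  fixes R F :: "complex ^ ('v::finite \<times> 'v) ^ ('v \<times> 'v)"
  assumes "R_matrix R" and "R_matrix F"
    and "strict_skew_invertible R" and "strict_skew_invertible F"
    and "compatible_pair R F"
  shows "\<exists>s. bilinear_mult (mat_algebra (qma R F)) (power_space R F) s \<and>
      star_formulas R F s \<and>
      (\<forall>s'. bilinear_mult (mat_algebra (qma R F)) (power_space R F) s' \<and> star_formulas R F s' \<longrightarrow>
         (\<forall>T\<in>power_space R F. \<forall>Y\<in>power_space R F. s' T Y = s T Y)) \<and>
      complex_algebra (power_algebra R F s) \<and>
      (\<forall>T\<in>power_space R F. \<forall>c\<in>char_space R F.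
         s T (scalar_mat (qma R F) c) = mat_rmult (qma R F) T c) \<and>
      algebra_mono (char_subalgebra R F) (power_algebra R F s) (scalar_mat (qma R F))"
proof -
  interpret strict_pair R F
    using assms by unfold_locales (simp_all add: strict_skew_invertible_def)
  show ?thesis
  proof (intro exI[of _ sm] conjI allI impI ballI)
    fix s' T Y
    assume "bilinear_mult (mat_algebra (qma R F)) (power_space R F) s' \<and> star_formulas R F s'"
      "T \<in> power_space R F" "Y \<in> power_space R F"
    then show "s' T Y = sm T Y" using sm_unique[of s'] by (auto simp: power_space_psp)
  next
    fix T c assume "T \<in> power_space R F" "c \<in> char_space R F"
    then obtain x d where "x \<in> psp" "T = qm x" "d \<in> csp" "c = qo d"
      by (auto simp: power_space_psp char_space_csp)
    then show "sm T (scalar_mat (qma R F) c) = mat_rmult (qma R F) T c"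
      using sm_csp_right[of d x] by (simp add: qm_scalar[symmetric] csp_loc)
  qed (rule bilinear_sm star_formulas_sm complex_algebra_power char_mono)+
qed

end
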